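(* Let $D$ be a division ring with center $F$, let $K$ be a subfield of $D$ (not necessarily contained in $F$), and let $d$ be a positive integer. Assume that $N$ is a noncentral normal subgroup of $D^*$ (that is, $N\not\subseteq F$). If $N$ is left algebraic of bounded degree $d$ over $K$, then $[D:F]\le d^2$.
   Context: $D^*$ denotes the multiplicative group of the division ring $D$, and $[D:F]$ the dimension of $D$ as a vector space over $F$. A subfield of $D$ means a commutative division subring. Given a subfield $K$ of $D$, an element $a\in D$ is left algebraic over $K$ if there is a nonzero polynomial $f(t)=a_nt^n+\dots+a_1t+a_0\in K[t]$ such that $a_na^n+\dots+a_1a+a_0=0$ in $D$ (coefficients written on the left). Its left algebraic degree over $K$ is the smallest degree of a monic polynomial in $K[t]$ with this property. A subset $S\subseteq D$ is left algebraic of bounded degree $d$ over $K$ if every element of $S$ is left algebraic over $K$ of left algebraic degree at most $d$. *)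

theory Defs
  imports "HOL-Algebra.Algebra"
begin

text \<open>
  The axiom on units also excludes the zero ring, in which \<open>\<zero>\<close> is a unit.
\<close>

locale skew_field = ring D for D (structure) +
  assumes skew_field_Units: "Units D = carrier D - {\<zero>}"

definition ring_center :: "('a, 'b) ring_scheme \<Rightarrow> 'a set"
  where "ring_center D = {x \<in> carrier D. \<forall>y \<in> carrier D. x \<otimes>\<^bsub>D\<^esub> y = y \<otimes>\<^bsub>D\<^esub> x}"

text \<open>
  Polynomials are coefficient lists with the leading coefficient first, the zero polynomial
  being \<open>[]\<close>; \<^const>\<open>ring.eval\<close> puts the coefficients to the left of the powers of its argument,
  so its values are the left evaluations also when the coefficients do not commute with the
  argument.
\<close>

context ring
begin

definition left_algebraic :: "'a set \<Rightarrow> 'a \<Rightarrow> bool"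
  where "left_algebraic K a \<longleftrightarrow>
    (\<exists>p. polynomial K p \<and> p \<noteq> [] \<and> eval p a = \<zero>)"

text \<open>Only meaningful for elements that are left algebraic over the subfield \<open>K\<close>.\<close>

definition left_algebraic_degree :: "'a set \<Rightarrow> 'a \<Rightarrow> nat"
  where "left_algebraic_degree K a =
    (LEAST n. \<exists>p. polynomial K p \<and> p \<noteq> [] \<and> lead_coeff p = \<one> \<and> degree p = n \<and> eval p a = \<zero>)"

definition left_algebraic_of_bounded_degree :: "nat \<Rightarrow> 'a set \<Rightarrow> 'a set \<Rightarrow> bool"
  where "left_algebraic_of_bounded_degree d K S \<longleftrightarrow>
    (\<forall>a \<in> S. left_algebraic K a \<and> left_algebraic_degree K a \<le> d)"

end

text \<open>
  The library notions \<^const>\<open>ring.finite_dimension\<close> and \<^const>\<open>ring.dim\<close> are well behaved over a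
  subfield of an arbitrary ring; the centre of a division ring is one.
\<close>

lemma (in skew_field) ring_center_subfield: "subfield (ring_center D) D"
proof (rule subfieldI)
  let ?F = "ring_center D"
  have inverse_central: "inv x \<in> ?F" if x: "x \<in> ?F" "x \<noteq> \<zero>" for x
  proof -
    have U: "x \<in> Units D"
      using x by (simp add: ring_center_def skew_field_Units)
    then have C: "x \<in> carrier D" "inv x \<in> carrier D"
      by auto
    have "inv x \<otimes> y = y \<otimes> inv x" if y: "y \<in> carrier D" for y
    proof -
      have "inv x \<otimes> y = inv x \<otimes> (y \<otimes> x) \<otimes> inv x"
        using U C y by (simp add: m_assoc)
      also have "\<dots> = inv x \<otimes> (x \<otimes> y) \<otimes> inv x"
        using x y by (simp add: ring_center_def)
      also have "\<dots> = y \<otimes> inv x"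
        using U C y by (simp add: m_assoc [symmetric])
      finally show ?thesis .
    qed
    then show ?thesis
      using U by (simp add: ring_center_def)
  qed
  have mult_closed: "x \<otimes> y \<in> ?F" if x: "x \<in> ?F" and y: "y \<in> ?F" for x y
  proof -
    have C: "x \<in> carrier D" "y \<in> carrier D"
      using x y by (auto simp: ring_center_def)
    have "x \<otimes> y \<otimes> z = z \<otimes> (x \<otimes> y)" if z: "z \<in> carrier D" for z
    proof -
      have comm: "x \<otimes> z = z \<otimes> x" "y \<otimes> z = z \<otimes> y"
        using x y z unfolding ring_center_def by blast+
      have "x \<otimes> y \<otimes> z = x \<otimes> (z \<otimes> y)"
        using m_assoc [OF C z] comm(2) by simp
      also have "\<dots> = z \<otimes> x \<otimes> y"
        using m_assoc [OF C(1) z C(2)] comm(1) by simp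
      also have "\<dots> = z \<otimes> (x \<otimes> y)"
        by (rule m_assoc [OF z C])
      finally show ?thesis .
    qed
    then show ?thesis
      using C by (simp add: ring_center_def)
  qed
  have "subring ?F D"
    by (rule subringI)
      (auto simp: mult_closed, auto simp: ring_center_def l_minus r_minus l_distr r_distr)
  then show "subcring ?F D"
    by (rule subcringI) (unfold ring_center_def, blast)
  show "Units (D\<lparr>carrier := ?F\<rparr>) = ?F - {\<zero>}"
  proof
    have "Units (D\<lparr>carrier := ?F\<rparr>) \<subseteq> Units D"
      unfolding Units_def ring_center_def by simp blast
    then show "Units (D\<lparr>carrier := ?F\<rparr>) \<subseteq> ?F - {\<zero>}"
      using skew_field_Units by (auto simp: Units_def)
    show "?F - {\<zero>} \<subseteq> Units (D\<lparr>carrier := ?F\<rparr>)"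
    proof
      fix x assume x: "x \<in> ?F - {\<zero>}"
      then have "x \<in> Units D"
        by (simp add: ring_center_def skew_field_Units)
      then have "inv x \<otimes> x = \<one>" "x \<otimes> inv x = \<one>"
        by simp_all
      then show "x \<in> Units (D\<lparr>carrier := ?F\<rparr>)"
        using x inverse_central [of x] unfolding Units_def by auto
    qed
  qed
qed

end

theory Submission
  imports Defs
begin

text \<open>
  For \<open>n \<in> N\<close> and \<open>w \<noteq> 0\<close>, the conjugate \<open>w n w\<inverse>\<close> is left algebraic over \<open>K\<close> exactly when the
  vectors \<open>w n^i\<close> are dependent in the left \<open>K\<close>-space \<open>D\<close>, so \<open>D\<close> is a torsion \<open>K[X]\<close>-module, with
  \<open>X\<close> acting as right multiplication by \<open>n\<close>, in which all orders have degree at most \<open>d\<close>.  A single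
  polynomial of degree at most \<open>d\<close> then annihilates \<open>D\<close>, and Artin's argument turns it into an
  algebraic relation of \<open>n\<close> over the center \<open>F\<close>.

  If \<open>F\<close> is infinite, let \<open>a \<in> N\<close> have maximal degree \<open>r \<le> d\<close> over \<open>F\<close>, with minimal polynomial \<open>f\<close>, and
  let \<open>\<Delta>\<close> be the derivative of \<open>x \<mapsto> f(x)\<close> at \<open>a\<close>; it is a nonzero bimodule map from \<open>D\<close> to the
  centralizer \<open>C\<close> of \<open>a\<close>.  Since the degree cannot grow along the families
  \<open>(1 - s y) a b\<inverse> (1 - s y)\<inverse> b\<close> with \<open>s \<in> F\<close> and \<open>b, y \<in> N\<close>, the map \<open>\<Delta>\<close> sends their tangents to
  \<open>F(a)\<close>.  As \<open>N\<close> spans \<open>D\<close> over \<open>F\<close>, all of \<open>D\<close> is sent to \<open>F(a)\<close>; hence \<open>C = F(a)\<close> and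
  \<open>[D:F] = r\<^sup>2\<close>.  If \<open>F\<close> is finite, then \<open>N\<close> is torsion, and for a noncentral \<open>u \<in> N\<close> some
  \<open>x\<close> normalizes the finite field \<open>F(u)\<close> without centralizing it.  Torsion of the commutator of \<open>1 + x\<close>
  and \<open>u\<close> makes \<open>x\<close> torsion, which is impossible as in Wedderburn's theorem on finite division rings.
\<close>

section \<open>Torsion modules of bounded degree over a principal domain\<close>

text \<open>After the first reduction \<open>K\<close> is gone: every element of \<open>N\<close>
  has degree at most the same \<open>d\<close> over F, because the annihilator of the whole module
  is the order of a single vector. \<open>N\<close> is closed under products and conjugation but not
  under sums, so perturbations of a must be built multiplicatively. Conjugating a by 1 - s y alone
  yields nothing: its tangent a y - y a is killed by \<Delta>, as \<Delta>(a y) = \<Delta>(y a). The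
  extra factor b is what gives informative tangents: for y = b z, \<Delta> takes the same value on
  the tangent as on a (z b - b z). Once \<Delta> has values in F(a), its linearity under left
  multiplication by C forces C into F(a), since some value of \<Delta> is invertible. A finite
  center offers too few parameters s, and that case is shown not to occur. The normalizing x need
  not lie in \<open>N\<close>, so its torsion is not given. The commutator n of 1 + x and u does lie
  in \<open>N\<close>, and the inverse of n - 1 is of degree one in the inverse of x over F(u); this
  carries the finiteness of F(n) over to x.\<close>

lemma module_common_annihilator:
  fixes P (structure) and M :: "('c, 'd, 'e) module_scheme" and deg :: "'c \<Rightarrow> nat"
  assumes "principal_domain P" and "module P M"
    and deg_mult: "\<And>p q. \<lbrakk>p \<in> carrier P - {\<zero>}; q \<in> carrier P - {\<zero>}\<rbrakk> \<Longrightarrow> deg (p \<otimes> q) = deg p + deg q"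
    and deg_unit: "\<And>p. \<lbrakk>p \<in> carrier P - {\<zero>}; deg p = 0\<rbrakk> \<Longrightarrow> p \<in> Units P"
    and torsion: "\<And>v. v \<in> carrier M \<Longrightarrow>
      \<exists>p \<in> carrier P - {\<zero>}. deg p \<le> d \<and> p \<odot>\<^bsub>M\<^esub> v = \<zero>\<^bsub>M\<^esub>"
  shows "\<exists>p \<in> carrier P - {\<zero>}. deg p \<le> d \<and> (\<forall>v \<in> carrier M. p \<odot>\<^bsub>M\<^esub> v = \<zero>\<^bsub>M\<^esub>)"
proof -
  interpret principal_domain P by fact
  interpret M: module P M by fact
  \<comment> \<open>A relation rather than a function, since a generator of the annihilator of
    \<open>v\<close> is only determined up to a unit.\<close>
  define ord where "ord v p \<longleftrightarrow> p \<in> carrier P - {\<zero>} \<and>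
    (\<forall>q \<in> carrier P. q \<odot>\<^bsub>M\<^esub> v = \<zero>\<^bsub>M\<^esub> \<longleftrightarrow> p divides q)" for v p
  have cancel: "b = c" if "a \<otimes> b = a \<otimes> c" "a \<noteq> \<zero>" "a \<in> carrier P" "b \<in> carrier P" "c \<in> carrier P" for a b c
    using that m_lcancel by blast
  have smult_zero: "p \<odot>\<^bsub>M\<^esub> \<zero>\<^bsub>M\<^esub> = \<zero>\<^bsub>M\<^esub>" if "p \<in> carrier P" for p
    using that by (rule M.smult_r_null)
  have deg_le: "deg p \<le> deg q" if pq: "p divides q" "p \<in> carrier P" "q \<in> carrier P - {\<zero>}" for p q
  proof -
    obtain c where c: "c \<in> carrier P" "q = p \<otimes> c"
      using pq(1) unfolding factor_def by blast
    have "p \<otimes> c \<noteq> \<zero>" using pq(3) c(2) by blast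
    then have "p \<noteq> \<zero>" "c \<noteq> \<zero>"
      using l_null[OF c(1)] r_null[OF pq(2)] by blast+
    then have "deg q = deg p + deg c" unfolding c(2) using c(1) pq(2) by (intro deg_mult) blast+
    then show ?thesis by simp
  qed
  have ord_exists: "\<exists>p. ord v p \<and> deg p \<le> d" if v: "v \<in> carrier M" for v
  proof -
    let ?I = "{q \<in> carrier P. q \<odot>\<^bsub>M\<^esub> v = \<zero>\<^bsub>M\<^esub>}"
    have "ideal ?I P"
    proof (rule idealI)
      show "ring P" by (rule ring_axioms)
      show "subgroup ?I (add_monoid P)"
      proof (rule add.subgroupI)
        show "?I \<noteq> {}" using v M.smult_l_null by force
        show "\<ominus> a \<in> ?I" if "a \<in> ?I" for a
          using that v M.smult_l_minus[of a v] by auto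
        show "a \<oplus> b \<in> ?I" if "a \<in> ?I" "b \<in> ?I" for a b
          using that v M.smult_l_distr[of a b v] by auto
      qed auto
      fix a x assume a: "a \<in> ?I" and x: "x \<in> carrier P"
      show "x \<otimes> a \<in> ?I" using a x v M.smult_assoc1[of x a v] smult_zero by auto
      then show "a \<otimes> x \<in> ?I" using a x m_comm by auto
    qed
    then obtain p where p: "p \<in> carrier P" "?I = PIdl p"
      using exists_gen by blast
    then have iff: "q \<odot>\<^bsub>M\<^esub> v = \<zero>\<^bsub>M\<^esub> \<longleftrightarrow> p divides q" if "q \<in> carrier P" for q
    proof -
      have "q \<odot>\<^bsub>M\<^esub> v = \<zero>\<^bsub>M\<^esub> \<longleftrightarrow> q \<in> PIdl p" using that p(2) by blast
      also have "\<dots> \<longleftrightarrow> p divides q"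
        unfolding cgenideal_def factor_def using m_comm p(1) by blast
      finally show ?thesis .
    qed
    obtain q where q: "q \<in> carrier P - {\<zero>}" "deg q \<le> d" "q \<odot>\<^bsub>M\<^esub> v = \<zero>\<^bsub>M\<^esub>"
      using torsion[OF v] by blast
    then have "p divides q" using iff by auto
    moreover have "p \<noteq> \<zero>" using \<open>p divides q\<close> q(1) unfolding factor_def by auto
    ultimately have "ord v p" "deg p \<le> deg q"
      unfolding ord_def using p(1) iff deg_le q(1) by blast+
    then show ?thesis using q(2) by (intro exI[of _ p]) simp
  qed
  have ord_deg: "deg f \<le> d" if vf: "v \<in> carrier M" "ord v f" for v f
  proof -
    obtain p where "ord v p" "deg p \<le> d" using ord_exists[OF vf(1)] by blast
    then show ?thesis using vf deg_le[of f p] unfolding ord_def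
      by (meson DiffD1 divides_refl le_trans)
  qed
  obtain w f where w: "w \<in> carrier M" and f: "ord w f"
    and maximal: "\<And>v g. \<lbrakk>v \<in> carrier M; ord v g\<rbrakk> \<Longrightarrow> deg g \<le> deg f"
  proof -
    obtain f0 where "ord \<zero>\<^bsub>M\<^esub> f0" using ord_exists by blast
    then have "\<exists>x. (fst x \<in> carrier M \<and> ord (fst x) (snd x)) \<and>
        (\<forall>y. fst y \<in> carrier M \<and> ord (fst y) (snd y) \<longrightarrow> deg (snd y) \<le> deg (snd x))"
      by (intro ex_has_greatest_nat[where k = "(\<zero>\<^bsub>M\<^esub>, f0)" and b = "Suc d"]) (auto simp: less_Suc_eq_le intro: ord_deg)
    then show ?thesis using that by auto
  qed
  have fC: "f \<in> carrier P" "f \<noteq> \<zero>" using f unfolding ord_def by auto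
  have fw: "f \<odot>\<^bsub>M\<^esub> w = \<zero>\<^bsub>M\<^esub>" using f fC unfolding ord_def by auto
  have "f \<odot>\<^bsub>M\<^esub> u = \<zero>\<^bsub>M\<^esub>" if u0: "u \<in> carrier M" for u
  proof (rule ccontr)
    assume u0': "f \<odot>\<^bsub>M\<^esub> u \<noteq> \<zero>\<^bsub>M\<^esub>"
    \<comment> \<open>Among the vectors not killed by \<open>f\<close>, one whose order
      \<open>g\<close> has least degree is chosen. This minimality does the work of a prime
      factorization: it will make \<open>f'\<close>, the cofactor of the gcd of \<open>f\<close> and
      \<open>g\<close> in \<open>f\<close>, coprime to \<open>g\<close> itself.\<close>
    let ?R = "\<lambda>n. \<exists>u \<in> carrier M. f \<odot>\<^bsub>M\<^esub> u \<noteq> \<zero>\<^bsub>M\<^esub> \<and> (\<exists>g. ord u g \<and> deg g = n)"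
    obtain n where "?R n" using ord_exists[OF u0] u0 u0' by blast
    then have "?R (Least ?R)" by (rule LeastI)
    then obtain u g where u: "u \<in> carrier M" and fu: "f \<odot>\<^bsub>M\<^esub> u \<noteq> \<zero>\<^bsub>M\<^esub>"
      and g: "ord u g" and least: "deg g = Least ?R" by blast
    have minimal: "f \<odot>\<^bsub>M\<^esub> v = \<zero>\<^bsub>M\<^esub>" if "v \<in> carrier M" "ord v h" "deg h < deg g" for v h
      using not_less_Least[of "deg h" ?R] that least by auto
    have gC: "g \<in> carrier P" "g \<noteq> \<zero>" using g unfolding ord_def by auto
    have gu: "g \<odot>\<^bsub>M\<^esub> u = \<zero>\<^bsub>M\<^esub>" using g gC unfolding ord_def by auto
    have kill_u: "g divides q" if "q \<in> carrier P" "q \<odot>\<^bsub>M\<^esub> u = \<zero>\<^bsub>M\<^esub>" for q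
      using that g unfolding ord_def by auto
    have bezout: "\<exists>k x y s t. k \<in> carrier P \<and> k \<noteq> \<zero> \<and> x \<in> carrier P \<and> y \<in> carrier P \<and> s \<in> carrier P
        \<and> t \<in> carrier P \<and> a = k \<otimes> x \<and> b = k \<otimes> y \<and> \<one> = s \<otimes> x \<oplus> t \<otimes> y"
      if ab: "a \<in> carrier P" "b \<in> carrier P" "b \<noteq> \<zero>" for a b
    proof -
      obtain k where k: "k \<in> carrier P" "PIdl a <+>\<^bsub>P\<^esub> PIdl b = PIdl k"
        using exists_gen[OF add_ideals[OF cgenideal_ideal[OF ab(1)] cgenideal_ideal[OF ab(2)]]] by blast
      have mem: "z \<in> PIdl k \<longleftrightarrow> (\<exists>s\<in>carrier P. \<exists>t\<in>carrier P. z = s \<otimes> a \<oplus> t \<otimes> b)" for z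
      proof -
        have "z \<in> PIdl k \<longleftrightarrow> z \<in> PIdl a <+>\<^bsub>P\<^esub> PIdl b" using k(2) by simp
        also have "\<dots> \<longleftrightarrow> (\<exists>s\<in>carrier P. \<exists>t\<in>carrier P. z = s \<otimes> a \<oplus> t \<otimes> b)"
          unfolding set_add_def' cgenideal_def by blast
        finally show ?thesis .
      qed
      have "a \<in> PIdl k" unfolding mem using ab by (intro bexI[of _ \<one>] bexI[of _ \<zero>]) auto
      then obtain x where x: "x \<in> carrier P" "a = k \<otimes> x"
        unfolding cgenideal_def using m_comm k(1) by blast
      have "b \<in> PIdl k" unfolding mem using ab by (intro bexI[of _ \<one>] bexI[of _ \<zero>]) auto
      then obtain y where y: "y \<in> carrier P" "b = k \<otimes> y"
        unfolding cgenideal_def using m_comm k(1) by blast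
      have k0: "k \<noteq> \<zero>" using ab y by auto
      have "k \<in> PIdl k" using cgenideal_self k(1) by simp
      then obtain s t where st: "s \<in> carrier P" "t \<in> carrier P" "k = s \<otimes> a \<oplus> t \<otimes> b"
        unfolding mem by blast
      have "k \<otimes> \<one> = k \<otimes> (s \<otimes> x \<oplus> t \<otimes> y)"
        using st x y k(1) by (simp add: r_distr m_lcomm)
      then have "\<one> = s \<otimes> x \<oplus> t \<otimes> y" by (rule cancel) (use k0 k(1) st(1,2) x(1) y(1) in simp_all)
      then show ?thesis using k(1) k0 x y st by blast
    qed
    obtain k f' q s t where k: "k \<in> carrier P" "k \<noteq> \<zero>" and C: "f' \<in> carrier P" "q \<in> carrier P" "s \<in> carrier P" "t \<in> carrier P"
      and eqs: "f = k \<otimes> f'" "g = k \<otimes> q" "\<one> = s \<otimes> f' \<oplus> t \<otimes> q"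
      using bezout[OF fC(1) gC] by blast
    have q_nonunit: "\<not> q divides \<one>"
    proof
      assume "q divides \<one>"
      then obtain c where c: "c \<in> carrier P" "\<one> = q \<otimes> c" unfolding factor_def by auto
      have "f = k \<otimes> (q \<otimes> c) \<otimes> f'" using eqs(1) c(2)[symmetric] k C by simp
      also have "\<dots> = (f' \<otimes> c) \<otimes> g" using eqs(2) k C c(1) by (simp add: m_ac)
      finally have "f \<odot>\<^bsub>M\<^esub> u = (f' \<otimes> c) \<odot>\<^bsub>M\<^esub> (g \<odot>\<^bsub>M\<^esub> u)"
        using M.smult_assoc1[of "f' \<otimes> c" g u] C c(1) gC u by simp
      then show False using fu gu smult_zero C c(1) by simp
    qed
    have q0: "q \<noteq> \<zero>" using eqs(2) k gC by auto
    have f'0: "f' \<noteq> \<zero>" using eqs(1) k fC by auto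
    obtain e f3 g' s2 t2 where e: "e \<in> carrier P" "e \<noteq> \<zero>" and C2: "f3 \<in> carrier P" "g' \<in> carrier P" "s2 \<in> carrier P" "t2 \<in> carrier P"
      and eqs2: "f' = e \<otimes> f3" "g = e \<otimes> g'" "\<one> = s2 \<otimes> f3 \<oplus> t2 \<otimes> g'"
      using bezout[OF C(1) gC] by blast
    have g'0: "g' \<noteq> \<zero>" using eqs2(2) e gC by auto
    \<comment> \<open>If the gcd \<open>e\<close> of \<open>f'\<close> and \<open>g\<close> were no
      unit, \<open>e u\<close> would have the order \<open>g'\<close> of smaller degree and hence be
      killed by \<open>f\<close>. Then \<open>g'\<close> divides \<open>f\<close> as well as
      \<open>g\<close>, so it divides their gcd \<open>k\<close>. This makes \<open>q\<close> a
      divisor of \<open>e\<close> and so of \<open>f'\<close>; being coprime to \<open>f'\<close>,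
      \<open>q\<close> would be a unit.\<close>
    have e_unit: "e \<in> Units P"
    proof (rule ccontr)
      assume "e \<notin> Units P"
      then have "deg e > 0" using deg_unit e by blast
      then have less: "deg g' < deg g" using deg_mult e g'0 C2 eqs2(2) by simp
      have eu: "e \<odot>\<^bsub>M\<^esub> u \<in> carrier M" using e u by simp
      have "ord (e \<odot>\<^bsub>M\<^esub> u) g'"
        unfolding ord_def
      proof (intro conjI ballI)
        show "g' \<in> carrier P - {\<zero>}" using g'0 C2 by simp
        fix p assume p: "p \<in> carrier P"
        have "p \<odot>\<^bsub>M\<^esub> (e \<odot>\<^bsub>M\<^esub> u) = \<zero>\<^bsub>M\<^esub> \<longleftrightarrow> (p \<otimes> e) \<odot>\<^bsub>M\<^esub> u = \<zero>\<^bsub>M\<^esub>"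
          using M.smult_assoc1 p e u by simp
        also have "\<dots> \<longleftrightarrow> g divides (p \<otimes> e)" using g p e unfolding ord_def by auto
        also have "\<dots> \<longleftrightarrow> g' divides p"
        proof
          assume "g divides p \<otimes> e"
          then obtain c where c: "c \<in> carrier P" "p \<otimes> e = e \<otimes> g' \<otimes> c" unfolding factor_def eqs2 by auto
          then have "e \<otimes> p = e \<otimes> (g' \<otimes> c)" using e p C2 by (simp add: m_ac)
          then have "p = g' \<otimes> c" by (rule cancel) (use e p C2 c(1) in simp_all)
          then show "g' divides p" using c unfolding factor_def by auto
        next
          assume "g' divides p"
          then obtain c where c: "c \<in> carrier P" "p = g' \<otimes> c" unfolding factor_def by auto
          then have "p \<otimes> e = g \<otimes> c" using eqs2(2) e C2 by (simp add: m_ac)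
          then show "g divides p \<otimes> e" using c unfolding factor_def by auto
        qed
        finally show "p \<odot>\<^bsub>M\<^esub> (e \<odot>\<^bsub>M\<^esub> u) = \<zero>\<^bsub>M\<^esub> \<longleftrightarrow> g' divides p" .
      qed
      then have "f \<odot>\<^bsub>M\<^esub> (e \<odot>\<^bsub>M\<^esub> u) = \<zero>\<^bsub>M\<^esub>" using minimal[OF eu _ less] by blast
      then have "(f \<otimes> e) \<odot>\<^bsub>M\<^esub> u = \<zero>\<^bsub>M\<^esub>" using M.smult_assoc1 fC e u by simp
      then obtain c where c: "c \<in> carrier P" "f \<otimes> e = g \<otimes> c"
        using kill_u fC e unfolding factor_def by blast
      then have "e \<otimes> f = e \<otimes> (g' \<otimes> c)" using e fC C2 eqs2(2) by (simp add: m_ac)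
      then have fg': "f = g' \<otimes> c" by (rule cancel) (use e fC(1) C2 c(1) in simp_all)
      have "k = k \<otimes> (s \<otimes> f' \<oplus> t \<otimes> q)" using eqs(3)[symmetric] k by simp
      also have "\<dots> = s \<otimes> f \<oplus> t \<otimes> g" using eqs(1,2) k C by (simp add: r_distr m_lcomm)
      also have "\<dots> = g' \<otimes> (s \<otimes> c \<oplus> t \<otimes> e)"
        using fg' eqs2(2) C C2 c e by (simp add: r_distr m_lcomm m_comm)
      finally have kl: "k = g' \<otimes> (s \<otimes> c \<oplus> t \<otimes> e)" .
      define l where "l = s \<otimes> c \<oplus> t \<otimes> e"
      have l: "l \<in> carrier P" unfolding l_def using C c e by simp
      have "g' \<otimes> e = g' \<otimes> (l \<otimes> q)"
        using eqs(2) eqs2(2) kl C C2 e l unfolding l_def[symmetric] by (simp add: m_ac)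
      then have elq: "e = l \<otimes> q" by (rule cancel) (use e(1) g'0 l C C2 in simp_all)
      have "\<one> = q \<otimes> (s \<otimes> l \<otimes> f3 \<oplus> t)"
        unfolding eqs(3) eqs2(1) elq using C C2 l by (simp add: r_distr m_ac)
      then show False using q_nonunit C C2 l unfolding factor_def by auto
    qed
    define s3 t3 where "s3 = s2 \<otimes> inv e" and "t3 = t2 \<otimes> inv e"
    have C3: "s3 \<in> carrier P" "t3 \<in> carrier P" unfolding s3_def t3_def using C2 e_unit by auto
    have "s3 \<otimes> f' = s2 \<otimes> f3" "t3 \<otimes> g = t2 \<otimes> g'"
      using eqs2(1,2) e_unit C2 e unfolding s3_def t3_def by (simp_all add: m_assoc)
        (metis Units_inv_closed Units_l_inv e(1) l_one m_assoc)+
    then have coprime: "s3 \<otimes> f' \<oplus> t3 \<otimes> g = \<one>" using eqs2(3) by metis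
    \<comment> \<open>\<open>k w\<close> has order \<open>f'\<close>, which is coprime to the order
      \<open>g\<close> of \<open>u\<close>. So the order of the sum is a multiple of
      \<open>f' g\<close>, whose degree exceeds that of \<open>f\<close> by the degree of
      \<open>q\<close>.\<close>
    define v where "v = k \<odot>\<^bsub>M\<^esub> w \<oplus>\<^bsub>M\<^esub> u"
    have v: "v \<in> carrier M" unfolding v_def using k w u by simp
    obtain p where p: "ord v p" using ord_exists[OF v] by blast
    have pC: "p \<in> carrier P" "p \<noteq> \<zero>" using p unfolding ord_def by auto
    have pv: "p \<odot>\<^bsub>M\<^esub> v = \<zero>\<^bsub>M\<^esub>" using p pC unfolding ord_def by auto
    have kw: "(f' \<otimes> p) \<odot>\<^bsub>M\<^esub> (k \<odot>\<^bsub>M\<^esub> w) = \<zero>\<^bsub>M\<^esub>"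
    proof -
      have "(f' \<otimes> p) \<odot>\<^bsub>M\<^esub> (k \<odot>\<^bsub>M\<^esub> w) = (f' \<otimes> p \<otimes> k) \<odot>\<^bsub>M\<^esub> w"
        using M.smult_assoc1[of "f' \<otimes> p" k w] C pC k w by simp
      also have "f' \<otimes> p \<otimes> k = p \<otimes> f" using eqs(1) C pC k by (simp add: m_ac)
      finally show ?thesis using M.smult_assoc1[of p f w] fw pC fC w smult_zero by simp
    qed
    have "(f' \<otimes> p) \<odot>\<^bsub>M\<^esub> v = \<zero>\<^bsub>M\<^esub>" using M.smult_assoc1[of f' p v] pv pC C v smult_zero by simp
    then have "(f' \<otimes> p) \<odot>\<^bsub>M\<^esub> u = \<zero>\<^bsub>M\<^esub>"
      unfolding v_def using M.smult_r_distr[of "f' \<otimes> p" "k \<odot>\<^bsub>M\<^esub> w" u] kw C pC k w u by simp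
    then obtain c where c: "c \<in> carrier P" "f' \<otimes> p = g \<otimes> c"
      using kill_u C pC unfolding factor_def by blast
    have "p = (s3 \<otimes> f' \<oplus> t3 \<otimes> g) \<otimes> p" using coprime pC by simp
    also have "\<dots> = s3 \<otimes> (f' \<otimes> p) \<oplus> t3 \<otimes> g \<otimes> p" using C3 C pC gC by (simp add: l_distr m_assoc)
    also have "\<dots> = g \<otimes> (s3 \<otimes> c \<oplus> t3 \<otimes> p)"
      unfolding c(2) using C3 c pC gC by (simp add: r_distr m_ac)
    finally have peq: "p = g \<otimes> (s3 \<otimes> c \<oplus> t3 \<otimes> p)" .
    obtain p' where p': "p' \<in> carrier P" "p = g \<otimes> p'"
      by (rule that[OF _ peq]) (use C3 c(1) pC in simp)
    have "p = p' \<otimes> g" using p' gC by (simp add: m_comm)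
    then have "p \<odot>\<^bsub>M\<^esub> u = \<zero>\<^bsub>M\<^esub>"
      using M.smult_assoc1[of p' g u] p'(1) gC u gu smult_zero by simp
    then have "p \<odot>\<^bsub>M\<^esub> (k \<odot>\<^bsub>M\<^esub> w) = \<zero>\<^bsub>M\<^esub>"
      using pv unfolding v_def using M.smult_r_distr[of p "k \<odot>\<^bsub>M\<^esub> w" u] pC k w u by simp
    then have "(p \<otimes> k) \<odot>\<^bsub>M\<^esub> w = \<zero>\<^bsub>M\<^esub>" using M.smult_assoc1 pC k w by simp
    then obtain c2 where c2: "c2 \<in> carrier P" "p \<otimes> k = f \<otimes> c2"
      using f pC k unfolding ord_def factor_def by auto
    then have "k \<otimes> p = k \<otimes> (f' \<otimes> c2)" using eqs(1) k C pC by (simp add: m_ac)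
    then have pc2: "p = f' \<otimes> c2" by (rule cancel) (use k pC(1) C c2(1) in simp_all)
    have "p' = (s3 \<otimes> f' \<oplus> t3 \<otimes> g) \<otimes> p'" using coprime p' by simp
    also have "\<dots> = s3 \<otimes> f' \<otimes> p' \<oplus> t3 \<otimes> (f' \<otimes> c2)"
      unfolding pc2[symmetric] p'(2) using C3 C gC p'(1) by (simp add: l_distr m_assoc)
    also have "\<dots> = f' \<otimes> (s3 \<otimes> p' \<oplus> t3 \<otimes> c2)" using C3 C p'(1) c2 by (simp add: r_distr m_ac)
    finally have p'eq: "p' = f' \<otimes> (s3 \<otimes> p' \<oplus> t3 \<otimes> c2)" .
    obtain p2 where p2: "p2 \<in> carrier P" "p' = f' \<otimes> p2"
      by (rule that[OF _ p'eq]) (use C3 c2(1) p'(1) in simp)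
    have p'0: "p' \<noteq> \<zero>" using pC(2) p'(2) gC(1) by auto
    then have p20: "p2 \<noteq> \<zero>" using p2(2) C(1) by auto
    have "deg p = deg g + deg p'" unfolding p'(2) using deg_mult gC p'(1) p'0 by simp
    moreover have "deg p' = deg f' + deg p2" unfolding p2(2) using deg_mult C(1) f'0 p2(1) p20 by simp
    ultimately have "deg p = deg g + (deg f' + deg p2)" by simp
    moreover have "deg g = deg k + deg q" "deg f = deg k + deg f'"
      using eqs(1,2) deg_mult k C q0 f'0 by auto
    moreover have "deg q > 0"
      using q_nonunit deg_unit[of q] q0 C Units_inv_closed Units_r_inv unfolding factor_def
      by (metis DiffI empty_iff gr0I insertE)
    moreover have "deg p \<le> deg f" using maximal[OF v p] .
    ultimately show False by linarith
  qed
  then show ?thesis using fC ord_deg[OF w f] by blast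
qed

section \<open>Relations over a skew field and centralizers\<close>

context ring
begin

lemma exp_base_Suc: "exp_base a (Suc n) = a [^] n # exp_base a n"
  by (simp add: exp_base_def)

lemma length_exp_base [simp]: "length (exp_base a n) = n"
  by (simp add: exp_base_def)

end

context skew_field
begin

abbreviation center where "center \<equiv> ring_center D"

lemma centerD: "c \<in> center \<Longrightarrow> y \<in> carrier D \<Longrightarrow> c \<otimes> y = y \<otimes> c"
  by (simp add: ring_center_def)

lemma center_carrier [simp, intro]: "c \<in> center \<Longrightarrow> c \<in> carrier D"
  by (simp add: ring_center_def)

lemma one_not_zero [simp]: "\<one> \<noteq> \<zero>"
  using Units_one_closed skew_field_Units by auto

lemma inv_facts [simp]:
  assumes "x \<in> carrier D" "x \<noteq> \<zero>"
  shows "inv x \<in> carrier D" "inv x \<otimes> x = \<one>" "x \<otimes> inv x = \<one>" "inv x \<noteq> \<zero>"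
proof -
  have x: "x \<in> Units D" using assms by (simp add: skew_field_Units)
  then show "inv x \<in> carrier D" "inv x \<otimes> x = \<one>" "x \<otimes> inv x = \<one>" by simp_all
  have "inv x \<in> Units D" using x by simp
  then show "inv x \<noteq> \<zero>" by (simp add: skew_field_Units)
qed

lemma inv_cancel [simp]:
  assumes "x \<in> carrier D" "x \<noteq> \<zero>" "y \<in> carrier D"
  shows "inv x \<otimes> (x \<otimes> y) = y" "x \<otimes> (inv x \<otimes> y) = y"
  using assms by (simp_all add: m_assoc[symmetric])

lemma integral_iff:
  assumes "x \<in> carrier D" "y \<in> carrier D"
  shows "x \<otimes> y = \<zero> \<longleftrightarrow> x = \<zero> \<or> y = \<zero>"
proof
  assume xy: "x \<otimes> y = \<zero>"
  show "x = \<zero> \<or> y = \<zero>"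
  proof (rule disjCI)
    assume "y \<noteq> \<zero>"
    have "x = x \<otimes> y \<otimes> inv y" using assms \<open>y \<noteq> \<zero>\<close> by (simp add: m_assoc)
    then show "x = \<zero>" unfolding xy using assms \<open>y \<noteq> \<zero>\<close> by simp
  qed
qed (use assms in auto)

lemma left_cancel:
  assumes "x \<otimes> y = x \<otimes> z" "x \<noteq> \<zero>" "x \<in> carrier D" "y \<in> carrier D" "z \<in> carrier D"
  shows "y = z"
  using assms inv_cancel(1) by metis

lemma right_cancel:
  assumes "y \<otimes> x = z \<otimes> x" "x \<noteq> \<zero>" "x \<in> carrier D" "y \<in> carrier D" "z \<in> carrier D"
  shows "y = z"
proof -
  have "y \<otimes> x \<otimes> inv x = z \<otimes> x \<otimes> inv x" using assms by simp
  then show ?thesis using assms(2-5) by (simp add: m_assoc)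
qed

lemma minus_eq_zero_iff:
  assumes "x \<in> carrier D" "y \<in> carrier D"
  shows "x \<ominus> y = \<zero> \<longleftrightarrow> x = y"
  using assms by (metis minus_eq r_neg minus_equality minus_minus a_inv_closed)

text \<open>Subtracting \<open>y\<close> times a relation at \<open>x\<close> from the same relation
  at \<open>y x\<close> leaves only the commutators of the coefficients with \<open>y\<close>. A
  coefficient \<open>\<one>\<close> disappears in this way, which is what shortens a relation in the
  next proof.\<close>

lemma combine_commutator:
  assumes "set ms \<subseteq> carrier D" "set Us \<subseteq> carrier D" "x \<in> carrier D" "y \<in> carrier D"
  shows "combine (map (\<lambda>m. m \<otimes> y \<ominus> y \<otimes> m) ms) (map ((\<otimes>) x) Us)
    = combine ms (map ((\<otimes>) (y \<otimes> x)) Us) \<ominus> y \<otimes> combine ms (map ((\<otimes>) x) Us)"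
  using assms(1,2)
proof (induction ms Us rule: combine.induct)
  case (1 k Ks u Us)
  define A where "A = combine Ks (map ((\<otimes>) (y \<otimes> x)) Us)"
  define B where "B = combine Ks (map ((\<otimes>) x) Us)"
  have C: "A \<in> carrier D" "B \<in> carrier D" "k \<in> carrier D" "u \<in> carrier D"
    unfolding A_def B_def using 1(2,3) assms(3,4) by (auto simp: subset_eq intro!: combine_in_carrier)
  have IH: "combine (map (\<lambda>m. m \<otimes> y \<ominus> y \<otimes> m) Ks) (map ((\<otimes>) x) Us) = A \<ominus> y \<otimes> B"
    using 1 unfolding A_def B_def by simp
  have "(k \<otimes> y \<ominus> y \<otimes> k) \<otimes> (x \<otimes> u) \<oplus> (A \<ominus> y \<otimes> B)
    = k \<otimes> (y \<otimes> x \<otimes> u) \<oplus> A \<ominus> y \<otimes> (k \<otimes> (x \<otimes> u) \<oplus> B)"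
    using C assms(3,4) by algebra
  then show ?case by (simp add: IH A_def[symmetric] B_def[symmetric])
qed (use assms(4) in \<open>simp_all add: minus_eq\<close>)

text \<open>
  Artin's argument: after normalising one coefficient of a shortest relation to \<open>\<one>\<close>, the
  commutators of the others with \<open>Y\<close> form a shorter relation, so they vanish.
\<close>
lemma centralizer_independent:
  assumes C: "subfield C D" and "Y \<subseteq> carrier D" and "W \<subseteq> carrier D"
    and centralizer: "\<And>z. \<lbrakk>z \<in> carrier D; \<And>y. y \<in> Y \<Longrightarrow> z \<otimes> y = y \<otimes> z\<rbrakk> \<Longrightarrow> z \<in> C"
    and "\<one> \<in> W" and closed: "\<And>y x. y \<in> Y \<Longrightarrow> x \<in> W \<Longrightarrow> y \<otimes> x \<in> W"
    and "independent C Us" and "length ms = length Us" and "set ms \<subseteq> carrier D"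
    and "\<And>x. x \<in> W \<Longrightarrow> combine ms (map ((\<otimes>) x) Us) = \<zero>"
  shows "set ms \<subseteq> {\<zero>}"
  using assms(7-10)
proof (induction Us arbitrary: ms rule: list.induct)
  case Nil
  then show ?case by simp
next
  case (Cons u Us)
  obtain m ms' where ms: "ms = m # ms'" using Cons.prems(2) by (cases ms) auto
  have ind: "independent C Us" and u: "u \<in> carrier D" "u \<notin> Span C Us" and Us: "set Us \<subseteq> carrier D"
    using independent_backwards[OF Cons.prems(1)] independent_in_carrier by blast+
  have mC: "m \<in> carrier D" "set ms' \<subseteq> carrier D" "length ms' = length Us"
    using Cons.prems(2,3) ms by auto
  have rel: "m \<otimes> (x \<otimes> u) \<oplus> combine ms' (map ((\<otimes>) x) Us) = \<zero>" if "x \<in> W" for x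
    using Cons.prems(4)[OF that] ms by simp
  have combine_C: "combine Ks (map ((\<otimes>) x) Us) \<in> carrier D" if "set Ks \<subseteq> carrier D" "x \<in> W" for Ks x
    using that assms(3) Us by (intro combine_in_carrier) auto
  show ?case
  proof (cases "m = \<zero>")
    case True
    have "combine ms' (map ((\<otimes>) x) Us) = \<zero>" if "x \<in> W" for x
    proof -
      have "x \<otimes> u \<in> carrier D" using that assms(3) u by auto
      then show ?thesis using rel[OF that] True combine_C[OF mC(2) that] by simp
    qed
    then have "set ms' \<subseteq> {\<zero>}" using Cons.IH[OF ind] mC by blast
    then show ?thesis using ms True by simp
  next
    case False
    define ns where "ns = map ((\<otimes>) (inv m)) ms'"
    have nsC: "set ns \<subseteq> carrier D" "length ns = length Us" using mC False by (auto simp: ns_def)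
    have rel': "x \<otimes> u \<oplus> combine ns (map ((\<otimes>) x) Us) = \<zero>" if x: "x \<in> W" for x
    proof -
      have xC: "x \<in> carrier D" using x assms(3) by auto
      define B where "B = combine ms' (map ((\<otimes>) x) Us)"
      have B: "B \<in> carrier D" unfolding B_def using combine_C mC x by blast
      have "combine ns (map ((\<otimes>) x) Us) = inv m \<otimes> B"
        unfolding ns_def B_def
        by (rule combine_r_distr[symmetric]) (use mC Us xC False in auto)
      moreover have "inv m \<otimes> (m \<otimes> (x \<otimes> u) \<oplus> B) = x \<otimes> u \<oplus> inv m \<otimes> B"
        using mC False xC u B by (simp add: r_distr)
      ultimately show ?thesis using rel[OF x] mC False by (simp add: B_def)
    qed
    have "set (map (\<lambda>n. n \<otimes> y \<ominus> y \<otimes> n) ns) \<subseteq> {\<zero>}" if y: "y \<in> Y" for y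
    proof (rule Cons.IH[OF ind])
      have yC: "y \<in> carrier D" using y assms(2) by auto
      show "length (map (\<lambda>n. n \<otimes> y \<ominus> y \<otimes> n) ns) = length Us" using nsC by simp
      show "set (map (\<lambda>n. n \<otimes> y \<ominus> y \<otimes> n) ns) \<subseteq> carrier D" using nsC yC by auto
      fix x assume x: "x \<in> W"
      then have xC: "x \<in> carrier D" using assms(3) by auto
      define A where "A = combine ns (map ((\<otimes>) (y \<otimes> x)) Us)"
      define B where "B = combine ns (map ((\<otimes>) x) Us)"
      have AB: "A \<in> carrier D" "B \<in> carrier D"
        unfolding A_def B_def using combine_C nsC(1) x closed[OF y x] by blast+
      have 1: "y \<otimes> x \<otimes> u \<oplus> A = \<zero>" using rel'[OF closed[OF y x]] by (simp add: A_def)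
      have 2: "x \<otimes> u \<oplus> B = \<zero>" using rel'[OF x] by (simp add: B_def)
      have "A \<ominus> y \<otimes> B = (y \<otimes> x \<otimes> u \<oplus> A) \<ominus> y \<otimes> (x \<otimes> u \<oplus> B)"
        using AB yC xC u by algebra
      then have "A \<ominus> y \<otimes> B = \<zero>" unfolding 1 2 using yC by (simp add: minus_eq)
      then show "combine (map (\<lambda>n. n \<otimes> y \<ominus> y \<otimes> n) ns) (map ((\<otimes>) x) Us) = \<zero>"
        using combine_commutator[OF nsC(1) Us xC yC] by (simp add: A_def B_def)
    qed
    then have "n \<otimes> y = y \<otimes> n" if "n \<in> set ns" "y \<in> Y" for n y
    proof -
      have "n \<otimes> y \<ominus> y \<otimes> n = \<zero>" using \<open>\<And>y. y \<in> Y \<Longrightarrow> _\<close>[OF that(2)] that(1) by auto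
      moreover have "n \<in> carrier D" "y \<in> carrier D" using nsC(1) that assms(2) by auto
      ultimately show ?thesis using minus_eq_zero_iff[of "n \<otimes> y" "y \<otimes> n"] by simp
    qed
    then have "set ns \<subseteq> C" using centralizer nsC(1) by blast
    moreover have "combine (\<one> # ns) (u # Us) = \<zero>"
    proof -
      have "map ((\<otimes>) \<one>) Us = Us" using Us by (intro map_idI) auto
      then show ?thesis using rel'[OF \<open>\<one> \<in> W\<close>] u by simp
    qed
    moreover have "\<one> \<in> C" using subringE(3)[OF subfieldE(1)[OF C]] .
    ultimately have "dependent C (u # Us)"
      using non_trivial_combine_imp_dependent[OF C, of "\<one> # ns" "u # Us"] by simp
    then show ?thesis using Cons.prems(1) by blast
  qed
qed

corollary center_independent:
  assumes "independent center Us" and "length ms = length Us" and "set ms \<subseteq> carrier D"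
    and "\<And>x. x \<in> carrier D \<Longrightarrow> combine ms (map ((\<otimes>) x) Us) = \<zero>"
  shows "set ms \<subseteq> {\<zero>}"
proof (rule centralizer_independent[OF ring_center_subfield order_refl order_refl _ one_closed m_closed assms])
  show "z \<in> center" if "z \<in> carrier D" "\<And>y. y \<in> carrier D \<Longrightarrow> z \<otimes> y = y \<otimes> z" for z
    unfolding ring_center_def using that by blast
qed

text \<open>Gaussian elimination with the unknowns as left factors, so that equations are combined
  with factors on the right. The members of \<open>fs\<close> are mere assignments of values, not
  linear maps, which lets the eliminated equations serve as the new list in the induction.\<close>

lemma homogeneous_system:
  assumes "length fs < length vs" and "\<And>f v. \<lbrakk>f \<in> set fs; v \<in> set vs\<rbrakk> \<Longrightarrow> f v \<in> carrier D"
  shows "\<exists>cs. length cs = length vs \<and> set cs \<subseteq> carrier D \<and> \<not> set cs \<subseteq> {\<zero>} \<and>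
    (\<forall>f \<in> set fs. combine cs (map f vs) = \<zero>)"
  using assms
proof (induction "length fs" arbitrary: fs vs)
  case 0
  then show ?case
    by (intro exI[of _ "replicate (length vs) \<one>"]) auto
next
  case (Suc n)
  obtain f fs' where fs: "fs = f # fs'" "length fs' = n" using Suc.hyps(2) by (cases fs) auto
  have C: "g w \<in> carrier D" if "g \<in> set fs" "w \<in> set vs" for g w
    using Suc.prems(2) that .
  show ?case
  proof (cases "\<forall>v \<in> set vs. f v = \<zero>")
    case True
    obtain cs where cs: "length cs = length vs" "set cs \<subseteq> carrier D" "\<not> set cs \<subseteq> {\<zero>}"
      "\<forall>f \<in> set fs'. combine cs (map f vs) = \<zero>"
      using Suc.hyps(1)[of fs' vs] Suc.prems fs by auto
    have "combine cs (map f vs) = \<zero>"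
      using cs(1,2) True by (induction cs vs rule: list_induct2) auto
    then show ?thesis using cs fs by auto
  next
    case False
    then obtain v where v: "v \<in> set vs" "f v \<noteq> \<zero>" by auto
    obtain vs1 vs2 where vs: "vs = vs1 @ v # vs2" using v(1) split_list by fastforce
    have fv: "f v \<in> carrier D" using C v fs by auto
    \<comment> \<open>With the right factor \<open>t g\<close>, subtracting the pivot equation
      \<open>f\<close> from \<open>g\<close> clears the column of \<open>v\<close>. The coefficient
      \<open>c\<close> of \<open>v\<close> is solved from the pivot equation afterwards.\<close>
    define t where "t g = inv (f v) \<otimes> g v" for g
    have t: "t g \<in> carrier D" if "g \<in> set fs" for g
      unfolding t_def using C that v fv by simp
    define e where "e g w = g w \<ominus> f w \<otimes> t g" for g w
    have combine_e: "combine cs (map (e g) ws) = combine cs (map g ws) \<ominus> combine cs (map f ws) \<otimes> t g"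
      if "length cs = length ws" "set cs \<subseteq> carrier D" "g \<in> set fs" "set ws \<subseteq> set vs" for cs ws g
      using that
    proof (induction cs ws rule: list_induct2)
      case Nil
      then show ?case using t by (simp add: minus_eq)
    next
      case (Cons c cs w ws)
      define A where "A = combine cs (map g ws)"
      define B where "B = combine cs (map f ws)"
      have "A \<in> carrier D" "B \<in> carrier D"
        unfolding A_def B_def using Cons.prems C fs by (auto simp: subset_eq intro!: combine_in_carrier)
      moreover have "g w \<in> carrier D" "f w \<in> carrier D" "c \<in> carrier D" "t g \<in> carrier D"
        using Cons.prems C fs t by auto
      ultimately have "c \<otimes> (g w \<ominus> f w \<otimes> t g) \<oplus> (A \<ominus> B \<otimes> t g)
        = c \<otimes> g w \<oplus> A \<ominus> (c \<otimes> f w \<oplus> B) \<otimes> t g"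
        by algebra
      then show ?case using Cons by (simp add: A_def B_def e_def)
    qed
    have "\<exists>cs. length cs = length (vs1 @ vs2) \<and> set cs \<subseteq> carrier D \<and> \<not> set cs \<subseteq> {\<zero>} \<and>
      (\<forall>g \<in> set (map e fs'). combine cs (map g (vs1 @ vs2)) = \<zero>)"
    proof (rule Suc.hyps(1))
      show "length (map e fs') < length (vs1 @ vs2)" using Suc.prems(1) vs fs by simp
      show "n = length (map e fs')" using fs by simp
      show "h w \<in> carrier D" if "h \<in> set (map e fs')" "w \<in> set (vs1 @ vs2)" for h w
        using that C fs t vs unfolding e_def by auto
    qed
    then obtain cs where cs: "length cs = length (vs1 @ vs2)" "set cs \<subseteq> carrier D" "\<not> set cs \<subseteq> {\<zero>}"
      "\<And>g. g \<in> set fs' \<Longrightarrow> combine cs (map (e g) (vs1 @ vs2)) = \<zero>"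
      by auto
    define cs1 cs2 where "cs1 = take (length vs1) cs" and "cs2 = drop (length vs1) cs"
    have cs12: "cs = cs1 @ cs2" "length cs1 = length vs1" "length cs2 = length vs2"
      unfolding cs1_def cs2_def using cs(1) by auto
    have csC: "set cs1 \<subseteq> carrier D" "set cs2 \<subseteq> carrier D" using cs(2) cs12 by auto
    define S where "S g = combine cs (map g (vs1 @ vs2))" for g
    have SC: "S g \<in> carrier D" if "g \<in> set fs" for g
      unfolding S_def using cs(2) C[OF that] vs by (intro combine_in_carrier) auto
    define c where "c = \<ominus> (S f \<otimes> inv (f v))"
    have c: "c \<in> carrier D" unfolding c_def using SC fs fv v by simp
    have total: "combine (cs1 @ c # cs2) (map g vs) = S g \<oplus> c \<otimes> g v" if g: "g \<in> set fs" for g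
    proof -
      define A where "A = combine cs1 (map g vs1)"
      define B where "B = combine cs2 (map g vs2)"
      have AB: "A \<in> carrier D" "B \<in> carrier D" "g v \<in> carrier D"
        unfolding A_def B_def using csC C[OF g] vs by (auto intro!: combine_in_carrier)
      have "combine (cs1 @ c # cs2) (map g vs) = A \<oplus> (c \<otimes> g v \<oplus> B)"
        unfolding vs A_def B_def using cs12 csC c C[OF g] vs
        by (simp, subst combine_append[symmetric]) auto
      moreover have "S g = A \<oplus> B"
        unfolding S_def A_def B_def cs12(1) using cs12(2,3) csC C[OF g] vs
        by (simp, subst combine_append[symmetric]) auto
      ultimately show ?thesis using AB c by (simp add: a_ac)
    qed
    have "combine (cs1 @ c # cs2) (map g vs) = \<zero>" if g: "g \<in> set fs" for g
    proof (cases "g = f")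
      case True
      then show ?thesis using total[OF g] SC[OF g] fv v(2)
        by (simp add: c_def l_minus m_assoc r_neg)
    next
      case False
      then have "g \<in> set fs'" using g fs by auto
      moreover have "set (vs1 @ vs2) \<subseteq> set vs" using vs by auto
      ultimately have "S g \<ominus> S f \<otimes> t g = \<zero>"
        using cs(4) combine_e[OF cs(1,2) g] unfolding S_def by metis
      moreover have "c \<otimes> g v = \<ominus> (S f \<otimes> t g)"
        unfolding c_def t_def using SC fs fv v C[OF g v(1)] by (simp add: l_minus m_assoc)
      ultimately show ?thesis using total[OF g] by (simp add: minus_eq)
    qed
    moreover have "\<not> set (cs1 @ c # cs2) \<subseteq> {\<zero>}" using cs(3) cs12(1) by auto
    ultimately show ?thesis
      using c csC cs12 vs by (intro exI[of _ "cs1 @ c # cs2"]) auto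
  qed
qed

end

section \<open>From left algebraic conjugates to algebraicity over the center\<close>

context skew_field
begin

lemma pow_zero_iff: "a \<in> carrier D \<Longrightarrow> a [^] (n::nat) = \<zero> \<longleftrightarrow> a = \<zero> \<and> n > 0"
  by (induction n) (auto simp: integral_iff)

lemma conj_pow:
  assumes "w \<in> carrier D" "w \<noteq> \<zero>" "a \<in> carrier D"
  shows "(w \<otimes> a \<otimes> inv w) [^] (n::nat) = w \<otimes> a [^] n \<otimes> inv w"
proof (induction n)
  case (Suc n)
  then show ?case using assms by (simp add: m_assoc)
qed (use assms in simp)

text \<open>The action of \<open>p\<close> on \<open>w\<close> when the indeterminate acts as right
  multiplication by \<open>a\<close>. Writing it with \<open>combine\<close> and
  \<open>exp_base\<close> makes an annihilating polynomial literally a relation of the kind treated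
  in \<open>center_independent\<close>.\<close>

definition twisted_eval :: "'a \<Rightarrow> 'a list \<Rightarrow> 'a \<Rightarrow> 'a" where
  "twisted_eval a p w = combine p (map ((\<otimes>) w) (exp_base a (length p)))"

lemma twisted_eval_Nil [simp]: "twisted_eval a [] w = \<zero>"
  by (simp add: twisted_eval_def)

lemma twisted_eval_Cons:
  "twisted_eval a (c # p) w = c \<otimes> (w \<otimes> a [^] length p) \<oplus> twisted_eval a p w"
  by (simp add: twisted_eval_def exp_base_Suc)

lemma twisted_eval_closed [simp]:
  assumes "set p \<subseteq> carrier D" "a \<in> carrier D" "w \<in> carrier D"
  shows "twisted_eval a p w \<in> carrier D"
  using assms by (induction p) (auto simp: twisted_eval_Cons)

text \<open>Pulling \<open>w\<close> from the right of a power of its conjugate to the left turns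
  that power into a power of \<open>a\<close>. This links annihilators of the vector
  \<open>w\<close> with left relations of the conjugate of \<open>a\<close> by
  \<open>w\<close>.\<close>

lemma twisted_eval_eq:
  assumes "set p \<subseteq> carrier D" "a \<in> carrier D" "w \<in> carrier D" "w \<noteq> \<zero>"
  shows "twisted_eval a p w = eval p (w \<otimes> a \<otimes> inv w) \<otimes> w"
  using assms(1)
proof (induction p)
  case (Cons c p)
  define b where "b = w \<otimes> a \<otimes> inv w"
  have b: "b \<in> carrier D" using assms by (simp add: b_def)
  have pow: "b [^] n \<otimes> w = w \<otimes> a [^] n" for n :: nat
    unfolding b_def conj_pow[OF assms(3,4,2)] using assms(2-4) by (simp add: m_assoc)
  have "twisted_eval a p w = eval p b \<otimes> w" using Cons by (simp add: b_def)
  then have "twisted_eval a (c # p) w = (c \<otimes> b [^] length p \<oplus> eval p b) \<otimes> w"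
    using Cons.prems assms b eval_in_carrier[of p b]
    by (simp add: twisted_eval_Cons l_distr m_assoc pow)
  then show ?case by (simp add: b_def)
qed (use assms in simp)

lemma twisted_eval_zero:
  assumes "set p \<subseteq> carrier D" "a \<in> carrier D"
  shows "twisted_eval a p \<zero> = \<zero>"
  using assms by (induction p) (auto simp: twisted_eval_Cons)

lemma twisted_eval_add:
  assumes "set p \<subseteq> carrier D" "a \<in> carrier D" "v \<in> carrier D" "w \<in> carrier D"
  shows "twisted_eval a p (v \<oplus> w) = twisted_eval a p v \<oplus> twisted_eval a p w"
  using assms(1)
proof (induction p)
  case (Cons c p)
  have "a [^] length p \<in> carrier D" "twisted_eval a p v \<in> carrier D" "twisted_eval a p w \<in> carrier D"
    "c \<in> carrier D" using Cons assms by auto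
  then show ?case using Cons assms(2-4)
    by (simp add: twisted_eval_Cons l_distr r_distr a_ac)
qed simp

lemma twisted_eval_poly_add:
  assumes "set p \<subseteq> carrier D" "set q \<subseteq> carrier D" "a \<in> carrier D" "w \<in> carrier D"
  shows "twisted_eval a (poly_add p q) w = twisted_eval a p w \<oplus> twisted_eval a q w"
proof (cases "w = \<zero>")
  case True
  then show ?thesis using assms poly_add_in_carrier by (simp add: twisted_eval_zero del: poly_add.simps)
next
  case False
  have c: "w \<otimes> a \<otimes> inv w \<in> carrier D" using assms False by simp
  show ?thesis
    using False assms c poly_add_in_carrier[OF assms(1,2)] eval_in_carrier[OF _ c]
    by (simp add: twisted_eval_eq eval_poly_add l_distr del: poly_add.simps)
qed

lemma twisted_eval_shift:
  assumes "set q \<subseteq> carrier D" "a \<in> carrier D" "w \<in> carrier D" "c \<in> carrier D"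
  shows "twisted_eval a (map ((\<otimes>) c) q @ replicate n \<zero>) w = c \<otimes> (twisted_eval a q w \<otimes> a [^] n)"
  using assms(1)
proof (induction q)
  case Nil
  show ?case using assms(2-4) by (induction n) (auto simp: twisted_eval_Cons)
next
  case (Cons b q)
  have C: "a [^] length q \<in> carrier D" "a [^] n \<in> carrier D" "twisted_eval a q w \<in> carrier D" "b \<in> carrier D"
    using Cons assms by auto
  have "a [^] (length q + n) = a [^] length q \<otimes> a [^] n"
    using assms by (simp add: nat_pow_mult)
  then show ?case using Cons C assms(2-4)
    by (simp add: twisted_eval_Cons l_distr r_distr m_assoc)
qed

text \<open>Left multiplications by coefficients commute with right multiplication by
  \<open>a\<close>, so composing actions is multiplying polynomials with a central indeterminate.
  Coefficients may therefore be arbitrary elements of \<open>D\<close>, a generality that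
  \<open>poly_fun_mult\<close> exploits.\<close>

lemma twisted_eval_poly_mult:
  assumes "set p \<subseteq> carrier D" "set q \<subseteq> carrier D" "a \<in> carrier D" "w \<in> carrier D"
  shows "twisted_eval a (poly_mult p q) w = twisted_eval a p (twisted_eval a q w)"
  using assms(1)
proof (induction p)
  case (Cons c p)
  have sets: "set (map ((\<otimes>) c) q @ replicate (length p) \<zero>) \<subseteq> carrier D" "set (poly_mult p q) \<subseteq> carrier D"
    using Cons.prems assms(2) poly_mult_in_carrier[of p q] by auto
  have "poly_mult (c # p) q = poly_add (map ((\<otimes>) c) q @ replicate (length p) \<zero>) (poly_mult p q)"
    by (simp del: poly_add.simps)
  then show ?case
    using twisted_eval_poly_add[OF sets assms(3,4)] Cons assms
    by (simp add: twisted_eval_shift twisted_eval_Cons del: poly_add.simps)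
qed simp

lemma twisted_eval_module:
  assumes K: "subfield K D" and a: "a \<in> carrier D"
  shows "module (K[X]\<^bsub>D\<^esub>)
    \<lparr>carrier = carrier D, monoid.mult = (\<otimes>), monoid.one = \<one>, ring.zero = \<zero>, ring.add = (\<oplus>), smult = twisted_eval a\<rparr>"
    (is "module _ ?M")
proof -
  have C: "set p \<subseteq> carrier D" if "p \<in> carrier (K[X]\<^bsub>D\<^esub>)" for p
    using that polynomial_incl[of K p] subfieldE(3)[OF K] unfolding univ_poly_carrier[symmetric] by blast
  interpret k: field "D\<lparr>carrier := K\<rparr>" using subfield_iff(2)[OF K] .
  have "cring (K[X]\<^bsub>D\<^esub>)"
    using k.univ_poly_is_cring[OF k.carrier_is_subring] univ_poly_consistent[OF subfieldE(1)[OF K]] by simp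
  moreover have "abelian_group ?M"
  proof (rule abelian_groupI)
    show "\<exists>y\<in>carrier ?M. y \<oplus>\<^bsub>?M\<^esub> x = \<zero>\<^bsub>?M\<^esub>" if "x \<in> carrier ?M" for x
      using that by (intro bexI[of _ "\<ominus> x"]) (auto simp: l_neg)
  qed (auto simp: a_ac)
  moreover have "twisted_eval a [\<one>] w = w" if "w \<in> carrier D" for w
    using that a by (simp add: twisted_eval_Cons)
  ultimately show ?thesis
    by (intro module.intro module_axioms.intro)
      (auto simp: univ_poly_add univ_poly_mult univ_poly_one C a twisted_eval_add twisted_eval_poly_add
        twisted_eval_poly_mult simp del: poly_add.simps)
qed

text \<open>A polynomial that annihilates all of \<open>D\<close> is a relation with terms
  \<open>c_i w a^i\<close> valid for every \<open>w\<close>. If the powers of \<open>a\<close> were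
  independent over the center, \<open>center_independent\<close> would make all its coefficients
  zero.\<close>

lemma conjugates_algebraic_imp_dependent:
  assumes K: "subfield K D" and a: "a \<in> carrier D"
    and alg: "\<And>w. \<lbrakk>w \<in> carrier D; w \<noteq> \<zero>\<rbrakk> \<Longrightarrow>
      \<exists>p. polynomial K p \<and> p \<noteq> [] \<and> degree p \<le> d \<and> eval p (w \<otimes> a \<otimes> inv w) = \<zero>"
  shows "dependent center (exp_base a (Suc d))"
proof -
  let ?P = "K[X]\<^bsub>D\<^esub>"
  let ?M = "\<lparr>carrier = carrier D, monoid.mult = (\<otimes>), monoid.one = \<one>, ring.zero = \<zero>, ring.add = (\<oplus>), smult = twisted_eval a\<rparr>"
  have C: "set p \<subseteq> carrier D" if "p \<in> carrier (K[X]\<^bsub>D\<^esub>)" for p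
    using that polynomial_incl[of K p] subfieldE(3)[OF K] unfolding univ_poly_carrier[symmetric] by blast
  interpret k: field "D\<lparr>carrier := K\<rparr>" using subfield_iff(2)[OF K] .
  have cons: "carrier (D\<lparr>carrier := K\<rparr>) [X]\<^bsub>D\<lparr>carrier := K\<rparr>\<^esub> = ?P"
    using univ_poly_consistent[OF subfieldE(1)[OF K]] by simp
  have principal: "principal_domain ?P"
    using k.univ_poly_is_principal[OF k.carrier_is_subfield] cons by simp
  have "\<exists>p \<in> carrier ?P - {\<zero>\<^bsub>?P\<^esub>}. degree p \<le> d \<and> (\<forall>v \<in> carrier ?M. p \<odot>\<^bsub>?M\<^esub> v = \<zero>\<^bsub>?M\<^esub>)"
  proof (rule module_common_annihilator[OF principal twisted_eval_module[OF K a]])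
    fix p q assume pq: "p \<in> carrier ?P - {\<zero>\<^bsub>?P\<^esub>}" "q \<in> carrier ?P - {\<zero>\<^bsub>?P\<^esub>}"
    have "polynomial\<^bsub>D\<lparr>carrier := K\<rparr>\<^esub> (carrier (D\<lparr>carrier := K\<rparr>)) p"
      "polynomial\<^bsub>D\<lparr>carrier := K\<rparr>\<^esub> (carrier (D\<lparr>carrier := K\<rparr>)) q"
      using pq cons unfolding univ_poly_carrier by simp_all
    from k.poly_mult_degree_eq[OF k.carrier_is_subring this]
    show "degree (p \<otimes>\<^bsub>?P\<^esub> q) = degree p + degree q"
      using pq poly_mult_consistent[OF subfieldE(1)[OF K]] by (simp add: univ_poly_mult univ_poly_zero)
  next
    fix p assume p: "p \<in> carrier ?P - {\<zero>\<^bsub>?P\<^esub>}" "degree p = 0"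
    then obtain c where "p = [c]" by (cases p) (auto simp: univ_poly_zero)
    moreover have "c \<in> K - {\<zero>}" using DiffD1[OF p(1)] \<open>p = [c]\<close> unfolding univ_poly_carrier[symmetric] polynomial_def by auto
    ultimately show "p \<in> Units ?P" using univ_poly_units[OF K] by blast
  next
    fix v assume "v \<in> carrier ?M"
    then have v: "v \<in> carrier D" by simp
    show "\<exists>p \<in> carrier ?P - {\<zero>\<^bsub>?P\<^esub>}. degree p \<le> d \<and> p \<odot>\<^bsub>?M\<^esub> v = \<zero>\<^bsub>?M\<^esub>"
    proof (cases "v = \<zero>")
      \<comment> \<open>There is no conjugate by the zero vector, but any nonzero polynomial of
        bounded degree kills it; a relation of \<open>a\<close> itself provides one.\<close>
      case True
      obtain p where "polynomial K p" "p \<noteq> []" "degree p \<le> d" using alg[of \<one>] by auto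
      then show ?thesis using True C a
        by (intro bexI[of _ p]) (auto simp: univ_poly_carrier[symmetric] univ_poly_zero twisted_eval_zero)
    next
      case False
      then obtain p where p: "polynomial K p" "p \<noteq> []" "degree p \<le> d" "eval p (v \<otimes> a \<otimes> inv v) = \<zero>"
        using alg v by blast
      then have "twisted_eval a p v = \<zero>"
        using twisted_eval_eq[OF _ a v False, of p] C[of p] v unfolding univ_poly_carrier[symmetric] by simp
      then show ?thesis using p
        by (intro bexI[of _ p]) (auto simp: univ_poly_carrier[symmetric] univ_poly_zero)
    qed
  qed
  then obtain p where p: "p \<in> carrier ?P" "p \<noteq> []" "degree p \<le> d"
    "\<And>v. v \<in> carrier D \<Longrightarrow> twisted_eval a p v = \<zero>"
    by (auto simp: univ_poly_zero)
  have "\<not> set p \<subseteq> {\<zero>}"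
    using p(1,2) unfolding univ_poly_carrier[symmetric] polynomial_def by (cases p) auto
  then have "dependent center (exp_base a (length p))"
    using center_independent[of "exp_base a (length p)" p] p(4) C[OF p(1)] by (auto simp: twisted_eval_def)
  \<comment> \<open>\<open>exp_base\<close> lists the powers in descending order, so the shorter
    list is a suffix of the longer one.\<close>
  moreover have "exp_base a (length p) = drop (Suc d - length p) (exp_base a (Suc d))"
    using drop_exp_base[of "Suc d - length p" a "Suc d"] p(2,3) by (cases p) auto
  ultimately show ?thesis
    using independent_split(1)[OF ring_center_subfield, of "take (Suc d - length p) (exp_base a (Suc d))"]
    by (metis append_take_drop_id)
qed

text \<open>The degree is a \<open>LEAST\<close> over monic relations whereas
  \<open>left_algebraic\<close> admits all of them, so this is what makes the degree attained.
  Scaling from the left is compatible with left evaluation.\<close>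

lemma left_algebraic_monic:
  assumes K: "subfield K D" and a: "a \<in> carrier D" and alg: "left_algebraic K a"
  shows "\<exists>p. polynomial K p \<and> p \<noteq> [] \<and> lead_coeff p = \<one> \<and> eval p a = \<zero>"
proof -
  obtain p where p: "polynomial K p" "p \<noteq> []" "eval p a = \<zero>"
    using alg unfolding left_algebraic_def by blast
  have pK: "set p \<subseteq> K" using polynomial_incl[OF p(1)] .
  have pC: "set p \<subseteq> carrier D" using pK subfieldE(3)[OF K] by blast
  define c where "c = lead_coeff p"
  have c: "c \<in> K - {\<zero>}" using p(1,2) pK unfolding polynomial_def c_def by auto
  then have cC: "c \<in> carrier D" "c \<noteq> \<zero>" using subfieldE(3)[OF K] by auto
  have ic: "inv c \<in> K" using subfield_m_inv(1)[OF K c] by simp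
  let ?q = "map ((\<otimes>) (inv c)) p"
  have lead: "lead_coeff ?q = \<one>" using p(2) cC unfolding c_def by (simp add: hd_map)
  have "eval ?q a = inv c \<otimes> eval p a"
    using pC
  proof (induction p)
    case (Cons b p)
    then show ?case using a cC eval_in_carrier[OF _ a, of p] by (simp add: r_distr m_assoc)
  qed (use cC in simp)
  then have "eval ?q a = \<zero>" using p(3) cC by simp
  moreover have "polynomial K ?q"
  proof -
    have "set ?q \<subseteq> K" using pK ic subringE(6)[OF subfieldE(1)[OF K]] by auto
    then show ?thesis using lead unfolding polynomial_def by auto
  qed
  ultimately show ?thesis using lead p(2) by blast
qed

lemma left_algebraic_degree_le:
  assumes K: "subfield K D" and a: "a \<in> carrier D" and alg: "left_algebraic K a"
    and "left_algebraic_degree K a \<le> d"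
  shows "\<exists>p. polynomial K p \<and> p \<noteq> [] \<and> degree p \<le> d \<and> eval p a = \<zero>"
proof -
  have "\<exists>n p. polynomial K p \<and> p \<noteq> [] \<and> lead_coeff p = \<one> \<and> degree p = n \<and> eval p a = \<zero>"
    using left_algebraic_monic[OF assms(1-3)] by blast
  from LeastI_ex[OF this, folded left_algebraic_degree_def]
  obtain p where "polynomial K p" "p \<noteq> []" "degree p = left_algebraic_degree K a" "eval p a = \<zero>"
    by (elim exE conjE)
  then show ?thesis using assms(4) by (intro exI[of _ p]) simp
qed

end

locale skew_field_normal_subgroup = skew_field +
  fixes N
  assumes normal: "N \<lhd> units_of D"
begin

lemma N_subgroup: "subgroup N (units_of D)"
  by (rule normal_imp_subgroup[OF normal])

lemma N_carrier_nonzero: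
  assumes "n \<in> N" shows "n \<in> carrier D" "n \<noteq> \<zero>"
proof -
  have "n \<in> Units D" using subgroup.subset[OF N_subgroup] assms by (auto simp: units_of_carrier)
  then show "n \<in> carrier D" "n \<noteq> \<zero>" by (auto simp: skew_field_Units)
qed

lemma N_one: "\<one> \<in> N"
  using subgroup.one_closed[OF N_subgroup] by (simp add: units_of_one)

lemma N_mult: "m \<in> N \<Longrightarrow> n \<in> N \<Longrightarrow> m \<otimes> n \<in> N"
  using subgroup.m_closed[OF N_subgroup] by (simp add: units_of_mult)

lemma N_inv: "n \<in> N \<Longrightarrow> inv n \<in> N"
  using subgroup.m_inv_closed[OF N_subgroup, of n] N_carrier_nonzero[of n] by (simp add: units_of_inv skew_field_Units)

lemma N_conj:
  assumes "n \<in> N" "x \<in> carrier D" "x \<noteq> \<zero>" shows "x \<otimes> n \<otimes> inv x \<in> N"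
  using normal.inv_op_closed2[OF normal, of x n] assms
  by (simp add: units_of_carrier units_of_mult units_of_inv skew_field_Units)

lemma N_dependent:
  assumes K: "subfield K D" and alg: "left_algebraic_of_bounded_degree d K N" and n: "n \<in> N"
  shows "dependent center (exp_base n (Suc d))"
proof (rule conjugates_algebraic_imp_dependent[OF K])
  show "n \<in> carrier D" using N_carrier_nonzero n by blast
  fix w assume w: "w \<in> carrier D" "w \<noteq> \<zero>"
  have "w \<otimes> n \<otimes> inv w \<in> N" using N_conj n w by blast
  then show "\<exists>p. polynomial K p \<and> p \<noteq> [] \<and> degree p \<le> d \<and> eval p (w \<otimes> n \<otimes> inv w) = \<zero>"
    using alg left_algebraic_degree_le[OF K] N_carrier_nonzero unfolding left_algebraic_of_bounded_degree_def by blast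
qed

end

section \<open>The linear span of a noncentral normal subgroup\<close>

context skew_field
begin

lemmas zero_not_one [simp] = one_not_zero[symmetric]

lemma subfield_if_inv_closed:
  assumes "subring L D" and "\<And>x y. \<lbrakk>x \<in> L; y \<in> L\<rbrakk> \<Longrightarrow> x \<otimes> y = y \<otimes> x"
    and inverse: "\<And>x. \<lbrakk>x \<in> L; x \<noteq> \<zero>\<rbrakk> \<Longrightarrow> inv x \<in> L"
  shows "subfield L D"
proof (rule subfieldI)
  show "subcring L D" using assms by (intro subcringI) auto
  have L: "L \<subseteq> carrier D" "\<one> \<in> L" using subringE(1,3)[OF assms(1)] .
  show "Units (D\<lparr>carrier := L\<rparr>) = L - {\<zero>}"
  proof (intro equalityI subsetI)
    fix x assume "x \<in> Units (D\<lparr>carrier := L\<rparr>)"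
    then obtain y where "x \<in> L" "y \<in> L" "y \<otimes> x = \<one>" unfolding Units_def by auto
    moreover from this have "y \<otimes> \<zero> = \<zero>" using L by auto
    ultimately show "x \<in> L - {\<zero>}" by auto
  next
    fix x assume x: "x \<in> L - {\<zero>}"
    then have "inv x \<in> L" "x \<otimes> inv x = \<one>" "inv x \<otimes> x = \<one>" using inverse L by auto
    then show "x \<in> Units (D\<lparr>carrier := L\<rparr>)" using x unfolding Units_def by auto
  qed
qed

lemma minimal_dependence:
  assumes "dependent center (exp_base a (Suc d))"
  shows "\<exists>r \<le> d. r > 0 \<and> independent center (exp_base a r) \<and> dependent center (exp_base a (Suc r))"
proof -
  let ?P = "\<lambda>r. dependent center (exp_base a (Suc r))"
  define r where "r = (LEAST r. ?P r)"
  have r: "?P r" "r \<le> d" unfolding r_def using assms by (rule LeastI, rule Least_le)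
  have "\<one> \<notin> Span center []" by simp
  then have "independent center (exp_base a (Suc 0))"
    by (simp add: exp_base_def li_Cons)
  then have "r \<noteq> 0" using r by (metis)
  moreover from this obtain q where "r = Suc q" using not0_implies_Suc by blast
  then have "\<not> ?P q" using not_less_Least[of q ?P] unfolding r_def by auto
  ultimately show ?thesis using r \<open>r = Suc q\<close> by auto
qed

lemma Span_induct [consumes 2, case_names zero add]:
  assumes "v \<in> Span center Us" and Us: "set Us \<subseteq> carrier D"
    and zero: "P \<zero>"
    and add: "\<And>k u v. \<lbrakk>k \<in> center; u \<in> set Us; v \<in> carrier D; P v\<rbrakk> \<Longrightarrow> P (k \<otimes> u \<oplus> v)"
  shows "P v"
proof -
  obtain Ks where Ks: "set Ks \<subseteq> center" "v = combine Ks Us"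
    using Span_mem_iff_length_version[OF ring_center_subfield Us] assms(1) by blast
  have "combine Ks Vs \<in> carrier D \<and> P (combine Ks Vs)" if "set Vs \<subseteq> set Us" "set Ks \<subseteq> center" for Ks Vs
    using that
  proof (induction Ks Vs rule: combine.induct)
    case (1 k Ks u Vs)
    then have "combine Ks Vs \<in> carrier D" "P (combine Ks Vs)" by auto
    moreover have "k \<in> center" "u \<in> set Us" "u \<in> carrier D" using 1 Us by auto
    ultimately show ?case using add by simp
  qed (use zero in auto)
  then show ?thesis using Ks by blast
qed

lemma exp_base_set: "set (exp_base a n) = {a [^] i | i. i < n}"
  by (auto simp: exp_base_def)

lemma center_closed [simp]:
  "\<zero> \<in> center" "\<one> \<in> center"
  "x \<in> center \<Longrightarrow> \<ominus> x \<in> center"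
  "x \<in> center \<Longrightarrow> y \<in> center \<Longrightarrow> x \<oplus> y \<in> center"
  "x \<in> center \<Longrightarrow> y \<in> center \<Longrightarrow> x \<otimes> y \<in> center"
  "x \<in> center \<Longrightarrow> y \<in> center \<Longrightarrow> x \<ominus> y \<in> center"
  using subringE[OF subfieldE(1)[OF ring_center_subfield]] by (auto simp: minus_eq)

lemma center_inv [simp]: "x \<in> center \<Longrightarrow> x \<noteq> \<zero> \<Longrightarrow> inv x \<in> center"
  using subfield_m_inv(1)[OF ring_center_subfield] by simp

text \<open>Writing the relation as \<open>p(z) z + b = 0\<close>, a nonzero constant term
  \<open>b\<close> gives the inverse of \<open>z\<close> as a polynomial in \<open>z\<close>, and a
  zero one is removed by cancelling \<open>z\<close>. Hence the induction starts at the constant end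
  of the list.\<close>

lemma inv_in_subring:
  assumes L: "subring L D" and FL: "center \<subseteq> L" and "z \<in> L" "z \<noteq> \<zero>"
    and "set p \<subseteq> center" "\<not> set p \<subseteq> {\<zero>}" "eval p z = \<zero>"
  shows "inv z \<in> L"
  using assms(5-7)
proof (induction p rule: rev_induct)
  case (snoc b p)
  have LD: "L \<subseteq> carrier D" and z: "z \<in> carrier D" using subringE(1)[OF L] assms(3) by auto
  have pb: "set p \<subseteq> center" "b \<in> center" and C: "set p \<subseteq> carrier D" "b \<in> carrier D"
    using snoc.prems by auto
  have ev: "eval p z \<in> carrier D" using C z eval_in_carrier by blast
  have eq: "eval p z \<otimes> z \<oplus> b = \<zero>" using snoc.prems(3) eval_append_aux[OF C z] by simp
  have ev_L: "eval q z \<in> L" if "set q \<subseteq> center" for q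
    using that
  proof (induction q)
    case (Cons c q)
    have "z [^] n \<in> L" for n :: nat
      by (induction n) (use assms(3) subringE(3,6)[OF L] in auto)
    then show ?case using Cons FL subringE(6,7)[OF L] by auto
  qed (use subringE(2)[OF L] in simp)
  show ?case
  proof (cases "b = \<zero>")
    case True
    then have "eval p z = \<zero>" using eq ev z assms(4) by (simp add: integral_iff)
    then show ?thesis using snoc True pb by auto
  next
    case False
    define w where "w = \<ominus> (inv b \<otimes> eval p z)"
    have "inv b \<otimes> (eval p z \<otimes> z \<oplus> b) = inv b \<otimes> eval p z \<otimes> z \<oplus> \<one>"
      using C ev z False by (simp add: r_distr m_assoc)
    then have "\<one> \<oplus> inv b \<otimes> eval p z \<otimes> z = \<zero>" using eq C ev z False by (simp add: a_comm)
    then have "\<ominus> (inv b \<otimes> eval p z \<otimes> z) = \<one>"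
      by (rule minus_equality) (use C ev z False in simp_all)
    moreover have "w \<otimes> z = \<ominus> (inv b \<otimes> eval p z \<otimes> z)"
      unfolding w_def using C ev z False by (simp add: l_minus)
    ultimately have "w \<otimes> z = \<one>"
      by simp
    moreover have wL: "w \<in> L"
      unfolding w_def using ev_L[OF pb(1)] subsetD[OF FL center_inv[OF pb(2) False]] subringE(5,6)[OF L] by auto
    ultimately have "w = inv z"
      using z assms(4) LD right_cancel[of w z "inv z"] by auto
    then show ?thesis using wL by simp
  qed
qed simp

lemma eval_zero_if_dependent:
  assumes a: "a \<in> carrier D" and dep: "dependent center (exp_base a n)"
  shows "\<exists>p. length p = n \<and> set p \<subseteq> center \<and> \<not> set p \<subseteq> {\<zero>} \<and> eval p a = \<zero>"
proof -
  have "set (exp_base a n) \<subseteq> carrier D" using a by (auto simp: exp_base_set)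
  from dependent_imp_non_trivial_combine[OF ring_center_subfield this dep]
  obtain p where p: "length p = n" "combine p (exp_base a n) = \<zero>" "set p \<subseteq> center" "set p \<noteq> {\<zero>}"
    by (metis length_exp_base)
  have "n > 0" using dep by (cases n) (auto simp: exp_base_def)
  then have "\<not> set p \<subseteq> {\<zero>}" using p(1,4) by (cases p) auto
  then show ?thesis using p combine_eq_eval[of p a] by auto
qed

text \<open>The span of the powers of \<open>a\<close> is the field F(a). The one extra dependence
  closes it under multiplication by \<open>a\<close>. Inverses come from the dimension:
  \<open>Suc r\<close> powers of any of its elements are dependent.\<close>

lemma Span_exp_base:
  assumes a: "a \<in> carrier D" and ind: "independent center (exp_base a r)"
    and dep: "dependent center (exp_base a (Suc r))"
  defines "L \<equiv> Span center (exp_base a r)"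
  shows "subfield L D" and "center \<subseteq> L" and "a \<in> L" and "dimension r center L"
proof -
  have U: "set (exp_base a n) \<subseteq> carrier D" for n using a by (auto simp: exp_base_set)
  note Span = Span_subgroup_props[OF ring_center_subfield U[of r], folded L_def]
  note smult = Span_smult_closed[OF ring_center_subfield U[of r], folded L_def]
  show dim: "dimension r center L"
    unfolding L_def using dimension_independent[OF ind] by simp
  have r0: "r \<noteq> 0"
  proof
    assume "r = 0"
    have "\<one> \<notin> Span center []" by simp
    then have "independent center (exp_base a (Suc 0))" by (simp add: exp_base_def li_Cons)
    then show False using dep \<open>r = 0\<close> by simp
  qed
  have base: "a [^] i \<in> L" if "i < r" for i
    using Span_base_incl[OF ring_center_subfield U[of r]] that unfolding L_def exp_base_set by auto
  have one: "\<one> \<in> L" using base[of 0] r0 by simp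
  show FL: "center \<subseteq> L" using smult[OF _ one] by auto
  have "a [^] r \<in> L"
    unfolding L_def using dep ind li_Cons[of "a [^] r" center "exp_base a r"] a by (auto simp: exp_base_Suc)
  then have base': "a \<otimes> a [^] i \<in> L" if "i < r" for i
    using base[of "Suc i"] that a by (cases "Suc i = r") (auto simp: nat_pow_Suc2[symmetric] simp del: nat_pow_Suc)
  have mult_a: "a \<otimes> v \<in> L" if "v \<in> L" for v
    using that[unfolded L_def] U[of r]
  proof (induction v rule: Span_induct)
    case zero
    then show ?case using a Span by simp
  next
    case (add k u v)
    then obtain i :: nat where i: "u = a [^] i" "i < r" by (auto simp: exp_base_set)
    have "a \<otimes> (k \<otimes> u \<oplus> v) = k \<otimes> (a \<otimes> u) \<oplus> a \<otimes> v"
      using add i a centerD[OF add(1) a] by (simp add: r_distr m_assoc[symmetric])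
    then show ?case using base'[OF i(2)] i add smult Span by simp
  qed
  have mult_pow: "a [^] i \<otimes> v \<in> L" if "v \<in> L" for i :: nat and v
  proof (induction i)
    case 0
    then show ?case using that Span by auto
  next
    case (Suc i)
    have "a [^] Suc i \<otimes> v = a \<otimes> (a [^] i \<otimes> v)"
      unfolding nat_pow_Suc2[OF a] by (rule m_assoc) (use a that Span(1) in auto)
    then show ?case using mult_a[OF Suc] by simp
  qed
  have mult: "v \<otimes> w \<in> L" if "v \<in> L" and w: "w \<in> L" for v w
    using that(1)[unfolded L_def] U[of r]
  proof (induction v rule: Span_induct)
    case zero
    then show ?case using w Span by auto
  next
    case (add k u v)
    then obtain i :: nat where i: "u = a [^] i" "i < r" by (auto simp: exp_base_set)
    have "(k \<otimes> u \<oplus> v) \<otimes> w = k \<otimes> (u \<otimes> w) \<oplus> v \<otimes> w"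
      using add i a w Span(1) by (auto simp: l_distr m_assoc)
    then show ?case using mult_pow[OF w] i add smult Span by simp
  qed
  \<comment> \<open>Used in two rounds: with \<open>a\<close> for \<open>x\<close> it shows that
    members of \<open>L\<close> commute with \<open>a\<close>, and then with a member of
    \<open>L\<close> for \<open>x\<close> that they commute with each other.\<close>
  have comm1: "v \<otimes> x = x \<otimes> v" if "v \<in> L" "x \<in> carrier D" "a \<otimes> x = x \<otimes> a" for v x
    using that(1)[unfolded L_def] U[of r]
  proof (induction v rule: Span_induct)
    case zero
    then show ?case using that(2) by simp
  next
    case (add k u v)
    then obtain i :: nat where i: "u = a [^] i" by (auto simp: exp_base_set)
    have "u \<otimes> x = x \<otimes> u" using group_commutes_pow[OF that(3) a that(2)] i by simp
    moreover have "k \<otimes> (x \<otimes> u) = x \<otimes> (k \<otimes> u)"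
      using add(1) that(2) a i centerD[OF add(1) that(2)] by (simp add: m_assoc[symmetric])
    ultimately show ?case using add i a that(2) by (simp add: l_distr r_distr m_assoc)
  qed
  have comm: "v \<otimes> w = w \<otimes> v" if "v \<in> L" "w \<in> L" for v w
  proof -
    have "w \<otimes> a = a \<otimes> w" using comm1[OF that(2) a] by simp
    then show ?thesis using comm1[OF that(1)] that(2) Span(1) by auto
  qed
  have sub: "subring L D"
    by (rule subringI) (use Span one mult in auto)
  show aL: "a \<in> L" using mult_a[OF one] a by simp
  have "inv z \<in> L" if z: "z \<in> L" "z \<noteq> \<zero>" for z
  proof -
    have zC: "z \<in> carrier D" using z Span by auto
    have "z [^] i \<in> L" for i :: nat
      by (induction i) (use one mult z in auto)
    then have "set (exp_base z (Suc r)) \<subseteq> L" by (auto simp: exp_base_set)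
    then have "dependent center (exp_base z (Suc r))"
      using independent_length_le_dimension[OF ring_center_subfield dim, of "exp_base z (Suc r)"] by auto
    then obtain p where "set p \<subseteq> center" "\<not> set p \<subseteq> {\<zero>}" "eval p z = \<zero>"
      using eval_zero_if_dependent[OF zC] by blast
    then show ?thesis using inv_in_subring[OF sub FL z] by blast
  qed
  then show "subfield L D" using subfield_if_inv_closed[OF sub comm] by blast
qed

end

locale noncentral_normal_subgroup = skew_field_normal_subgroup +
  assumes noncentral: "\<not> N \<subseteq> ring_center D"
begin

text \<open>The span over the center of a possibly infinite set, hence inductive rather than the
  \<open>Span\<close> of a list. Adding one scaled element of \<open>N\<close> at a time is the step
  used in every later induction.\<close>

inductive_set lin :: "'a set" where
  zero: "\<zero> \<in> lin"
| add: "\<lbrakk>k \<in> center; n \<in> N; v \<in> lin\<rbrakk> \<Longrightarrow> k \<otimes> n \<oplus> v \<in> lin"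

lemma lin_D: "v \<in> lin \<Longrightarrow> v \<in> carrier D"
  by (induction rule: lin.induct) (auto dest: N_carrier_nonzero)

lemma lin_add: "v \<in> lin \<Longrightarrow> w \<in> lin \<Longrightarrow> v \<oplus> w \<in> lin"
proof (induction rule: lin.induct)
  case (add k n v)
  then have "k \<otimes> n \<oplus> v \<oplus> w = k \<otimes> n \<oplus> (v \<oplus> w)"
    by (intro a_assoc) (auto dest: N_carrier_nonzero lin_D)
  then show ?case using add lin.add by simp
qed (simp add: lin_D)

lemma lin_smult: "v \<in> lin \<Longrightarrow> c \<in> center \<Longrightarrow> c \<otimes> v \<in> lin"
proof (induction rule: lin.induct)
  case (add k n v)
  then have "c \<otimes> (k \<otimes> n \<oplus> v) = c \<otimes> k \<otimes> n \<oplus> c \<otimes> v"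
    by (simp add: r_distr m_assoc N_carrier_nonzero lin_D)
  then show ?case using add lin.add[of "c \<otimes> k" n "c \<otimes> v"] by simp
qed (auto intro: lin.zero)

lemma N_lin: "n \<in> N \<Longrightarrow> n \<in> lin"
  using lin.add[of \<one> n, OF _ _ lin.zero] by (simp add: N_carrier_nonzero)

lemma N_mult_lin: "v \<in> lin \<Longrightarrow> n \<in> N \<Longrightarrow> n \<otimes> v \<in> lin"
proof (induction rule: lin.induct)
  case (add k m v)
  have "n \<otimes> (k \<otimes> m) = k \<otimes> (n \<otimes> m)"
    using add centerD[of k n] by (simp add: m_assoc[symmetric] N_carrier_nonzero)
  then have "n \<otimes> (k \<otimes> m \<oplus> v) = k \<otimes> (n \<otimes> m) \<oplus> n \<otimes> v"
    using add by (simp add: r_distr N_carrier_nonzero lin_D)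
  then show ?case using add lin.add[of k "n \<otimes> m" "n \<otimes> v"] N_mult by simp
qed (auto intro: lin.zero simp: N_carrier_nonzero)

lemma lin_mult: "v \<in> lin \<Longrightarrow> w \<in> lin \<Longrightarrow> v \<otimes> w \<in> lin"
proof (induction rule: lin.induct)
  case (add k m v)
  have "(k \<otimes> m \<oplus> v) \<otimes> w = k \<otimes> (m \<otimes> w) \<oplus> v \<otimes> w"
    using add by (simp add: l_distr m_assoc N_carrier_nonzero lin_D)
  then show ?case using add lin_add lin_smult N_mult_lin by simp
qed (auto intro: lin.zero simp: lin_D)

lemma lin_minus: "v \<in> lin \<Longrightarrow> w \<in> lin \<Longrightarrow> v \<ominus> w \<in> lin"
  using lin_add[OF _ lin_smult[of w "\<ominus> \<one>"]] by (simp add: lin_D minus_eq l_minus)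

text \<open>The inverse lies in the field generated by \<open>n\<close> over the center; that field
  is spanned by powers of \<open>n\<close>, and these stay in \<open>N\<close>.\<close>

lemma lin_inv_one_minus:
  assumes n: "n \<in> N" "n \<noteq> \<one>" and "dependent center (exp_base n (Suc d))"
  shows "inv (\<one> \<ominus> n) \<in> lin"
proof -
  obtain r where r: "independent center (exp_base n r)" "dependent center (exp_base n (Suc r))"
    using minimal_dependence[OF assms(3)] by blast
  define L where "L = Span center (exp_base n r)"
  note L = Span_exp_base[OF N_carrier_nonzero(1)[OF n(1)] r, folded L_def]
  have nC: "n \<in> carrier D" using N_carrier_nonzero n by blast
  have "\<one> \<ominus> n \<in> L"
    using subringE(3,5,7)[OF subfieldE(1)[OF L(1)]] L(3) unfolding minus_eq by auto
  moreover have "\<one> \<ominus> n \<noteq> \<zero>" using minus_eq_zero_iff[OF one_closed nC] n(2) by auto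
  ultimately have inL: "inv (\<one> \<ominus> n) \<in> L" using subfield_m_inv(1)[OF L(1)] by blast
  have U: "set (exp_base n r) \<subseteq> carrier D" using nC by (auto simp: exp_base_set)
  have "v \<in> lin" if "v \<in> L" for v
    using that[unfolded L_def] U
  proof (induction v rule: Span_induct)
    case (add k u v)
    then obtain i :: nat where i: "u = n [^] i" by (auto simp: exp_base_set)
    have "n [^] i \<in> N"
      by (induction i) (use n N_one N_mult in auto)
    then show ?case using add i lin.add by simp
  qed (rule lin.zero)
  then show ?thesis using inL by blast
qed

text \<open>
  For \<open>y\<close> not commuting with \<open>n \<in> N\<close>, subtracting \<open>y n = r\<^sub>1 y\<close> from
  \<open>(1 + y) n = r\<^sub>2 (1 + y)\<close> with \<open>r\<^sub>1, r\<^sub>2 \<in> N\<close> expresses \<open>y\<close> through \<open>N\<close>,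
  as in the Cartan--Brauer--Hua theorem.
\<close>
lemma lin_eq_carrier:
  assumes alg: "\<And>n. n \<in> N \<Longrightarrow> dependent center (exp_base n (Suc d))"
  shows "lin = carrier D"
proof -
  have noncomm: "y \<in> lin" if y: "y \<in> carrier D" and n: "n \<in> N" and ne: "y \<otimes> n \<noteq> n \<otimes> y" for y n
  proof -
    have nC: "n \<in> carrier D" using N_carrier_nonzero n by blast
    have y0: "y \<noteq> \<zero>" using ne nC by auto
    have y1: "\<one> \<oplus> y \<noteq> \<zero>"
    proof
      assume "\<one> \<oplus> y = \<zero>"
      then have "y = \<ominus> \<one>" using y by (metis minus_equality one_closed a_comm)
      then show False using ne nC by (simp add: l_minus r_minus)
    qed
    have y1C: "\<one> \<oplus> y \<in> carrier D" using y by simp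
    define r1 where "r1 = y \<otimes> n \<otimes> inv y"
    define r2 where "r2 = (\<one> \<oplus> y) \<otimes> n \<otimes> inv (\<one> \<oplus> y)"
    have N12: "r1 \<in> N" "r2 \<in> N" unfolding r1_def r2_def using N_conj n y y0 y1 y1C by auto
    then have C12: "r1 \<in> carrier D" "r2 \<in> carrier D" "r1 \<noteq> \<zero>" using N_carrier_nonzero by auto
    have e1: "r1 \<otimes> y = y \<otimes> n" unfolding r1_def using y y0 nC by (simp add: m_assoc)
    have e2: "r2 \<otimes> (\<one> \<oplus> y) = (\<one> \<oplus> y) \<otimes> n" unfolding r2_def using y1C y1 nC by (simp add: m_assoc)
    have eq: "(r1 \<ominus> r2) \<otimes> y = r2 \<ominus> n"
    proof -
      have e2': "r2 \<oplus> r2 \<otimes> y = n \<oplus> y \<otimes> n" using e2 C12 y nC by (simp add: l_distr r_distr)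
      have "(r1 \<ominus> r2) \<otimes> y = r1 \<otimes> y \<ominus> (r2 \<oplus> r2 \<otimes> y) \<oplus> r2" using C12 y by algebra
      also have "\<dots> = y \<otimes> n \<ominus> (n \<oplus> y \<otimes> n) \<oplus> r2" unfolding e1 e2' ..
      also have "\<dots> = r2 \<ominus> n" using C12 y nC by algebra
      finally show ?thesis .
    qed
    have "r1 \<noteq> r2"
    proof
      assume "r1 = r2"
      then have "r2 \<ominus> n = \<zero>" using eq C12 y by (simp add: r_neg minus_eq)
      then have "r1 = n" using minus_eq_zero_iff[OF C12(2) nC] \<open>r1 = r2\<close> by simp
      then show False using e1 ne by simp
    qed
    \<comment> \<open>Then \<open>r1 - r2 = r1 (1 - m)\<close> with \<open>m\<close> in
      \<open>N\<close>, so the factor that has to be inverted is of the form covered by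
      \<open>lin_inv_one_minus\<close>.\<close>
    define m where "m = inv r1 \<otimes> r2"
    have m: "m \<in> N" "m \<in> carrier D" unfolding m_def using N12 N_inv N_mult N_carrier_nonzero by auto
    have r2m: "r2 = r1 \<otimes> m" unfolding m_def using C12 by simp
    then have m1: "m \<noteq> \<one>" using \<open>r1 \<noteq> r2\<close> C12 by auto
    have z: "\<one> \<ominus> m \<in> carrier D" "\<one> \<ominus> m \<noteq> \<zero>" using m m1 minus_eq_zero_iff[of \<one> m] by auto
    have "r1 \<otimes> ((\<one> \<ominus> m) \<otimes> y) = r2 \<ominus> n"
    proof -
      have "r1 \<otimes> ((\<one> \<ominus> m) \<otimes> y) = (r1 \<otimes> \<one> \<ominus> r1 \<otimes> m) \<otimes> y"
        using C12(1) m(2) y by algebra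
      then show ?thesis using eq C12(1) r2m by simp
    qed
    then have "(\<one> \<ominus> m) \<otimes> y = inv r1 \<otimes> (r2 \<ominus> n)"
      using C12 z y inv_cancel(1)[of r1 "(\<one> \<ominus> m) \<otimes> y"] by simp
    then have "y = inv (\<one> \<ominus> m) \<otimes> (inv r1 \<otimes> (r2 \<ominus> n))"
      using inv_cancel(1)[OF z y] by simp
    then show ?thesis
      using lin_mult lin_minus N_lin N_inv N12 n lin_inv_one_minus[OF m(1) m1 alg[OF m(1)]] by metis
  qed
  obtain n z where n: "n \<in> N" and z: "z \<in> carrier D" "n \<otimes> z \<noteq> z \<otimes> n"
    using noncentral N_carrier_nonzero unfolding ring_center_def by blast
  have nC: "n \<in> carrier D" using N_carrier_nonzero n by blast
  have "y \<in> lin" if y: "y \<in> carrier D" for y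
  proof (cases "y \<otimes> n = n \<otimes> y")
    case True
    \<comment> \<open>An element commuting with \<open>n\<close> is the difference of
      \<open>z + y\<close> and \<open>z\<close>, neither of which commutes with
      \<open>n\<close>.\<close>
    have "(z \<oplus> y) \<otimes> n \<noteq> n \<otimes> (z \<oplus> y)"
    proof
      assume "(z \<oplus> y) \<otimes> n = n \<otimes> (z \<oplus> y)"
      then have "z \<otimes> n \<oplus> n \<otimes> y = n \<otimes> z \<oplus> n \<otimes> y" using True y z nC by (simp add: l_distr r_distr)
      then show False using z y nC by simp
    qed
    then have "z \<oplus> y \<in> lin" "z \<in> lin" using noncomm n z y by auto
    then have "(z \<oplus> y) \<ominus> z \<in> lin" by (rule lin_minus)
    moreover have "(z \<oplus> y) \<ominus> z = y" using z y by algebra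
    ultimately show ?thesis by simp
  qed (use noncomm n y in blast)
  then show ?thesis using lin_D by blast
qed

end

section \<open>Polynomial families and generic independence\<close>

context skew_field
begin

section \<open>Polynomial functions of a central parameter\<close>

lemma center_pow [simp]: "s \<in> center \<Longrightarrow> s [^] (n::nat) \<in> center"
  by (induction n) auto

lemma center_swap: "\<lbrakk>s \<in> center; x \<in> carrier D; y \<in> carrier D\<rbrakk> \<Longrightarrow> x \<otimes> (s \<otimes> y) = s \<otimes> (x \<otimes> y)"
  using centerD[of s x] by (simp add: m_assoc[symmetric])

text \<open>The coefficients range over \<open>D\<close>, but only central arguments count: those
  commute with all coefficients, so that products of such functions are again of this kind.\<close>

definition poly_fun :: "('a \<Rightarrow> 'a) \<Rightarrow> bool" where
  "poly_fun f \<longleftrightarrow> (\<exists>p. set p \<subseteq> carrier D \<and> (\<forall>s \<in> center. f s = eval p s))"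

lemma poly_fun_closed: "poly_fun f \<Longrightarrow> s \<in> center \<Longrightarrow> f s \<in> carrier D"
  unfolding poly_fun_def using eval_in_carrier by auto

lemma poly_fun_cong: "poly_fun f \<Longrightarrow> (\<And>s. s \<in> center \<Longrightarrow> g s = f s) \<Longrightarrow> poly_fun g"
  unfolding poly_fun_def by auto

lemma poly_fun_eval: "set p \<subseteq> carrier D \<Longrightarrow> poly_fun (eval p)"
  unfolding poly_fun_def by blast

lemma poly_fun_const [intro]: "c \<in> carrier D \<Longrightarrow> poly_fun (\<lambda>s. c)"
  by (rule poly_fun_cong[OF poly_fun_eval[of "[c]"]]) auto

lemma poly_fun_id [intro]: "poly_fun (\<lambda>s. s)"
  by (rule poly_fun_cong[OF poly_fun_eval[of "[\<one>, \<zero>]"]]) auto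

lemma poly_fun_add [intro]:
  assumes "poly_fun f" "poly_fun g"
  shows "poly_fun (\<lambda>s. f s \<oplus> g s)"
proof -
  obtain p q where p: "set p \<subseteq> carrier D" "\<And>s. s \<in> center \<Longrightarrow> f s = eval p s"
    and q: "set q \<subseteq> carrier D" "\<And>s. s \<in> center \<Longrightarrow> g s = eval q s"
    using assms unfolding poly_fun_def by blast
  show ?thesis
    by (rule poly_fun_cong[OF poly_fun_eval[OF poly_add_in_carrier[OF p(1) q(1)]]])
      (use p q eval_poly_add[OF p(1) q(1)] in \<open>simp del: poly_add.simps\<close>)
qed

lemma poly_fun_mult [intro]:
  assumes "poly_fun f" "poly_fun g"
  shows "poly_fun (\<lambda>s. f s \<otimes> g s)"
proof -
  obtain p q where p: "set p \<subseteq> carrier D" "\<And>s. s \<in> center \<Longrightarrow> f s = eval p s"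
    and q: "set q \<subseteq> carrier D" "\<And>s. s \<in> center \<Longrightarrow> g s = eval q s"
    using assms unfolding poly_fun_def by blast
  \<comment> \<open>Conjugation fixes a central \<open>s\<close>, so the twisted action becomes left
    multiplication by \<open>eval p s\<close>. The multiplicativity of the action then is
    multiplicativity of evaluation.\<close>
  have central: "twisted_eval s p w = eval p s \<otimes> w"
    if p: "set p \<subseteq> carrier D" and s: "s \<in> center" and w: "w \<in> carrier D" for s p w
  proof (cases "w = \<zero>")
    case True
    then show ?thesis using p s eval_in_carrier[OF p, of s] by (simp add: twisted_eval_zero)
  next
    case False
    have "w \<otimes> s \<otimes> inv w = s" using center_swap[OF s w, of "inv w"] False s w by (simp add: m_assoc)
    then show ?thesis using twisted_eval_eq[OF p _ w False, of s] s by simp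
  qed
  have "f s \<otimes> g s = eval (poly_mult p q) s" if s: "s \<in> center" for s
  proof -
    have sC: "s \<in> carrier D" using s by simp
    have "twisted_eval s (poly_mult p q) \<one> = twisted_eval s p (twisted_eval s q \<one>)"
      by (rule twisted_eval_poly_mult[OF p(1) q(1)]) (use s in auto)
    then show ?thesis
      using central[OF poly_mult_in_carrier[OF p(1) q(1)] s] central[OF p(1) s] central[OF q(1) s]
        eval_in_carrier[OF p(1) sC] eval_in_carrier[OF q(1) sC]
        eval_in_carrier[OF poly_mult_in_carrier[OF p(1) q(1)] sC] p(2)[OF s] q(2)[OF s] by simp
  qed
  then show ?thesis
    by (rule poly_fun_cong[OF poly_fun_eval[OF poly_mult_in_carrier[OF p(1) q(1)]]])
qed

lemma poly_fun_uminus [intro]: "poly_fun f \<Longrightarrow> poly_fun (\<lambda>s. \<ominus> f s)"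
  by (rule poly_fun_cong[OF poly_fun_mult[OF poly_fun_const[of "\<ominus> \<one>"]]])
    (auto simp: l_minus dest: poly_fun_closed)

lemma poly_fun_minus [intro]: "poly_fun f \<Longrightarrow> poly_fun g \<Longrightarrow> poly_fun (\<lambda>s. f s \<ominus> g s)"
  unfolding minus_eq by (intro poly_fun_add poly_fun_uminus)

lemma poly_fun_pow [intro]: "poly_fun f \<Longrightarrow> poly_fun (\<lambda>s. f s [^] (n::nat))"
  by (induction n) (simp_all add: poly_fun_const poly_fun_mult)

text \<open>Horner division by \<open>s - t\<close>, where centrality of \<open>s\<close> and
  \<open>t\<close> lets them pass the coefficients. The bound on \<open>length q\<close> is the
  measure by which zeros are counted.\<close>

lemma eval_factor:
  assumes "set p \<subseteq> carrier D" "t \<in> center"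
  shows "\<exists>q. length q \<le> length p - 1 \<and> set q \<subseteq> carrier D \<and>
    (\<forall>s \<in> center. eval p s = eval p t \<oplus> (s \<ominus> t) \<otimes> eval q s)"
  using assms(1)
proof (induction p rule: rev_induct)
  case Nil
  then show ?case using assms(2) by (intro exI[of _ "[]"]) (auto simp: minus_eq)
next
  case (snoc b p)
  then obtain q where q: "length q \<le> length p - 1" "set q \<subseteq> carrier D"
    "\<And>s. s \<in> center \<Longrightarrow> eval p s = eval p t \<oplus> (s \<ominus> t) \<otimes> eval q s" by auto
  have C: "set p \<subseteq> carrier D" "b \<in> carrier D" using snoc.prems by auto
  show ?case
  proof (cases "p = []")
    case True
    then show ?thesis using C assms(2) by (intro exI[of _ "[]"]) (auto simp: minus_eq)
  next
    case False
    have tC: "t \<in> carrier D" using assms(2) by simp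
    have pt: "eval p t \<in> carrier D" using eval_in_carrier[OF C(1) tC] .
    have "eval (p @ [b]) s = eval (p @ [b]) t \<oplus> (s \<ominus> t) \<otimes> eval (q @ [eval p t]) s" if s: "s \<in> center" for s
    proof -
      have sC: "s \<in> carrier D" using s by simp
      have qs: "eval q s \<in> carrier D" using eval_in_carrier[OF q(2) sC] .
      have comm: "s \<otimes> eval p t = eval p t \<otimes> s" "t \<otimes> eval p t = eval p t \<otimes> t"
        using centerD s assms(2) pt by auto
      have "(eval p t \<oplus> (s \<ominus> t) \<otimes> eval q s) \<otimes> s \<oplus> b
        = eval p t \<otimes> s \<oplus> (s \<ominus> t) \<otimes> (eval q s \<otimes> s) \<oplus> b"
        using pt sC tC qs C by algebra
      also have "\<dots> = eval p t \<otimes> t \<oplus> b \<oplus> ((s \<ominus> t) \<otimes> (eval q s \<otimes> s) \<oplus> (eval p t \<otimes> s \<ominus> eval p t \<otimes> t))"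
        using pt sC tC qs C by algebra
      also have "\<dots> = eval p t \<otimes> t \<oplus> b \<oplus> ((s \<ominus> t) \<otimes> (eval q s \<otimes> s) \<oplus> (s \<otimes> eval p t \<ominus> t \<otimes> eval p t))"
        unfolding comm ..
      also have "\<dots> = eval p t \<otimes> t \<oplus> b \<oplus> (s \<ominus> t) \<otimes> (eval q s \<otimes> s \<oplus> eval p t)"
        using pt sC tC qs C by algebra
      finally show ?thesis
        unfolding eval_append_aux[OF C sC] eval_append_aux[OF C tC] eval_append_aux[OF q(2) pt sC] q(3)[OF s] .
    qed
    moreover have "length (q @ [eval p t]) \<le> length (p @ [b]) - 1" using q(1) False by (cases p) auto
    ultimately show ?thesis using q(2) pt by (intro exI[of _ "q @ [eval p t]"]) auto
  qed
qed

text \<open>A zero \<open>t\<close> splits off the factor \<open>s - t\<close>, and the quotient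
  still does not vanish at \<open>s0\<close>. So every step contributes at most one zero and lowers
  the length.\<close>

lemma finite_zeros_eval:
  assumes "set p \<subseteq> carrier D" "s0 \<in> center" "eval p s0 \<noteq> \<zero>"
  shows "finite {s \<in> center. eval p s = \<zero>}"
  using assms(1,3)
proof (induction "length p" arbitrary: p rule: less_induct)
  case less
  show ?case
  proof (cases "\<exists>t \<in> center. eval p t = \<zero>")
    case False
    then have "{s \<in> center. eval p s = \<zero>} = {}" by blast
    then show ?thesis by (simp only: finite.emptyI)
  next
    case True
    then obtain t where t: "t \<in> center" "eval p t = \<zero>" by blast
    obtain q where q: "length q \<le> length p - 1" "set q \<subseteq> carrier D"
      "\<And>s. s \<in> center \<Longrightarrow> eval p s = eval p t \<oplus> (s \<ominus> t) \<otimes> eval q s"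
      using eval_factor[OF less.prems(1) t(1)] by blast
    have eq: "eval p s = (s \<ominus> t) \<otimes> eval q s" if "s \<in> center" for s
      using q(3)[OF that] t that eval_in_carrier[OF q(2)] by simp
    have "p \<noteq> []" using less.prems by auto
    then have "length q < length p" using q(1) by (cases p) auto
    moreover have "eval q s0 \<noteq> \<zero>"
      using eq[OF assms(2)] less.prems(2) assms(2) t(1) by auto
    ultimately have "finite {s \<in> center. eval q s = \<zero>}" using less.hyps q(2) by blast
    moreover have "{s \<in> center. eval p s = \<zero>} \<subseteq> insert t {s \<in> center. eval q s = \<zero>}"
      using eq integral_iff minus_eq_zero_iff eval_in_carrier[OF q(2)] t(1) by auto
    ultimately show ?thesis by (meson finite_insert finite_subset)
  qed
qed

lemma finite_zeros:
  assumes "poly_fun f" "s0 \<in> center" "f s0 \<noteq> \<zero>"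
  shows "finite {s \<in> center. f s = \<zero>}"
proof -
  obtain p where p: "set p \<subseteq> carrier D" "\<And>s. s \<in> center \<Longrightarrow> f s = eval p s"
    using assms(1) unfolding poly_fun_def by blast
  then have "finite {s \<in> center. eval p s = \<zero>}" using finite_zeros_eval assms(2,3) by auto
  moreover have "{s \<in> center. f s = \<zero>} = {s \<in> center. eval p s = \<zero>}" using p(2) by auto
  ultimately show ?thesis by simp
qed

section \<open>Linear functionals over the center and generic independence\<close>

definition center_linear :: "('a \<Rightarrow> 'a) \<Rightarrow> bool" where
  "center_linear l \<longleftrightarrow> (\<forall>x \<in> carrier D. l x \<in> center) \<and>
    (\<forall>x \<in> carrier D. \<forall>y \<in> carrier D. l (x \<oplus> y) = l x \<oplus> l y) \<and>
    (\<forall>k \<in> center. \<forall>x \<in> carrier D. l (k \<otimes> x) = k \<otimes> l x)"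

lemma center_linear_simps:
  assumes "center_linear l"
  shows "x \<in> carrier D \<Longrightarrow> l x \<in> center"
    and "\<lbrakk>x \<in> carrier D; y \<in> carrier D\<rbrakk> \<Longrightarrow> l (x \<oplus> y) = l x \<oplus> l y"
    and "\<lbrakk>k \<in> center; x \<in> carrier D\<rbrakk> \<Longrightarrow> l (k \<otimes> x) = k \<otimes> l x"
    and "l \<zero> = \<zero>"
proof -
  have "l (\<zero> \<otimes> \<zero>) = \<zero> \<otimes> l \<zero>" "l \<zero> \<in> center"
    using assms center_closed(1) zero_closed unfolding center_linear_def by blast+
  then show "l \<zero> = \<zero>" by simp
qed (use assms in \<open>auto simp: center_linear_def\<close>)

text \<open>\<open>D\<close> may have infinite dimension over its center at this stage, so Zorn's
  lemma is used: a subspace maximal among those avoiding \<open>v\<close> is a complement of the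
  line through \<open>v\<close>, and \<open>l\<close> reads off the coordinate along that
  line.\<close>

lemma center_linear_exists:
  assumes v: "v \<in> carrier D" "v \<noteq> \<zero>"
  shows "\<exists>l. center_linear l \<and> l v = \<one>"
proof -
  define S where "S = {H. H \<subseteq> carrier D \<and> \<zero> \<in> H \<and> v \<notin> H \<and> (\<forall>x\<in>H. \<forall>y\<in>H. x \<oplus> y \<in> H) \<and>
    (\<forall>k\<in>center. \<forall>x\<in>H. k \<otimes> x \<in> H)}"
  have "{\<zero>} \<in> S" unfolding S_def using v by auto
  then have "S \<noteq> {}" by blast
  moreover have "\<Union>C \<in> S" if C: "C \<noteq> {}" "subset.chain S C" for C
  proof -
    have sub: "C \<subseteq> S" and chain: "\<And>A B. A \<in> C \<Longrightarrow> B \<in> C \<Longrightarrow> A \<subseteq> B \<or> B \<subseteq> A"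
      using C(2) unfolding subset.chain_def by auto
    have "x \<oplus> y \<in> \<Union>C" if "x \<in> \<Union>C" "y \<in> \<Union>C" for x y
    proof -
      obtain A B where AB: "A \<in> C" "x \<in> A" "B \<in> C" "y \<in> B" using \<open>x \<in> \<Union>C\<close> \<open>y \<in> \<Union>C\<close> by blast
      then obtain H where H: "H \<in> C" "x \<in> H" "y \<in> H" using chain[of A B] by blast
      then have "x \<oplus> y \<in> H" using sub unfolding S_def by blast
      then show ?thesis using H(1) by blast
    qed
    moreover have "\<Union>C \<subseteq> carrier D" "\<zero> \<in> \<Union>C" "v \<notin> \<Union>C" "\<forall>k\<in>center. \<forall>x\<in>\<Union>C. k \<otimes> x \<in> \<Union>C"
      using sub C(1) unfolding S_def by blast+
    ultimately show ?thesis unfolding S_def by simp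
  qed
  ultimately obtain M where M: "M \<in> S" and max: "\<And>H. H \<in> S \<Longrightarrow> M \<subseteq> H \<Longrightarrow> H = M"
    using subset_Zorn_nonempty[of S] by blast
  have MC: "M \<subseteq> carrier D" and M0: "\<zero> \<in> M" and vM: "v \<notin> M"
    and Madd: "\<And>x y. x \<in> M \<Longrightarrow> y \<in> M \<Longrightarrow> x \<oplus> y \<in> M" and Msm: "\<And>k x. k \<in> center \<Longrightarrow> x \<in> M \<Longrightarrow> k \<otimes> x \<in> M"
    using M unfolding S_def by auto
  have Mneg: "\<ominus> x \<in> M" if "x \<in> M" for x
    using Msm[of "\<ominus> \<one>" x] that MC by (auto simp: l_minus)
  have ex: "\<exists>c \<in> center. \<exists>m \<in> M. y = c \<otimes> v \<oplus> m" if y: "y \<in> carrier D" for y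
  proof -
    \<comment> \<open>The subspace generated by \<open>M\<close> and \<open>y\<close>. If it
      contains \<open>v\<close>, solving for \<open>y\<close> gives the decomposition; otherwise
      maximality puts \<open>y\<close> into \<open>M\<close>.\<close>
    define H where "H = {k \<otimes> y \<oplus> m | k m. k \<in> center \<and> m \<in> M}"
    have MH: "M \<subseteq> H"
    proof
      fix m assume "m \<in> M"
      then have "m = \<zero> \<otimes> y \<oplus> m" using y MC by auto
      then show "m \<in> H" unfolding H_def using \<open>m \<in> M\<close> center_closed(1) by blast
    qed
    have "y = \<one> \<otimes> y \<oplus> \<zero>" using y by simp
    then have yH: "y \<in> H" unfolding H_def using M0 center_closed(2) by blast
    show ?thesis
    proof (cases "v \<in> H")
      case True
      then obtain k m where km: "k \<in> center" "m \<in> M" "v = k \<otimes> y \<oplus> m" unfolding H_def by blast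
      have k0: "k \<noteq> \<zero>" using km vM MC y by auto
      have mC: "m \<in> carrier D" using km MC by auto
      have ky: "k \<otimes> y = v \<oplus> \<ominus> m" unfolding km(3) using km(1) mC y by (simp add: a_assoc r_neg)
      have "y = inv k \<otimes> (k \<otimes> y)" using km(1) k0 y by simp
      also have "\<dots> = inv k \<otimes> v \<oplus> inv k \<otimes> \<ominus> m"
        unfolding ky using km(1) k0 mC v by (simp add: r_distr)
      finally show ?thesis
        using center_inv[OF km(1) k0] Msm[OF _ Mneg[OF km(2)]] by blast
    next
      case False
      have "H \<in> S"
        unfolding S_def
      proof (intro CollectI conjI ballI)
        show "H \<subseteq> carrier D" unfolding H_def using MC y by auto
        show "\<zero> \<in> H" using MH M0 by blast
        show "v \<notin> H" by fact
        fix x z assume "x \<in> H" "z \<in> H"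
        then obtain k m k' m' where 1: "k \<in> center" "m \<in> M" "x = k \<otimes> y \<oplus> m"
          and 2: "k' \<in> center" "m' \<in> M" "z = k' \<otimes> y \<oplus> m'" unfolding H_def by blast
        have "m \<in> carrier D" "m' \<in> carrier D" "k \<in> carrier D" "k' \<in> carrier D" using 1 2 MC by auto
        then have "x \<oplus> z = (k \<oplus> k') \<otimes> y \<oplus> (m \<oplus> m')" unfolding 1(3) 2(3) using y by algebra
        then show "x \<oplus> z \<in> H" unfolding H_def using 1 2 Madd center_closed(4) by blast
      next
        fix k x assume "k \<in> center" "x \<in> H"
        then obtain k' m where 1: "k' \<in> center" "m \<in> M" "x = k' \<otimes> y \<oplus> m" unfolding H_def by blast
        have "m \<in> carrier D" "k \<in> carrier D" "k' \<in> carrier D" using 1 MC \<open>k \<in> center\<close> by auto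
        then have "k \<otimes> x = (k \<otimes> k') \<otimes> y \<oplus> k \<otimes> m" unfolding 1(3) using y by algebra
        then show "k \<otimes> x \<in> H" unfolding H_def using 1 Msm \<open>k \<in> center\<close> center_closed(5) by blast
      qed
      then have "y \<in> M" using max[OF _ MH] yH by blast
      moreover have "y = \<zero> \<otimes> v \<oplus> y" using y v by simp
      ultimately show ?thesis using center_closed(1) by blast
    qed
  qed
  have unique: "c = c'" if "c \<in> center" "c' \<in> center" "m \<in> M" "m' \<in> M" "c \<otimes> v \<oplus> m = c' \<otimes> v \<oplus> m'" for c c' m m'
  proof (rule ccontr)
    assume "c \<noteq> c'"
    have mC: "m \<in> carrier D" "m' \<in> carrier D" "c \<in> carrier D" "c' \<in> carrier D" using that MC by auto
    have ne: "c \<ominus> c' \<noteq> \<zero>" "c \<ominus> c' \<in> center"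
      using minus_eq_zero_iff[OF mC(3,4)] \<open>c \<noteq> c'\<close> that by auto
    have "(c \<ominus> c') \<otimes> v = (c \<otimes> v \<oplus> m) \<ominus> c' \<otimes> v \<ominus> m" using mC v by algebra
    also have "\<dots> = (c' \<otimes> v \<oplus> m') \<ominus> c' \<otimes> v \<ominus> m" unfolding that(5) ..
    also have "\<dots> = m' \<oplus> \<ominus> m" using mC v by algebra
    finally have "(c \<ominus> c') \<otimes> v \<in> M" using Madd[OF that(4) Mneg[OF that(3)]] by simp
    then have "inv (c \<ominus> c') \<otimes> ((c \<ominus> c') \<otimes> v) \<in> M" using Msm center_inv ne by blast
    then show False using vM ne v by simp
  qed
  define l where "l y = (SOME c. c \<in> center \<and> (\<exists>m \<in> M. y = c \<otimes> v \<oplus> m))" for y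
  have l: "l y \<in> center" "\<exists>m \<in> M. y = l y \<otimes> v \<oplus> m" if "y \<in> carrier D" for y
    using someI_ex[of "\<lambda>c. c \<in> center \<and> (\<exists>m \<in> M. y = c \<otimes> v \<oplus> m)"] ex[OF that] unfolding l_def by blast+
  have l_eq: "l y = c" if "c \<in> center" "m \<in> M" "y = c \<otimes> v \<oplus> m" for y c m
  proof -
    have "y \<in> carrier D" using that MC v by auto
    then obtain m' where "m' \<in> M" "y = l y \<otimes> v \<oplus> m'" "l y \<in> center" using l by blast
    then show ?thesis using unique that by metis
  qed
  have "center_linear l"
    unfolding center_linear_def
  proof (intro conjI ballI)
    show "l x \<in> center" if "x \<in> carrier D" for x using l that by blast
    fix x y assume x: "x \<in> carrier D" and y: "y \<in> carrier D"
    obtain m where m: "m \<in> M" "x = l x \<otimes> v \<oplus> m" using l x by blast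
    obtain m' where m': "m' \<in> M" "y = l y \<otimes> v \<oplus> m'" using l y by blast
    have C: "l x \<in> carrier D" "l y \<in> carrier D" "m \<in> carrier D" "m' \<in> carrier D" using l x y m m' MC by auto
    have "x \<oplus> y = (l x \<otimes> v \<oplus> m) \<oplus> (l y \<otimes> v \<oplus> m')" using m(2) m'(2) by simp
    also have "\<dots> = (l x \<oplus> l y) \<otimes> v \<oplus> (m \<oplus> m')" using C v by algebra
    finally show "l (x \<oplus> y) = l x \<oplus> l y"
      by (intro l_eq[of "l x \<oplus> l y" "m \<oplus> m'"] Madd center_closed l(1) x y m(1) m'(1))
  next
    fix k x assume k: "k \<in> center" and x: "x \<in> carrier D"
    obtain m where m: "m \<in> M" "x = l x \<otimes> v \<oplus> m" using l x by blast
    have C: "l x \<in> carrier D" "m \<in> carrier D" "k \<in> carrier D" using l x m MC k by auto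
    have "k \<otimes> x = k \<otimes> (l x \<otimes> v \<oplus> m)" using m(2) by simp
    also have "\<dots> = (k \<otimes> l x) \<otimes> v \<oplus> (k \<otimes> m)" using C v by algebra
    finally show "l (k \<otimes> x) = k \<otimes> l x"
      by (intro l_eq[of "k \<otimes> l x" "k \<otimes> m"] Msm center_closed l(1) x k m(1))
  qed
  moreover have "l v = \<one>" using l_eq[of \<one> \<zero> v] M0 v by simp
  ultimately show ?thesis by blast
qed

text \<open>Powers of a central \<open>s\<close> are scalars for \<open>l\<close>, so applying
  \<open>l\<close> to the value is applying it to each coefficient.\<close>

lemma poly_fun_linear:
  assumes l: "center_linear l" and f: "poly_fun f"
  shows "poly_fun (\<lambda>s. l (f s))"
proof -
  obtain p where p: "set p \<subseteq> carrier D" "\<And>s. s \<in> center \<Longrightarrow> f s = eval p s"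
    using f unfolding poly_fun_def by blast
  have "l (eval p s) = eval (map l p) s" if s: "s \<in> center" for s
    using p(1)
  proof (induction p)
    case (Cons c p)
    have C: "c \<in> carrier D" "set p \<subseteq> carrier D" "s [^] length p \<in> center" "eval p s \<in> carrier D"
      using Cons.prems s eval_in_carrier[of p s] by auto
    have "l (c \<otimes> s [^] length p) = l c \<otimes> s [^] length p"
      using center_linear_simps(3)[OF l C(3,1)] centerD[OF C(3), of c] centerD[OF C(3), of "l c"]
        center_linear_simps(1)[OF l C(1)] C(1) by simp
    then show ?case using Cons C center_linear_simps(2)[OF l] by simp
  qed (use center_linear_simps[OF l] in simp)
  moreover have "set (map l p) \<subseteq> carrier D" using p(1) center_linear_simps(1)[OF l] by auto
  ultimately show ?thesis
    using poly_fun_cong[OF poly_fun_eval[of "map l p"], of "\<lambda>s. l (f s)"] p(2) by simp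
qed

text \<open>The map sending \<open>u\<close> to \<open>l x u - l u x\<close> is linear over the
  center and kills \<open>x\<close>. It is an elimination step without division, so it keeps
  polynomial dependence on a parameter.\<close>

lemma combine_eliminate:
  assumes l: "center_linear l" and "set Ks \<subseteq> center" "set Us \<subseteq> carrier D" "x \<in> carrier D"
  shows "combine Ks (map (\<lambda>u. l x \<otimes> u \<ominus> l u \<otimes> x) Us)
    = l x \<otimes> combine Ks Us \<ominus> l (combine Ks Us) \<otimes> x"
  using assms(2,3)
proof (induction Ks Us rule: combine.induct)
  case (1 k Ks u Us)
  have prems: "k \<in> center" "set Ks \<subseteq> center" "u \<in> carrier D" "set Us \<subseteq> carrier D"
    using 1(2,3) by auto
  define S where "S = combine Ks Us"
  have S: "S \<in> carrier D" unfolding S_def using prems by (intro combine_in_carrier) auto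
  have lC: "l x \<in> center" "l u \<in> center" "l S \<in> center" using center_linear_simps(1)[OF l] prems assms(4) S by auto
  then have C: "l x \<in> carrier D" "l u \<in> carrier D" "l S \<in> carrier D" "k \<in> carrier D" using prems by auto
  have "combine (k # Ks) (map (\<lambda>u. l x \<otimes> u \<ominus> l u \<otimes> x) (u # Us))
    = k \<otimes> (l x \<otimes> u \<ominus> l u \<otimes> x) \<oplus> (l x \<otimes> S \<ominus> l S \<otimes> x)"
    using 1(1)[OF prems(2,4)] by (simp add: S_def)
  also have "\<dots> = k \<otimes> l x \<otimes> u \<ominus> k \<otimes> l u \<otimes> x \<oplus> (l x \<otimes> S \<ominus> l S \<otimes> x)"
    using C prems(3) S assms(4) by algebra
  also have "k \<otimes> l x = l x \<otimes> k" using centerD prems(1) C by auto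
  also have "l x \<otimes> k \<otimes> u \<ominus> k \<otimes> l u \<otimes> x \<oplus> (l x \<otimes> S \<ominus> l S \<otimes> x)
    = l x \<otimes> (k \<otimes> u \<oplus> S) \<ominus> (k \<otimes> l u \<oplus> l S) \<otimes> x"
    using C prems(3) S assms(4) by algebra
  also have "k \<otimes> l u \<oplus> l S = l (k \<otimes> u \<oplus> S)"
    using center_linear_simps(2,3)[OF l] prems S by auto
  finally show ?case by (simp add: S_def)
qed (use center_linear_simps[OF l] assms(4) in \<open>simp_all add: minus_eq\<close>)

text \<open>Elimination against the first vector \<open>v\<close>, with a functional
  \<open>l\<close> fixed once by \<open>l (v \<zero>) = \<one>\<close>, reduces the claim to one
  vector less. The new exceptional parameters are the zeros of \<open>l (v s)\<close>, finitely many
  because this function is \<open>\<one>\<close> at \<open>\<zero>\<close>.\<close>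

lemma finite_dependent:
  assumes "\<And>v. v \<in> set vs \<Longrightarrow> poly_fun v" and "independent center (map (\<lambda>v. v \<zero>) vs)"
  shows "finite {s \<in> center. dependent center (map (\<lambda>v. v s) vs)}"
  using assms
proof (induction "length vs" arbitrary: vs)
  case 0
  then show ?case by simp
next
  case (Suc n)
  obtain v ws where vs: "vs = v # ws" "length ws = n" using Suc.hyps(2) by (cases vs) auto
  have pv: "poly_fun v" and pw: "\<And>w. w \<in> set ws \<Longrightarrow> poly_fun w" using Suc.prems vs by auto
  have v0: "v \<zero> \<in> carrier D" using poly_fun_closed[OF pv] by simp
  have "v \<zero> \<notin> Span center (map (\<lambda>v. v \<zero>) ws)"
    using independent_backwards(1) Suc.prems(2) vs by simp
  moreover have wsC: "set (map (\<lambda>v. v s) ws) \<subseteq> carrier D" if "s \<in> center" for s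
    using poly_fun_closed[OF pw] that by auto
  ultimately have "v \<zero> \<noteq> \<zero>"
    using Span_subgroup_props(2)[OF ring_center_subfield wsC[of \<zero>]] by auto
  then obtain l where l: "center_linear l" "l (v \<zero>) = \<one>" using center_linear_exists v0 by blast
  define e where "e w s = l (v s) \<otimes> w s \<ominus> l (w s) \<otimes> v s" for w s
  have map_e: "map (\<lambda>w. w s) (map e ws) = map (\<lambda>u. l (v s) \<otimes> u \<ominus> l u \<otimes> v s) (map (\<lambda>w. w s) ws)" for s
    by (simp add: e_def)
  have comb: "combine Ks (map (\<lambda>w. w s) (map e ws))
    = l (v s) \<otimes> combine Ks (map (\<lambda>w. w s) ws) \<ominus> l (combine Ks (map (\<lambda>w. w s) ws)) \<otimes> v s"
    if "set Ks \<subseteq> center" "s \<in> center" for Ks s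
    unfolding map_e by (rule combine_eliminate[OF l(1) that(1) wsC[OF that(2)] poly_fun_closed[OF pv that(2)]])
  have pe: "poly_fun u" if u: "u \<in> set (map e ws)" for u
  proof -
    obtain w where w: "w \<in> set ws" "u = e w" using u by auto
    show ?thesis
      unfolding w(2) e_def by (intro poly_fun_minus poly_fun_mult poly_fun_linear[OF l(1)] pv pw w(1))
  qed
  have "finite {s \<in> center. dependent center (map (\<lambda>w. w s) (map e ws))}"
  proof (rule Suc.hyps(1))
    show "n = length (map e ws)" using vs by simp
    show "poly_fun u" if "u \<in> set (map e ws)" for u using pe that .
    show "independent center (map (\<lambda>w. w \<zero>) (map e ws))"
    proof (rule trivial_combine_imp_independent[OF ring_center_subfield])
      show "set (map (\<lambda>w. w \<zero>) (map e ws)) \<subseteq> carrier D" using poly_fun_closed[OF pe] by auto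
      fix Ks assume Ks: "set Ks \<subseteq> center" "combine Ks (map (\<lambda>w. w \<zero>) (map e ws)) = \<zero>"
      define S where "S = combine Ks (map (\<lambda>w. w \<zero>) ws)"
      have S: "S \<in> carrier D" unfolding S_def using Ks(1) wsC[of \<zero>] by (intro combine_in_carrier) auto
      have lS: "l S \<in> center" using center_linear_simps(1)[OF l(1) S] .
      have "S \<ominus> l S \<otimes> v \<zero> = \<zero>" using comb[OF Ks(1), of \<zero>] Ks(2) l(2) S by (simp add: S_def)
      then have "\<ominus> l S \<otimes> v \<zero> \<oplus> S = \<zero>" using S lS v0 by (simp add: l_minus minus_eq a_comm)
      then have "combine (\<ominus> l S # Ks) (map (\<lambda>v. v \<zero>) vs) = \<zero>" by (simp add: vs S_def)
      then have "set (take (length vs) (\<ominus> l S # Ks)) \<subseteq> {\<zero>}"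
        using independent_imp_trivial_combine[OF ring_center_subfield Suc.prems(2), of "\<ominus> l S # Ks"] lS Ks(1) by simp
      then show "set (take (length (map (\<lambda>w. w \<zero>) (map e ws))) Ks) \<subseteq> {\<zero>}" using vs by simp
    qed
  qed
  moreover have "finite {s \<in> center. l (v s) = \<zero>}"
    by (rule finite_zeros[OF poly_fun_linear[OF l(1) pv], of \<zero>]) (use l(2) in auto)
  moreover have "{s \<in> center. dependent center (map (\<lambda>v. v s) vs)} \<subseteq>
    {s \<in> center. dependent center (map (\<lambda>w. w s) (map e ws))} \<union> {s \<in> center. l (v s) = \<zero>}"
  proof
    fix s assume "s \<in> {s \<in> center. dependent center (map (\<lambda>v. v s) vs)}"
    then have s: "s \<in> center" and dep: "dependent center (map (\<lambda>v. v s) vs)" by auto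
    show "s \<in> {s \<in> center. dependent center (map (\<lambda>w. w s) (map e ws))} \<union> {s \<in> center. l (v s) = \<zero>}"
    proof (rule ccontr)
      assume "\<not> ?thesis"
      then have ind: "independent center (map (\<lambda>w. w s) (map e ws))" and ls: "l (v s) \<noteq> \<zero>" using s by auto
      define x where "x = v s"
      have x: "x \<in> carrier D" unfolding x_def using poly_fun_closed[OF pv s] .
      have x0: "x \<noteq> \<zero>" using ls center_linear_simps(4)[OF l(1)] x_def by auto
      have lx: "l x \<in> center" using center_linear_simps(1)[OF l(1) x] .
      have "independent center (map (\<lambda>v. v s) vs)"
      proof (rule trivial_combine_imp_independent[OF ring_center_subfield])
        show "set (map (\<lambda>v. v s) vs) \<subseteq> carrier D" using poly_fun_closed[OF Suc.prems(1) s] by auto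
        fix Ks' assume Ks': "set Ks' \<subseteq> center" "combine Ks' (map (\<lambda>v. v s) vs) = \<zero>"
        show "set (take (length (map (\<lambda>v. v s) vs)) Ks') \<subseteq> {\<zero>}"
        proof (cases Ks')
          case (Cons k Ks)
          define S where "S = combine Ks (map (\<lambda>w. w s) ws)"
          have kK: "k \<in> center" "set Ks \<subseteq> center" using Ks' Cons by auto
          have S: "S \<in> carrier D" unfolding S_def using kK wsC[OF s] by (intro combine_in_carrier) auto
          have sum: "k \<otimes> x \<oplus> S = \<zero>" using Ks'(2) Cons vs by (simp add: x_def S_def)
          then have "l (k \<otimes> x \<oplus> S) = \<zero>" using center_linear_simps(4)[OF l(1)] by simp
          then have "k \<otimes> l x \<oplus> l S = \<zero>" using center_linear_simps(2,3)[OF l(1)] kK x S by simp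
          moreover have "l S \<in> center" using center_linear_simps(1)[OF l(1) S] .
          moreover have "l x \<otimes> S \<ominus> l S \<otimes> x = l x \<otimes> (k \<otimes> x \<oplus> S) \<ominus> (l x \<otimes> k \<oplus> l S) \<otimes> x"
            if "l S \<in> carrier D" "l x \<in> carrier D" "k \<in> carrier D"
            using that S x by algebra
          moreover have "l x \<otimes> k = k \<otimes> l x" using centerD[OF lx] kK by simp
          ultimately have "l x \<otimes> S \<ominus> l S \<otimes> x = \<zero>" using sum lx kK x by (simp add: minus_eq)
          then have "set (take (length ws) Ks) \<subseteq> {\<zero>}"
            using independent_imp_trivial_combine[OF ring_center_subfield ind kK(2)] comb[OF kK(2) s] by (simp add: S_def x_def)
          then have Kz: "take (length ws) Ks = replicate (length (take (length ws) Ks)) \<zero>"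
            by (intro replicate_eqI) auto
          have "S = combine (take (length ws) Ks) (map (\<lambda>w. w s) ws)"
            unfolding S_def using combine_take[of "map (\<lambda>w. w s) ws" Ks] by simp
          also have "\<dots> = combine (replicate (length (take (length ws) Ks)) \<zero> @ []) (map (\<lambda>w. w s) ws)"
            using Kz by simp
          also have "\<dots> = combine [] (drop (length (take (length ws) Ks)) (map (\<lambda>w. w s) ws))"
            by (rule combine_prepend_replicate) (use wsC[OF s] in auto)
          finally have "S = \<zero>" by simp
          then have "k = \<zero>" using sum kK x x0 by (simp add: integral_iff)
          then show ?thesis using Cons vs \<open>set (take (length ws) Ks) \<subseteq> {\<zero>}\<close> by simp
        qed simp
      qed
      then show False using dep by blast
    qed
  qed
  ultimately show ?case by (meson finite_Un finite_subset)
qed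

end

section \<open>Deformation of an algebraic element\<close>

context skew_field
begin

text \<open>The coefficient of s in (a + s y)^n for a central s, that is, the sum of all a^i y a^j
  with i + j = n - 1.\<close>

primrec pow_dev :: "'a \<Rightarrow> nat \<Rightarrow> 'a \<Rightarrow> 'a" where
  "pow_dev a 0 y = \<zero>"
| "pow_dev a (Suc n) y = y \<otimes> a [^] n \<oplus> a \<otimes> pow_dev a n y"

text \<open>The directional derivative at \<open>a\<close> of a polynomial with central
  coefficients. For the minimal polynomial of \<open>a\<close> it is the map \<open>\<Delta>\<close>
  of the overview.\<close>

primrec eval_dev :: "'a \<Rightarrow> 'a list \<Rightarrow> 'a \<Rightarrow> 'a" where
  "eval_dev a [] y = \<zero>"
| "eval_dev a (c # q) y = c \<otimes> pow_dev a (length q) y \<oplus> eval_dev a q y"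

lemma pow_dev_closed [simp]: "a \<in> carrier D \<Longrightarrow> y \<in> carrier D \<Longrightarrow> pow_dev a n y \<in> carrier D"
  by (induction n) auto

lemma eval_dev_closed [simp]:
  "a \<in> carrier D \<Longrightarrow> y \<in> carrier D \<Longrightarrow> set q \<subseteq> center \<Longrightarrow> eval_dev a q y \<in> carrier D"
  by (induction q) auto

lemma eval_dev_mem:
  assumes L: "subring L D" "center \<subseteq> L" "a \<in> L" "y \<in> L" and q: "set q \<subseteq> center"
  shows "eval_dev a q y \<in> L"
proof -
  have pow: "a [^] n \<in> L" for n :: nat
    by (induction n) (use L subringE(3,6)[OF L(1)] in auto)
  have "pow_dev a n y \<in> L" for n
    by (induction n) (use L pow subringE(2,6,7)[OF L(1)] in auto)
  then show ?thesis
    using q by (induction q) (use L subringE(2,6,7)[OF L(1)] in auto)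
qed

lemma eval_dev_add:
  assumes "a \<in> carrier D" "y \<in> carrier D" "z \<in> carrier D" "set q \<subseteq> center"
  shows "eval_dev a q (y \<oplus> z) = eval_dev a q y \<oplus> eval_dev a q z"
proof -
  have pow: "pow_dev a n (y \<oplus> z) = pow_dev a n y \<oplus> pow_dev a n z" for n
    by (induction n) (use assms in \<open>simp_all add: l_distr r_distr a_ac\<close>)
  show ?thesis
    using assms(4)
  proof (induction q)
    case (Cons c q)
    then show ?case using assms by (simp add: pow r_distr a_ac)
  qed simp
qed

lemma eval_dev_lmult:
  assumes a: "a \<in> carrier D" and y: "y \<in> carrier D" and q: "set q \<subseteq> center"
    and c: "c \<in> carrier D" "c \<otimes> a = a \<otimes> c"
  shows "eval_dev a q (c \<otimes> y) = c \<otimes> eval_dev a q y"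
proof -
  have pow: "pow_dev a n (c \<otimes> y) = c \<otimes> pow_dev a n y" for n
  proof (induction n)
    case (Suc n)
    have "a \<otimes> (c \<otimes> pow_dev a n y) = c \<otimes> (a \<otimes> pow_dev a n y)"
      using c a y by (simp add: m_assoc[symmetric])
    then show ?case using Suc a c(1) y by (simp add: r_distr m_assoc)
  qed (use c in simp)
  show ?thesis
    using q
  proof (induction q)
    case (Cons k q)
    then have "k \<otimes> (c \<otimes> pow_dev a (length q) y) = c \<otimes> (k \<otimes> pow_dev a (length q) y)"
      using center_swap[of k c] a c(1) y by simp
    then show ?case using Cons a c(1) y by (simp add: pow r_distr)
  qed (use c in simp)
qed

lemma eval_dev_rmult:
  assumes a: "a \<in> carrier D" and y: "y \<in> carrier D" and q: "set q \<subseteq> center"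
  shows "eval_dev a q (y \<otimes> a) = eval_dev a q y \<otimes> a"
proof -
  have pow: "pow_dev a n (y \<otimes> a) = pow_dev a n y \<otimes> a" for n
  proof (induction n)
    case (Suc n)
    have "y \<otimes> a \<otimes> a [^] n = y \<otimes> a [^] n \<otimes> a"
      using a y nat_pow_Suc2[OF a, of n] by (simp add: m_assoc)
    then show ?case using Suc a y by (simp add: l_distr m_assoc)
  qed (use a in simp)
  show ?thesis
    using q
  proof (induction q)
    case (Cons k q)
    then show ?case using a y by (simp add: pow l_distr m_assoc)
  qed (use a in simp)
qed

text \<open>For a single power the sum of all \<open>a^i y a^j\<close> telescopes when its products
  with \<open>a\<close> from the left and from the right are subtracted. If \<open>q\<close>
  vanishes at \<open>a\<close>, the right-hand side is zero, so all values of the derivative commute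
  with \<open>a\<close>.\<close>

lemma eval_dev_commutator:
  assumes a: "a \<in> carrier D" and y: "y \<in> carrier D" and q: "set q \<subseteq> center"
  shows "a \<otimes> eval_dev a q y \<ominus> eval_dev a q y \<otimes> a = eval q a \<otimes> y \<ominus> y \<otimes> eval q a"
proof -
  have pow: "a \<otimes> pow_dev a n y \<ominus> pow_dev a n y \<otimes> a = a [^] n \<otimes> y \<ominus> y \<otimes> a [^] n" for n
  proof (induction n)
    case (Suc n)
    define p where "p = a [^] n"
    define P where "P = pow_dev a n y"
    have C: "p \<in> carrier D" "P \<in> carrier D" unfolding p_def P_def using a y by auto
    have IH: "a \<otimes> P \<ominus> P \<otimes> a = p \<otimes> y \<ominus> y \<otimes> p" using Suc by (simp add: p_def P_def)
    have comm: "p \<otimes> a = a \<otimes> p" unfolding p_def using a group_commutes_pow[of a a n] by simp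
    have "a \<otimes> (y \<otimes> p \<oplus> a \<otimes> P) \<ominus> (y \<otimes> p \<oplus> a \<otimes> P) \<otimes> a
      = a \<otimes> (a \<otimes> P \<ominus> P \<otimes> a) \<oplus> a \<otimes> (y \<otimes> p) \<ominus> y \<otimes> (p \<otimes> a)"
      using a y C by algebra
    also have "\<dots> = a \<otimes> p \<otimes> y \<ominus> y \<otimes> (p \<otimes> a)"
      unfolding IH using a y C by algebra
    finally show ?case using comm by (simp add: p_def P_def)
  qed (use a y in \<open>simp add: minus_eq r_neg\<close>)
  show ?thesis
    using q
  proof (induction q)
    case (Cons c q)
    define p where "p = a [^] length q"
    define P where "P = pow_dev a (length q) y"
    define E where "E = eval_dev a q y"
    define e where "e = eval q a"
    have c: "c \<in> center" "c \<in> carrier D" "set q \<subseteq> center" "set q \<subseteq> carrier D" using Cons.prems by auto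
    have C: "p \<in> carrier D" "P \<in> carrier D" "E \<in> carrier D" "e \<in> carrier D"
      unfolding p_def P_def E_def e_def using a y c eval_in_carrier by auto
    have IH: "a \<otimes> E \<ominus> E \<otimes> a = e \<otimes> y \<ominus> y \<otimes> e" using Cons c by (simp add: E_def e_def)
    have IHp: "a \<otimes> P \<ominus> P \<otimes> a = p \<otimes> y \<ominus> y \<otimes> p" using pow by (simp add: p_def P_def)
    have s: "a \<otimes> (c \<otimes> P) = c \<otimes> (a \<otimes> P)" "y \<otimes> (c \<otimes> p) = c \<otimes> (y \<otimes> p)"
      using center_swap c a y C by auto
    have "a \<otimes> (c \<otimes> P \<oplus> E) \<ominus> (c \<otimes> P \<oplus> E) \<otimes> a = a \<otimes> (c \<otimes> P) \<ominus> c \<otimes> (P \<otimes> a) \<oplus> (a \<otimes> E \<ominus> E \<otimes> a)"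
      using a y C c(2) by algebra
    also have "\<dots> = c \<otimes> (a \<otimes> P \<ominus> P \<otimes> a) \<oplus> (a \<otimes> E \<ominus> E \<otimes> a)"
      unfolding s using a y C c(2) by algebra
    also have "\<dots> = c \<otimes> p \<otimes> y \<ominus> c \<otimes> (y \<otimes> p) \<oplus> (e \<otimes> y \<ominus> y \<otimes> e)"
      unfolding IH IHp using a y C c(2) by algebra
    also have "\<dots> = (c \<otimes> p \<oplus> e) \<otimes> y \<ominus> y \<otimes> (c \<otimes> p \<oplus> e)"
      unfolding s(2)[symmetric] using a y C c(2) by algebra
    finally show ?case by (simp add: p_def P_def E_def e_def)
  qed (use a y in \<open>simp add: minus_eq\<close>)
qed

text \<open>Collecting everything to the left of \<open>y\<close> into one coefficient per power of
  \<open>a\<close> gives the shape required by \<open>center_independent\<close>.\<close>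

lemma pow_dev_combine:
  assumes a: "a \<in> carrier D"
  shows "\<exists>ms. length ms = n \<and> set ms \<subseteq> carrier D \<and>
    (\<forall>y \<in> carrier D. pow_dev a n y = combine ms (map ((\<otimes>) y) (exp_base a n)))"
proof (induction n)
  case (Suc n)
  then obtain ms where ms: "length ms = n" "set ms \<subseteq> carrier D"
    "\<And>y. y \<in> carrier D \<Longrightarrow> pow_dev a n y = combine ms (map ((\<otimes>) y) (exp_base a n))" by blast
  have "pow_dev a (Suc n) y = combine (\<one> # map ((\<otimes>) a) ms) (map ((\<otimes>) y) (exp_base a (Suc n)))"
    if y: "y \<in> carrier D" for y
  proof -
    have "a \<otimes> combine ms (map ((\<otimes>) y) (exp_base a n)) = combine (map ((\<otimes>) a) ms) (map ((\<otimes>) y) (exp_base a n))"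
      by (rule combine_r_distr) (use ms y a in \<open>auto simp: exp_base_set\<close>)
    then show ?thesis using ms(3)[OF y] y a by (simp add: exp_base_Suc)
  qed
  then show ?case using ms a by (intro exI[of _ "\<one> # map ((\<otimes>) a) ms"]) auto
qed simp

lemma eval_dev_combine:
  assumes a: "a \<in> carrier D" and q: "set q \<subseteq> center"
  shows "\<exists>ms. length ms = length q - 1 \<and> set ms \<subseteq> carrier D \<and>
    (\<forall>y \<in> carrier D. eval_dev a q y = combine ms (map ((\<otimes>) y) (exp_base a (length q - 1))))"
  using q
proof (induction q)
  case (Cons c q)
  have c: "c \<in> carrier D" "set q \<subseteq> center" using Cons.prems by auto
  obtain ms where ms: "length ms = length q - 1" "set ms \<subseteq> carrier D"
    "\<And>y. y \<in> carrier D \<Longrightarrow> eval_dev a q y = combine ms (map ((\<otimes>) y) (exp_base a (length q - 1)))"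
    using Cons.IH[OF c(2)] by blast
  obtain ns where ns: "length ns = length q" "set ns \<subseteq> carrier D"
    "\<And>y. y \<in> carrier D \<Longrightarrow> pow_dev a (length q) y = combine ns (map ((\<otimes>) y) (exp_base a (length q)))"
    using pow_dev_combine[OF a] by blast
  \<comment> \<open>The derivative of the tail has one coefficient fewer than that of the leading
    monomial. As \<open>exp_base\<close> begins with the highest power, the missing coefficient is a
    zero at the head.\<close>
  define ms' where "ms' = (if q = [] then [] else \<zero> # ms)"
  have ms': "length ms' = length q" "set ms' \<subseteq> carrier D" unfolding ms'_def using ms by (auto simp: Suc_le_eq)
  define ns' where "ns' = map ((\<otimes>) c) ns"
  have ns': "length ns' = length q" "set ns' \<subseteq> carrier D" unfolding ns'_def using ns c by auto
  have "eval_dev a (c # q) y = combine (map2 (\<oplus>) ns' ms') (map ((\<otimes>) y) (exp_base a (length q)))"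
    if y: "y \<in> carrier D" for y
  proof -
    let ?U = "map ((\<otimes>) y) (exp_base a (length q))"
    have U: "set ?U \<subseteq> carrier D" using y a by (auto simp: exp_base_set)
    have "eval_dev a q y = combine ms' ?U"
    proof (cases q)
      case (Cons b q')
      have "combine ms (map ((\<otimes>) y) (exp_base a (length q'))) \<in> carrier D"
        using ms(2) y a by (intro combine_in_carrier) (auto simp: exp_base_set)
      then show ?thesis using ms(3)[OF y] Cons y a by (simp add: ms'_def exp_base_Suc)
    qed (simp add: ms'_def)
    moreover have "c \<otimes> pow_dev a (length q) y = combine ns' ?U"
      unfolding ns(3)[OF y] ns'_def using combine_r_distr[OF ns(2) U c(1)] .
    moreover have "combine ns' ?U \<oplus> combine ms' ?U = combine (map2 (\<oplus>) ns' ms') ?U"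
      by (rule combine_add) (use ns' ms' U in auto)
    ultimately show ?thesis by simp
  qed
  moreover have "set (map2 (\<oplus>) ns' ms') \<subseteq> carrier D"
    using ns'(2) ms'(2) by (auto dest!: set_zip_leftD set_zip_rightD simp: set_zip subset_eq)
  ultimately show ?case using ns'(1) ms'(1) by (intro exI[of _ "map2 (\<oplus>) ns' ms'"]) auto
qed simp

text \<open>In the derivative of a monic polynomial of degree \<open>r\<close> the term
  \<open>y a^(r-1)\<close> has left coefficient \<open>\<one>\<close>, while
  \<open>center_independent\<close> would force every left coefficient of a vanishing map to be
  zero. For inseparable \<open>a\<close> the value at \<open>y = \<one>\<close>, the formal
  derivative at \<open>a\<close>, may vanish, so another \<open>y\<close> has to do.\<close>

lemma eval_dev_nonzero:
  assumes a: "a \<in> carrier D" and q: "set q \<subseteq> center" "length q = r" "r > 0"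
    and ind: "independent center (exp_base a r)"
  shows "\<exists>y \<in> carrier D. eval_dev a (\<one> # q) y \<noteq> \<zero>"
proof (rule ccontr)
  assume contra: "\<not> ?thesis"
  obtain n where n: "r = Suc n" using q(3) by (cases r) auto
  obtain ms where ms: "length ms = n" "set ms \<subseteq> carrier D"
    "\<And>y. y \<in> carrier D \<Longrightarrow> eval_dev a q y = combine ms (map ((\<otimes>) y) (exp_base a n))"
    using eval_dev_combine[OF a q(1)] q(2) n by auto
  obtain ns where ns: "length ns = n" "set ns \<subseteq> carrier D"
    "\<And>y. y \<in> carrier D \<Longrightarrow> pow_dev a n y = combine ns (map ((\<otimes>) y) (exp_base a n))"
    using pow_dev_combine[OF a] by blast
  define ns' where "ns' = map ((\<otimes>) a) ns"
  have ns': "length ns' = n" "set ns' \<subseteq> carrier D" unfolding ns'_def using ns a by auto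
  have "combine (\<one> # map2 (\<oplus>) ns' ms) (map ((\<otimes>) y) (exp_base a r)) = \<zero>" if y: "y \<in> carrier D" for y
  proof -
    let ?U = "map ((\<otimes>) y) (exp_base a n)"
    have U: "set ?U \<subseteq> carrier D" using y a by (auto simp: exp_base_set)
    have "a \<otimes> pow_dev a n y = combine ns' ?U"
      unfolding ns(3)[OF y] ns'_def using combine_r_distr[OF ns(2) U a] .
    moreover have "combine ns' ?U \<oplus> combine ms ?U = combine (map2 (\<oplus>) ns' ms) ?U"
      by (rule combine_add) (use ns' ms U in auto)
    moreover have "eval_dev a (\<one> # q) y = y \<otimes> a [^] n \<oplus> a \<otimes> pow_dev a n y \<oplus> eval_dev a q y"
      using q n a y by simp
    moreover have "combine ns' ?U \<in> carrier D" "combine ms ?U \<in> carrier D"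
      using ns' ms U by (auto intro!: combine_in_carrier)
    ultimately have "eval_dev a (\<one> # q) y = y \<otimes> a [^] n \<oplus> combine (map2 (\<oplus>) ns' ms) ?U"
      using ms(3)[OF y] y a by (simp add: a_assoc)
    then show ?thesis using contra y a n by (simp add: exp_base_Suc)
  qed
  moreover have "set (map2 (\<oplus>) ns' ms) \<subseteq> carrier D"
    using ns'(2) ms(2) by (auto dest!: set_zip_leftD set_zip_rightD simp: set_zip subset_eq)
  ultimately have "set (\<one> # map2 (\<oplus>) ns' ms) \<subseteq> {\<zero>}"
    using ns'(1) ms(1) n by (intro center_independent[OF ind]) auto
  then show False by simp
qed

section \<open>Expansion to second order along polynomial curves through \<open>a\<close>\<close>

lemma pow_deform:
  assumes a: "a \<in> carrier D" and y: "y \<in> carrier D" and R: "poly_fun R"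
    and A: "\<And>s. s \<in> center \<Longrightarrow> A s = a \<oplus> s \<otimes> (y \<oplus> s \<otimes> R s)"
  shows "\<exists>Q. poly_fun Q \<and> (\<forall>s \<in> center. A s [^] n = a [^] n \<oplus> s \<otimes> (pow_dev a n y \<oplus> s \<otimes> Q s))"
proof (induction n)
  case 0
  show ?case by (intro exI[of _ "\<lambda>s. \<zero>"]) auto
next
  case (Suc n)
  then obtain Q where Q: "poly_fun Q"
    "\<And>s. s \<in> center \<Longrightarrow> A s [^] n = a [^] n \<oplus> s \<otimes> (pow_dev a n y \<oplus> s \<otimes> Q s)" by blast
  define p where "p = a [^] n"
  define P where "P = pow_dev a n y"
  have C: "p \<in> carrier D" "P \<in> carrier D" unfolding p_def P_def using a y by auto
  define Q' where "Q' s = a \<otimes> Q s \<oplus> R s \<otimes> p \<oplus> (y \<oplus> s \<otimes> R s) \<otimes> (P \<oplus> s \<otimes> Q s)" for s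
  have "poly_fun Q'"
    unfolding Q'_def by (intro poly_fun_add poly_fun_mult poly_fun_const poly_fun_id Q(1) R a y C)
  moreover have "A s [^] Suc n = a [^] Suc n \<oplus> s \<otimes> (pow_dev a (Suc n) y \<oplus> s \<otimes> Q' s)"
    if s: "s \<in> center" for s
  proof -
    have sC: "s \<in> carrier D" "R s \<in> carrier D" "Q s \<in> carrier D"
      using s poly_fun_closed[OF R s] poly_fun_closed[OF Q(1) s] by auto
    define B where "B = y \<oplus> s \<otimes> R s"
    define W where "W = P \<oplus> s \<otimes> Q s"
    have BW: "B \<in> carrier D" "W \<in> carrier D" unfolding B_def W_def using sC C y by auto
    have AC: "A s \<in> carrier D" using A[OF s] a BW(1) sC by (simp add: B_def)
    have sw: "a \<otimes> (s \<otimes> W) = s \<otimes> (a \<otimes> W)" "B \<otimes> (s \<otimes> W) = s \<otimes> (B \<otimes> W)" "a \<otimes> (s \<otimes> Q s) = s \<otimes> (a \<otimes> Q s)"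
      using center_swap[OF s] a BW sC by auto
    have aW: "a \<otimes> W = a \<otimes> P \<oplus> s \<otimes> (a \<otimes> Q s)" unfolding W_def sw(3)[symmetric] using a C sC by (simp add: r_distr)
    have Bp: "B \<otimes> p = y \<otimes> p \<oplus> s \<otimes> (R s \<otimes> p)" unfolding B_def using y C sC by (simp add: l_distr m_assoc)
    have "A s [^] Suc n = A s \<otimes> A s [^] n" using nat_pow_Suc2[OF AC] .
    also have "\<dots> = (a \<oplus> s \<otimes> B) \<otimes> (p \<oplus> s \<otimes> W)" unfolding Q(2)[OF s] unfolding A[OF s] by (simp add: p_def P_def B_def W_def)
    also have "\<dots> = a \<otimes> p \<oplus> a \<otimes> (s \<otimes> W) \<oplus> s \<otimes> (B \<otimes> p) \<oplus> s \<otimes> (B \<otimes> (s \<otimes> W))"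
      using a C BW sC by algebra
    also have "\<dots> = a \<otimes> p \<oplus> s \<otimes> (a \<otimes> P \<oplus> s \<otimes> (a \<otimes> Q s)) \<oplus> s \<otimes> (y \<otimes> p \<oplus> s \<otimes> (R s \<otimes> p)) \<oplus> s \<otimes> (s \<otimes> (B \<otimes> W))"
      unfolding sw aW Bp ..
    also have "\<dots> = a \<otimes> p \<oplus> s \<otimes> ((y \<otimes> p \<oplus> a \<otimes> P) \<oplus> s \<otimes> (a \<otimes> Q s \<oplus> R s \<otimes> p \<oplus> B \<otimes> W))"
      using a y C BW sC by algebra
    finally show ?thesis unfolding nat_pow_Suc2[OF a] by (simp add: p_def P_def B_def W_def Q'_def)
  qed
  ultimately show ?case by blast
qed

lemma eval_deform:
  assumes a: "a \<in> carrier D" and y: "y \<in> carrier D" and R: "poly_fun R"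
    and A: "\<And>s. s \<in> center \<Longrightarrow> A s = a \<oplus> s \<otimes> (y \<oplus> s \<otimes> R s)" and q: "set q \<subseteq> center"
  shows "\<exists>Q. poly_fun Q \<and> (\<forall>s \<in> center. eval q (A s) = eval q a \<oplus> s \<otimes> (eval_dev a q y \<oplus> s \<otimes> Q s))"
  using q
proof (induction q)
  case Nil
  show ?case by (intro exI[of _ "\<lambda>s. \<zero>"]) auto
next
  case (Cons c q)
  then obtain Q where Q: "poly_fun Q"
    "\<And>s. s \<in> center \<Longrightarrow> eval q (A s) = eval q a \<oplus> s \<otimes> (eval_dev a q y \<oplus> s \<otimes> Q s)" by auto
  obtain P where P: "poly_fun P"
    "\<And>s. s \<in> center \<Longrightarrow> A s [^] length q = a [^] length q \<oplus> s \<otimes> (pow_dev a (length q) y \<oplus> s \<otimes> P s)"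
    using pow_deform[OF a y R A] by blast
  have c: "c \<in> center" "c \<in> carrier D" "set q \<subseteq> center" "set q \<subseteq> carrier D" using Cons.prems by auto
  have "poly_fun (\<lambda>s. c \<otimes> P s \<oplus> Q s)"
    by (intro poly_fun_add poly_fun_mult poly_fun_const P(1) Q(1) c)
  moreover have "eval (c # q) (A s) = eval (c # q) a \<oplus> s \<otimes> (eval_dev a (c # q) y \<oplus> s \<otimes> (c \<otimes> P s \<oplus> Q s))"
    if s: "s \<in> center" for s
  proof -
    define p where "p = a [^] length q"
    define d where "d = pow_dev a (length q) y"
    define e where "e = eval q a"
    define E where "E = eval_dev a q y"
    have C: "p \<in> carrier D" "d \<in> carrier D" "e \<in> carrier D" "E \<in> carrier D" "s \<in> carrier D" "P s \<in> carrier D" "Q s \<in> carrier D"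
      unfolding p_def d_def e_def E_def
      using a y c s eval_in_carrier poly_fun_closed[OF P(1) s] poly_fun_closed[OF Q(1) s] by auto
    have sw: "c \<otimes> (s \<otimes> (d \<oplus> s \<otimes> P s)) = s \<otimes> (c \<otimes> (d \<oplus> s \<otimes> P s))" "c \<otimes> (s \<otimes> P s) = s \<otimes> (c \<otimes> P s)"
      using center_swap[OF s c(2)] C by auto
    have "c \<otimes> (p \<oplus> s \<otimes> (d \<oplus> s \<otimes> P s)) \<oplus> (e \<oplus> s \<otimes> (E \<oplus> s \<otimes> Q s))
      = c \<otimes> p \<oplus> c \<otimes> (s \<otimes> (d \<oplus> s \<otimes> P s)) \<oplus> (e \<oplus> s \<otimes> (E \<oplus> s \<otimes> Q s))"
      using C c(2) by algebra
    also have "\<dots> = c \<otimes> p \<oplus> s \<otimes> (c \<otimes> d \<oplus> c \<otimes> (s \<otimes> P s)) \<oplus> (e \<oplus> s \<otimes> (E \<oplus> s \<otimes> Q s))"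
      unfolding sw(1) using C c(2) by algebra
    also have "\<dots> = (c \<otimes> p \<oplus> e) \<oplus> s \<otimes> ((c \<otimes> d \<oplus> E) \<oplus> s \<otimes> (c \<otimes> P s \<oplus> Q s))"
      unfolding sw(2) using C c(2) by algebra
    finally show ?thesis using P(2)[OF s] Q(2)[OF s] by (simp add: p_def d_def e_def E_def)
  qed
  ultimately show ?case by blast
qed

text \<open>
  The first-order term of the minimal polynomial along a deformation of \<open>a\<close> whose members have
  no larger degree than \<open>a\<close> lies in the field generated by \<open>a\<close>: otherwise it would be independent
  of the lower powers also at nearby parameters.
\<close>
lemma deformation:
  assumes inf: "infinite center" and a: "a \<in> carrier D" and y: "y \<in> carrier D" and R: "poly_fun R"
    and A: "\<And>s. s \<in> center \<Longrightarrow> A s = a \<oplus> s \<otimes> (y \<oplus> s \<otimes> R s)"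
    and q: "set q \<subseteq> center" "length q = r" "eval (\<one> # q) a = \<zero>"
    and ind: "independent center (exp_base a r)"
    and B: "finite B" and dep: "\<And>s. s \<in> center - B \<Longrightarrow> dependent center (exp_base (A s) (Suc r))"
  shows "eval_dev a (\<one> # q) y \<in> Span center (exp_base a r)"
proof (rule ccontr)
  assume notin: "eval_dev a (\<one> # q) y \<notin> Span center (exp_base a r)"
  have q1: "set (\<one> # q) \<subseteq> center" using q(1) by simp
  define e where "e = eval_dev a (\<one> # q) y"
  have e: "e \<in> carrier D" unfolding e_def using eval_dev_closed[OF a y q1] .
  obtain G where G: "poly_fun G"
    "\<And>s. s \<in> center \<Longrightarrow> eval (\<one> # q) (A s) = eval (\<one> # q) a \<oplus> s \<otimes> (e \<oplus> s \<otimes> G s)"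
    unfolding e_def using eval_deform[OF a y R A q1] by blast
  \<comment> \<open>The minimal polynomial of \<open>a\<close> evaluated at \<open>A s\<close> is
    \<open>s\<close> times \<open>w s\<close>. Dividing by \<open>s\<close> leaves a function that
    still makes sense at \<open>\<zero>\<close>, where it equals the derivative \<open>e\<close>.
    For generic \<open>s\<close>, \<open>w s\<close> stays independent of the lower powers of
    \<open>A s\<close>, yet dependence of the next power puts it into their span.\<close>
  define w where "w s = e \<oplus> s \<otimes> G s" for s
  have pA: "poly_fun A"
    by (rule poly_fun_cong[OF _ A]) (intro poly_fun_add poly_fun_mult poly_fun_const poly_fun_id R a y)
  have pw: "poly_fun w" unfolding w_def by (intro poly_fun_add poly_fun_mult poly_fun_const poly_fun_id G(1) e)
  define vs where "vs = w # map (\<lambda>i s. A s [^] i) (rev [0..<r])"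
  have vs_eq: "map (\<lambda>v. v s) vs = w s # exp_base (A s) r" for s
    by (simp add: vs_def exp_base_def)
  have "poly_fun v" if "v \<in> set vs" for v
    using that pw poly_fun_pow[OF pA] unfolding vs_def by auto
  moreover have "A \<zero> = a" "w \<zero> = e"
    using A[of \<zero>] a y e poly_fun_closed[OF R] poly_fun_closed[OF G(1)] by (auto simp: w_def)
  then have "independent center (map (\<lambda>v. v \<zero>) vs)"
    unfolding vs_eq using li_Cons[OF e] notin ind by (simp add: e_def)
  ultimately have "finite {s \<in> center. dependent center (map (\<lambda>v. v s) vs)}" (is "finite ?B'")
    by (rule finite_dependent)
  then have "infinite (center - (?B' \<union> B \<union> {\<zero>}))" using inf B by simp
  then have "center - (?B' \<union> B \<union> {\<zero>}) \<noteq> {}" by (metis finite.emptyI)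
  then obtain s where s: "s \<in> center - (?B' \<union> B \<union> {\<zero>})" by blast
  then have sF: "s \<in> center" "s \<noteq> \<zero>" and ind': "independent center (w s # exp_base (A s) r)"
    and dep': "dependent center (exp_base (A s) (Suc r))"
    using vs_eq dep by auto
  have AC: "A s \<in> carrier D" using poly_fun_closed[OF pA sF(1)] .
  have U: "set (exp_base (A s) r) \<subseteq> carrier D" using AC by (auto simp: exp_base_set)
  note Span = Span_subgroup_props[OF ring_center_subfield U] Span_smult_closed[OF ring_center_subfield U]
  have wC: "w s \<in> carrier D" using poly_fun_closed[OF pw sF(1)] .
  have "A s [^] r \<in> Span center (exp_base (A s) r)"
    using dep' independent_backwards(2)[OF ind'] li_Cons[of "A s [^] r" center "exp_base (A s) r"] AC
    by (auto simp: exp_base_Suc)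
  moreover have "eval q (A s) \<in> Span center (exp_base (A s) r)"
    using combine_eq_eval[of q "A s"] q Span_mem_iff_length_version[OF ring_center_subfield U] by (metis length_exp_base)
  ultimately have "A s [^] r \<oplus> eval q (A s) \<in> Span center (exp_base (A s) r)" using Span by simp
  moreover have "A s [^] r \<oplus> eval q (A s) = s \<otimes> w s"
    using G(2)[OF sF(1)] q AC sF wC by (simp add: w_def)
  ultimately have "w s \<in> Span center (exp_base (A s) r)"
    using Span_m_inv_simprule[OF ring_center_subfield U _ wC, of s] sF by simp
  then show False using independent_backwards(1)[OF ind'] by blast
qed

end

section \<open>Normal subgroups with elements of bounded degree: infinite center\<close>

context skew_field
begin

lemma eval_center: "set q \<subseteq> center \<Longrightarrow> s \<in> center \<Longrightarrow> eval q s \<in> center"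
  by (induction q) auto

lemma eval_commutes:
  assumes "set q \<subseteq> center" "x \<in> carrier D"
  shows "x \<otimes> eval q x = eval q x \<otimes> x"
  using assms(1)
proof (induction q)
  case (Cons c q)
  have C: "c \<in> center" "eval q x \<in> carrier D" using Cons.prems eval_in_carrier[of q x] assms(2) by auto
  have "x \<otimes> (c \<otimes> x [^] length q) = c \<otimes> x [^] length q \<otimes> x"
    using center_swap[OF C(1) assms(2), of "x [^] length q"] C assms(2)
      group_commutes_pow[of x x "length q"] by (simp add: m_assoc)
  then show ?case using Cons C assms(2) by (simp add: l_distr r_distr)
qed (use assms in simp)

text \<open>With n the degree of \<open>q\<close>, the value \<open>eval (rev q) s\<close> is s^n
  q(1/s) for nonzero s, and q(1/s) - q(x) is divisible by 1/s - x. If \<open>q\<close> annihilates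
  \<open>x\<close>, then \<open>1 - s x\<close> divides a central scalar, so its inverse is
  polynomial in \<open>s\<close> up to that scalar.\<close>

lemma one_minus_factor:
  assumes x: "x \<in> carrier D" and q: "set q \<subseteq> center"
  shows "\<exists>Q. poly_fun Q \<and> (\<forall>s \<in> center.
    (\<one> \<ominus> s \<otimes> x) \<otimes> Q s = eval (rev q) s \<ominus> s [^] (length q - 1) \<otimes> eval q x)"
  using q
proof (induction q rule: rev_induct)
  case Nil
  then show ?case using x by (intro exI[of _ "\<lambda>s. \<zero>"]) (auto simp: minus_eq)
next
  case (snoc b q)
  have C: "set q \<subseteq> center" "b \<in> center" "set q \<subseteq> carrier D" "b \<in> carrier D" using snoc.prems by auto
  obtain Q where Q: "poly_fun Q" "\<And>s. s \<in> center \<Longrightarrow>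
    (\<one> \<ominus> s \<otimes> x) \<otimes> Q s = eval (rev q) s \<ominus> s [^] (length q - 1) \<otimes> eval q x"
    using snoc.IH[OF C(1)] by blast
  define E where "E = eval q x"
  have E: "E \<in> carrier D" unfolding E_def using eval_in_carrier[OF C(3) x] .
  have xE: "x \<otimes> E = E \<otimes> x" unfolding E_def using eval_commutes[OF C(1) x] .
  have "poly_fun (\<lambda>s. Q s \<oplus> s [^] (length q - 1) \<otimes> E)"
    by (intro poly_fun_add poly_fun_mult poly_fun_pow poly_fun_id poly_fun_const Q(1) E)
  moreover have "(\<one> \<ominus> s \<otimes> x) \<otimes> (Q s \<oplus> s [^] (length q - 1) \<otimes> E)
    = eval (rev (q @ [b])) s \<ominus> s [^] (length (q @ [b]) - 1) \<otimes> eval (q @ [b]) x" if s: "s \<in> center" for s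
  proof -
    define t where "t = s [^] (length q - 1)"
    define u where "u = s [^] length q"
    define P where "P = eval (rev q) s"
    have tF: "t \<in> center" "u \<in> center" "P \<in> center" unfolding t_def u_def P_def using s C eval_center by auto
    have c: "t \<in> carrier D" "u \<in> carrier D" "P \<in> carrier D" "s \<in> carrier D" "Q s \<in> carrier D"
      using tF s poly_fun_closed[OF Q(1) s] by auto
    have stE: "s \<otimes> (t \<otimes> (x \<otimes> E)) = u \<otimes> (E \<otimes> x)"
    proof (cases "q = []")
      case True
      then show ?thesis using c x by (simp add: E_def)
    next
      case False
      then have "s \<otimes> t = u" unfolding t_def u_def using nat_pow_Suc2[OF c(4), of "length q - 1"] by (cases q) auto
      then show ?thesis unfolding xE using c x E by (simp add: m_assoc[symmetric])
    qed
    have xt: "x \<otimes> (t \<otimes> E) = t \<otimes> (x \<otimes> E)" using center_swap[OF tF(1) x E] .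
    have bu: "u \<otimes> b = b \<otimes> u" using centerD tF C by auto
    have "(\<one> \<ominus> s \<otimes> x) \<otimes> (Q s \<oplus> t \<otimes> E) = (\<one> \<ominus> s \<otimes> x) \<otimes> Q s \<oplus> \<one> \<otimes> (t \<otimes> E) \<ominus> s \<otimes> (x \<otimes> (t \<otimes> E))"
      using c x E one_closed by algebra
    also have "\<dots> = P \<ominus> t \<otimes> E \<oplus> t \<otimes> E \<ominus> u \<otimes> (E \<otimes> x)"
      unfolding xt stE Q(2)[OF s] using c E by (simp add: P_def t_def E_def)
    also have "\<dots> = b \<otimes> u \<oplus> P \<ominus> (u \<otimes> (E \<otimes> x) \<oplus> b \<otimes> u)"
      using c x E C by algebra
    also have "\<dots> = b \<otimes> u \<oplus> P \<ominus> u \<otimes> (E \<otimes> x \<oplus> b)"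
      unfolding bu[symmetric] using c x E C by (simp add: r_distr)
    finally show ?thesis
      using eval_append_aux[OF C(3,4) x] by (simp add: t_def u_def P_def E_def)
  qed
  ultimately show ?case by blast
qed

text \<open>This allows a central denominator to be cleared from a family in \<open>N\<close>: the
  scaled elements leave \<open>N\<close> but keep their degree over the center.\<close>

lemma exp_base_scale:
  assumes k: "k \<in> center" "k \<noteq> \<zero>" and x: "x \<in> carrier D"
  shows "Span center (exp_base (k \<otimes> x) n) = Span center (exp_base x n)"
    and "independent center (exp_base (k \<otimes> x) n) \<Longrightarrow> independent center (exp_base x n)"
proof -
  have pow: "(k \<otimes> x) [^] n = k [^] n \<otimes> x [^] n" for n :: nat
    using k x centerD[of k x] by (intro pow_mult_distrib) auto
  have Span_eq: "Span center (exp_base (k \<otimes> x) n) = Span center (exp_base x n)" for n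
  proof (induction n)
    case (Suc n)
    have "line_extension center (c \<otimes> u) E = line_extension center u E"
      if c: "c \<in> center" "c \<noteq> \<zero>" and u: "u \<in> carrier D" for c u E
    proof (intro equalityI subsetI)
      fix w assume "w \<in> line_extension center (c \<otimes> u) E"
      then obtain l v where "l \<in> center" "v \<in> E" "w = l \<otimes> (c \<otimes> u) \<oplus> v"
        unfolding line_extension_mem_iff by blast
      moreover have "l \<otimes> (c \<otimes> u) = (l \<otimes> c) \<otimes> u" using \<open>l \<in> center\<close> c u by (simp add: m_assoc)
      ultimately show "w \<in> line_extension center u E"
        unfolding line_extension_mem_iff using c(1) center_closed(5) by metis
    next
      fix w assume "w \<in> line_extension center u E"
      then obtain l v where "l \<in> center" "v \<in> E" "w = l \<otimes> u \<oplus> v"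
        unfolding line_extension_mem_iff by blast
      moreover have "l \<otimes> u = (l \<otimes> inv c) \<otimes> (c \<otimes> u)" using \<open>l \<in> center\<close> c u by (simp add: m_assoc)
      ultimately show "w \<in> line_extension center (c \<otimes> u) E"
        unfolding line_extension_mem_iff using center_inv[OF c] center_closed(5) by metis
    qed
    then show ?case using Suc pow k x pow_zero_iff[of k n] by (simp add: exp_base_Suc)
  qed (simp add: exp_base_def)
  then show "Span center (exp_base (k \<otimes> x) n) = Span center (exp_base x n)" .
  show "independent center (exp_base x n)" if "independent center (exp_base (k \<otimes> x) n)"
    using that
  proof (induction n)
    case (Suc n)
    have U: "set (exp_base x n) \<subseteq> carrier D" using x by (auto simp: exp_base_set)
    have ind: "independent center (exp_base x n)" and notin: "(k \<otimes> x) [^] n \<notin> Span center (exp_base x n)"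
      using Suc independent_backwards Span_eq unfolding exp_base_Suc by blast+
    have "x [^] n \<notin> Span center (exp_base x n)"
    proof
      assume "x [^] n \<in> Span center (exp_base x n)"
      then have "k [^] n \<otimes> x [^] n \<in> Span center (exp_base x n)"
        using Span_smult_closed[OF ring_center_subfield U] k by simp
      then show False using notin pow by simp
    qed
    then show ?case using ind li_Cons x by (simp add: exp_base_Suc)
  qed (simp add: exp_base_def)
qed

lemma monic_relation:
  assumes a: "a \<in> carrier D" and ind: "independent center (exp_base a r)"
    and dep: "dependent center (exp_base a (Suc r))"
  shows "\<exists>q. set q \<subseteq> center \<and> length q = r \<and> eval (\<one> # q) a = \<zero>"
proof -
  have U: "set (exp_base a r) \<subseteq> carrier D" using a by (auto simp: exp_base_set)
  have "a [^] r \<in> Span center (exp_base a r)"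
    using dep ind li_Cons[of "a [^] r" center "exp_base a r"] a by (auto simp: exp_base_Suc)
  then obtain Ks where Ks: "set Ks \<subseteq> center" "length Ks = r" "a [^] r = combine Ks (exp_base a r)"
    using Span_mem_iff_length_version[OF ring_center_subfield U] by auto
  have KC: "set Ks \<subseteq> carrier D" using Ks by auto
  define q where "q = map ((\<otimes>) (\<ominus> \<one>)) Ks"
  have q: "set q \<subseteq> center" "length q = r" unfolding q_def using Ks by auto
  have "eval q a = combine q (exp_base a r)" using combine_eq_eval[of q a] q by simp
  also have "\<dots> = \<ominus> \<one> \<otimes> a [^] r"
    unfolding q_def Ks(3) by (rule combine_r_distr[symmetric]) (use KC U in auto)
  finally have "eval (\<one> # q) a = \<zero>" using q a by (simp add: l_minus r_neg)
  then show ?thesis using q by blast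
qed

lemma Span_exp_base_commute:
  assumes a: "a \<in> carrier D" and x: "x \<in> carrier D" "a \<otimes> x = x \<otimes> a" and v: "v \<in> Span center (exp_base a r)"
  shows "v \<otimes> x = x \<otimes> v"
proof -
  have U: "set (exp_base a r) \<subseteq> carrier D" using a by (auto simp: exp_base_set)
  show ?thesis
    using v U
  proof (induction v rule: Span_induct)
    case (add k u v)
    then obtain i :: nat where u: "u = a [^] i" by (auto simp: exp_base_set)
    have "u \<otimes> x = x \<otimes> u" unfolding u using group_commutes_pow[OF x(2) a x(1)] .
    then show ?case using add center_swap[OF add(1) x(1), of u] a x(1) u
      by (simp add: l_distr r_distr m_assoc)
  qed (use x in simp)
qed

lemma independent_exp_base_mono:
  assumes "independent center (exp_base a m)" "k \<le> m"
  shows "independent center (exp_base a k)"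
proof -
  have "exp_base a m = take (m - k) (exp_base a m) @ exp_base a k"
    using drop_exp_base[of "m - k" a m] assms(2) append_take_drop_id[of "m - k" "exp_base a m"] by simp
  then show ?thesis using independent_split(1)[OF ring_center_subfield] assms(1) by metis
qed

text \<open>The centralizer of \<open>a\<close> is \<open>L\<close>, and it suffices that
  \<open>D\<close> has dimension at most \<open>r\<close> over \<open>L\<close>. For more than
  \<open>r\<close> vectors the \<open>r\<close> equations indexed by the powers \<open>a^i\<close>
  have a nontrivial solution; by linearity it is a relation at every \<open>x\<close> in
  \<open>L\<close>, which \<open>centralizer_independent\<close> excludes for vectors independent
  over \<open>L\<close>. Since \<open>L\<close> has dimension \<open>r\<close> over the center, the
  bound \<open>r * r\<close> follows.\<close>

lemma dimension_of_center:
  assumes a: "a \<in> carrier D" and ind: "independent center (exp_base a r)"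
    and dep: "dependent center (exp_base a (Suc r))"
    and central: "\<And>c. \<lbrakk>c \<in> carrier D; c \<otimes> a = a \<otimes> c\<rbrakk> \<Longrightarrow> c \<in> Span center (exp_base a r)"
  shows "\<exists>n \<le> r\<^sup>2. dimension n center (carrier D)"
proof -
  define L where "L = Span center (exp_base a r)"
  note L = Span_exp_base[OF a ind dep, folded L_def]
  have U: "set (exp_base a r) \<subseteq> carrier D" using a by (auto simp: exp_base_set)
  have LC: "L \<subseteq> carrier D" using subfieldE(3)[OF L(1)] .
  have bound: "length Ys \<le> r" if Ys: "independent L Ys" for Ys
  proof (rule ccontr)
    assume "\<not> length Ys \<le> r"
    then have len: "length (map (\<lambda>i. (\<otimes>) (a [^] i)) [0..<r]) < length Ys" by simp
    have YC: "set Ys \<subseteq> carrier D" using independent_in_carrier[OF Ys] .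
    have "\<exists>cs. length cs = length Ys \<and> set cs \<subseteq> carrier D \<and> \<not> set cs \<subseteq> {\<zero>} \<and>
      (\<forall>f \<in> set (map (\<lambda>i. (\<otimes>) (a [^] i)) [0..<r]). combine cs (map f Ys) = \<zero>)"
      by (rule homogeneous_system[OF len]) (use YC a in auto)
    then obtain cs where cs: "length cs = length Ys" "set cs \<subseteq> carrier D" "\<not> set cs \<subseteq> {\<zero>}"
      and all: "\<forall>f \<in> set (map (\<lambda>i. (\<otimes>) (a [^] i)) [0..<r]). combine cs (map f Ys) = \<zero>"
      by (elim exE conjE)
    have rel: "combine cs (map ((\<otimes>) (a [^] i)) Ys) = \<zero>" if "i < r" for i
      using all that by auto
    have "combine cs (map ((\<otimes>) x) Ys) = \<zero>" if x: "x \<in> L" for x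
      using x[unfolded L_def] U
    proof (induction x rule: Span_induct)
      case zero
      have "combine cs (map ((\<otimes>) \<zero>) Ys) = \<zero>"
        using cs(1,2) YC by (induction cs Ys rule: list_induct2) auto
      then show ?case .
    next
      case (add k u v)
      then obtain i where i: "u = a [^] i" "i < r" by (auto simp: exp_base_set)
      have "combine cs (map ((\<otimes>) (k \<otimes> u \<oplus> v)) Ys)
        = k \<otimes> combine cs (map ((\<otimes>) u) Ys) \<oplus> combine cs (map ((\<otimes>) v) Ys)"
        using cs(1,2) YC
      proof (induction cs Ys rule: list_induct2)
        case (Cons c cs w Ys)
        define A where "A = combine cs (map ((\<otimes>) u) Ys)"
        define B where "B = combine cs (map ((\<otimes>) v) Ys)"
        have C: "A \<in> carrier D" "B \<in> carrier D" "c \<in> carrier D" "w \<in> carrier D" "u \<in> carrier D" "k \<in> carrier D" "v \<in> carrier D"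
          unfolding A_def B_def using Cons.prems add i a
          by (auto simp: subset_eq intro!: combine_in_carrier)
        have "c \<otimes> ((k \<otimes> u \<oplus> v) \<otimes> w) \<oplus> (k \<otimes> A \<oplus> B) = c \<otimes> (k \<otimes> (u \<otimes> w)) \<oplus> c \<otimes> (v \<otimes> w) \<oplus> (k \<otimes> A \<oplus> B)"
          using C by algebra
        also have "c \<otimes> (k \<otimes> (u \<otimes> w)) = k \<otimes> (c \<otimes> (u \<otimes> w))" using center_swap[OF add(1)] C by simp
        also have "k \<otimes> (c \<otimes> (u \<otimes> w)) \<oplus> c \<otimes> (v \<otimes> w) \<oplus> (k \<otimes> A \<oplus> B)
          = k \<otimes> (c \<otimes> (u \<otimes> w) \<oplus> A) \<oplus> (c \<otimes> (v \<otimes> w) \<oplus> B)" using C by algebra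
        finally show ?case using Cons by (simp add: A_def B_def)
      qed (use add in simp)
      then show ?case using add i rel by simp
    qed
    then have "set cs \<subseteq> {\<zero>}"
      using cs(1,2) subringE(3,6)[OF subfieldE(1)[OF L(1)]] L(3) a central
      by (intro centralizer_independent[OF L(1), of "{a}" L Ys cs] Ys LC) (auto simp: L_def)
    then show False using cs(3) by simp
  qed
  \<comment> \<open>The bound provides a longest independent list, and it spans \<open>D\<close>
    because a vector outside its span would lengthen it.\<close>
  define k where "k = (GREATEST k. \<exists>Ys. independent L Ys \<and> length Ys = k)"
  have ex: "\<exists>k Ys. independent L Ys \<and> length Ys = k" using li_Nil by blast
  have bd: "\<forall>k. (\<exists>Ys. independent L Ys \<and> length Ys = k) \<longrightarrow> k \<le> r" using bound by blast
  have "\<exists>Ys. independent L Ys \<and> length Ys = k"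
    unfolding k_def by (rule GreatestI_ex_nat[OF ex]) (use bd in blast)
  then obtain Ys where Ys: "independent L Ys" "length Ys = k" by blast
  have greatest: "length Zs \<le> k" if "independent L Zs" for Zs
    unfolding k_def by (rule Greatest_le_nat[where b = r]) (use that bd in blast)+
  have "Span L Ys = carrier D"
  proof
    show "Span L Ys \<subseteq> carrier D" using Span_in_carrier[OF LC independent_in_carrier[OF Ys(1)]] .
    show "carrier D \<subseteq> Span L Ys"
    proof
      fix u assume u: "u \<in> carrier D"
      show "u \<in> Span L Ys"
      proof (rule ccontr)
        assume "u \<notin> Span L Ys"
        then have "independent L (u # Ys)" using li_Cons u Ys by blast
        from greatest[OF this] show False using Ys(2) by simp
      qed
    qed
  qed
  then have "dimension k L (carrier D)" using dimension_independent[OF Ys(1)] Ys(2) by simp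
  then have "dimension (r * k) center (carrier D)"
    using telescopic_base[OF ring_center_subfield L(1) L(4)] by blast
  moreover have "r * k \<le> r\<^sup>2" using bound[OF Ys(1)] Ys(2) by (simp add: power2_eq_square)
  ultimately show ?thesis by blast
qed

end

context noncentral_normal_subgroup
begin

text \<open>With \<open>g = a b^{-1}\<close>, the element
  \<open>(1 - s y0) g (1 - s y0)^{-1} b\<close> lies in \<open>N\<close> and equals \<open>a\<close>
  at \<open>s = \<zero>\<close>. Its product with the central scalar \<open>P s\<close>, where
  \<open>P\<close> is the reversed minimal polynomial of \<open>y0\<close>, is polynomial in
  \<open>s\<close>. The summand \<open>k a\<close> of the tangent is the price of this factor:
  \<open>k\<close> is the derivative of \<open>P\<close> at \<open>\<zero>\<close>.\<close>

lemma tangent: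
  assumes inf: "infinite center" and a: "a \<in> N" and ind: "independent center (exp_base a r)"
    and dep: "\<And>n. n \<in> N \<Longrightarrow> dependent center (exp_base n (Suc r))"
    and q: "set q \<subseteq> center" "length q = r" "eval (\<one> # q) a = \<zero>"
    and b: "b \<in> N" and y0: "y0 \<in> N"
  shows "\<exists>k \<in> center. eval_dev a (\<one> # q) (k \<otimes> a \<oplus> a \<otimes> inv b \<otimes> y0 \<otimes> b \<ominus> y0 \<otimes> a) \<in> Span center (exp_base a r)"
proof -
  have C: "a \<in> carrier D" "b \<in> carrier D" "b \<noteq> \<zero>" "y0 \<in> carrier D" using a b y0 N_carrier_nonzero by auto
  define g where "g = a \<otimes> inv b"
  have g: "g \<in> N" "g \<in> carrier D" unfolding g_def using a b N_mult N_inv N_carrier_nonzero by auto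
  have gb: "g \<otimes> b = a" unfolding g_def using C by (simp add: m_assoc)
  obtain r' where "independent center (exp_base y0 r')" "dependent center (exp_base y0 (Suc r'))"
    using minimal_dependence[OF dep[OF y0]] by blast
  then obtain p where p: "set p \<subseteq> center" "eval (\<one> # p) y0 = \<zero>"
    using monic_relation[OF C(4)] by blast
  have rev_p: "set (rev p) \<subseteq> carrier D" using p(1) by auto
  obtain Q where Q: "poly_fun Q" "\<And>s. s \<in> center \<Longrightarrow> (\<one> \<ominus> s \<otimes> y0) \<otimes> Q s = eval (rev p @ [\<one>]) s"
  proof -
    obtain Q where Q: "poly_fun Q" "\<forall>s \<in> center. (\<one> \<ominus> s \<otimes> y0) \<otimes> Q s
      = eval (rev (\<one> # p)) s \<ominus> s [^] (length (\<one> # p) - 1) \<otimes> eval (\<one> # p) y0"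
      using one_minus_factor[OF C(4), of "\<one> # p"] p(1) by auto
    have "(\<one> \<ominus> s \<otimes> y0) \<otimes> Q s = eval (rev p @ [\<one>]) s" if s: "s \<in> center" for s
    proof -
      have "eval (rev p @ [\<one>]) s \<in> carrier D" using eval_in_carrier[of "rev p @ [\<one>]" s] rev_p s by auto
      then show ?thesis using Q(2) s p(2) by (simp add: minus_eq del: eval.simps)
    qed
    then show ?thesis using that Q(1) by blast
  qed
  define P where "P s = eval (rev p @ [\<one>]) s" for s
  define P1 where "P1 s = eval (rev p) s" for s
  have pP1: "poly_fun P1" unfolding P1_def using poly_fun_eval[OF rev_p] .
  have pP: "poly_fun P" unfolding P_def using rev_p by (intro poly_fun_eval) auto
  have P_P1: "P s = P1 s \<otimes> s \<oplus> \<one>" if "s \<in> carrier D" for s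
    unfolding P_def P1_def using eval_append_aux[OF rev_p one_closed that] .
  \<comment> \<open>\<open>P\<close> begins with \<open>1 + k s\<close>, because the reversal of a
    monic polynomial has constant term \<open>\<one>\<close>.\<close>
  obtain k P2 where k: "k \<in> center" and P2: "poly_fun P2" "\<And>s. s \<in> center \<Longrightarrow> P1 s = k \<oplus> s \<otimes> P2 s"
  proof (cases p)
    case Nil
    have "P1 s = \<zero> \<oplus> s \<otimes> \<zero>" if "s \<in> center" for s using that by (simp add: P1_def Nil)
    then show ?thesis using that[of \<zero> "\<lambda>s. \<zero>"] by auto
  next
    case (Cons c p')
    have c: "c \<in> center" "set (rev p') \<subseteq> carrier D" using p(1) Cons by auto
    have "P1 s = c \<oplus> s \<otimes> eval (rev p') s" if s: "s \<in> center" for s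
      using eval_append_aux[OF c(2), of c s] s c(1) centerD[OF s] eval_in_carrier[OF c(2), of s]
      by (simp add: P1_def Cons a_comm)
    then show ?thesis using that[of c "eval (rev p')"] c poly_fun_eval[OF c(2)] by blast
  qed
  have kC: "k \<in> carrier D" using k by simp
  \<comment> \<open>\<open>Q s = 1 + s V s\<close> and \<open>V s = k + y0 + s T s\<close> are the
    successive expansions at \<open>\<zero>\<close>. They separate the tangent of \<open>A\<close>
    from its second-order remainder \<open>R\<close>.\<close>
  define V where "V s = P1 s \<oplus> y0 \<otimes> Q s" for s
  have pV: "poly_fun V" unfolding V_def by (intro poly_fun_add poly_fun_mult poly_fun_const pP1 Q(1) C)
  define T where "T s = P2 s \<oplus> y0 \<otimes> V s" for s
  have pT: "poly_fun T" unfolding T_def by (intro poly_fun_add poly_fun_mult poly_fun_const P2(1) pV C)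
  define R where "R s = g \<otimes> T s \<otimes> b \<ominus> y0 \<otimes> (g \<otimes> V s \<otimes> b)" for s
  have pR: "poly_fun R" unfolding R_def by (intro poly_fun_minus poly_fun_mult poly_fun_const pT pV g C)
  define A where "A s = (\<one> \<ominus> s \<otimes> y0) \<otimes> g \<otimes> Q s \<otimes> b" for s
  let ?y = "k \<otimes> a \<oplus> a \<otimes> inv b \<otimes> y0 \<otimes> b \<ominus> y0 \<otimes> a"
  have yC: "?y \<in> carrier D" using C kC by simp
  have A_eq: "A s = a \<oplus> s \<otimes> (?y \<oplus> s \<otimes> R s)" if s: "s \<in> center" for s
  proof -
    have c: "s \<in> carrier D" "Q s \<in> carrier D" "V s \<in> carrier D" "T s \<in> carrier D" "P2 s \<in> carrier D" "P1 s \<in> carrier D"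
      using s poly_fun_closed[OF _ s] Q(1) pV pT P2(1) pP1 by auto
    have QV: "Q s = \<one> \<oplus> s \<otimes> V s"
    proof -
      have "Q s = (\<one> \<ominus> s \<otimes> y0) \<otimes> Q s \<oplus> s \<otimes> (y0 \<otimes> Q s)"
      proof -
        have "\<one> \<otimes> Q s = (\<one> \<ominus> s \<otimes> y0) \<otimes> Q s \<oplus> s \<otimes> (y0 \<otimes> Q s)"
          using c C one_closed by algebra
        then show ?thesis using c by simp
      qed
      also have "\<dots> = P1 s \<otimes> s \<oplus> \<one> \<oplus> s \<otimes> (y0 \<otimes> Q s)"
        using Q(2)[OF s] P_P1[OF c(1)] by (simp add: P_def)
      also have "P1 s \<otimes> s = s \<otimes> P1 s" using centerD[OF s] c by simp
      also have "s \<otimes> P1 s \<oplus> \<one> \<oplus> s \<otimes> (y0 \<otimes> Q s) = \<one> \<oplus> s \<otimes> V s"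
        unfolding V_def using c C one_closed by algebra
      finally show ?thesis .
    qed
    have VT: "V s = k \<oplus> y0 \<oplus> s \<otimes> T s"
    proof -
      have "y0 \<otimes> Q s = y0 \<oplus> s \<otimes> (y0 \<otimes> V s)"
        unfolding QV using c C center_swap[OF s C(4) c(3)] by (simp add: r_distr)
      then show ?thesis unfolding V_def[of s] P2(2)[OF s] T_def using c C kC by algebra
    qed
    define z where "z = g \<otimes> Q s \<otimes> b"
    have zC: "z \<in> carrier D" unfolding z_def using c C g by simp
    have z1: "z = a \<oplus> s \<otimes> (g \<otimes> V s \<otimes> b)"
      unfolding z_def QV gb[symmetric] using c C g center_swap[OF s g(2) c(3)]
      by (simp add: r_distr l_distr m_assoc)
    have gVb: "g \<otimes> V s \<otimes> b = k \<otimes> a \<oplus> a \<otimes> inv b \<otimes> y0 \<otimes> b \<oplus> s \<otimes> (g \<otimes> T s \<otimes> b)"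
    proof -
      have sw: "g \<otimes> (s \<otimes> (T s \<otimes> b)) = s \<otimes> (g \<otimes> (T s \<otimes> b))" "g \<otimes> (k \<otimes> b) = k \<otimes> (g \<otimes> b)"
        using center_swap[OF s g(2)] center_swap[OF k g(2)] c C by auto
      have "g \<otimes> V s \<otimes> b = g \<otimes> (k \<otimes> b) \<oplus> g \<otimes> y0 \<otimes> b \<oplus> g \<otimes> (s \<otimes> (T s \<otimes> b))"
        unfolding VT using c C kC g by algebra
      then show ?thesis unfolding sw gb using c C g by (simp add: g_def m_assoc)
    qed
    have "A s = (\<one> \<ominus> s \<otimes> y0) \<otimes> z" unfolding A_def z_def using c C g by (simp add: m_assoc)
    also have "\<dots> = z \<ominus> s \<otimes> (y0 \<otimes> z)"
    proof -
      have "(\<one> \<ominus> s \<otimes> y0) \<otimes> z = \<one> \<otimes> z \<ominus> s \<otimes> (y0 \<otimes> z)" using c C zC one_closed by algebra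
      then show ?thesis using zC by simp
    qed
    also have "y0 \<otimes> z = y0 \<otimes> a \<oplus> s \<otimes> (y0 \<otimes> (g \<otimes> V s \<otimes> b))"
      unfolding z1 using c C g center_swap[OF s C(4), of "g \<otimes> V s \<otimes> b"] by (simp add: r_distr)
    also have "z \<ominus> s \<otimes> (y0 \<otimes> a \<oplus> s \<otimes> (y0 \<otimes> (g \<otimes> V s \<otimes> b)))
      = a \<oplus> s \<otimes> (g \<otimes> V s \<otimes> b \<ominus> y0 \<otimes> a \<ominus> s \<otimes> (y0 \<otimes> (g \<otimes> V s \<otimes> b)))"
      unfolding z1 using c C g by algebra
    also have "g \<otimes> V s \<otimes> b \<ominus> y0 \<otimes> a \<ominus> s \<otimes> (y0 \<otimes> (g \<otimes> V s \<otimes> b)) = ?y \<oplus> s \<otimes> R s"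
    proof -
      define W where "W = y0 \<otimes> (g \<otimes> V s \<otimes> b)"
      define U where "U = a \<otimes> inv b \<otimes> y0 \<otimes> b"
      define H where "H = g \<otimes> T s \<otimes> b"
      have "W \<in> carrier D" "U \<in> carrier D" "H \<in> carrier D" unfolding W_def U_def H_def using c C g by auto
      then have "k \<otimes> a \<oplus> U \<oplus> s \<otimes> H \<ominus> y0 \<otimes> a \<ominus> s \<otimes> W = k \<otimes> a \<oplus> U \<ominus> y0 \<otimes> a \<oplus> s \<otimes> (H \<ominus> W)"
        using c C kC by algebra
      then show ?thesis unfolding R_def gVb W_def[symmetric] U_def[symmetric] H_def[symmetric]
        unfolding W_def gVb U_def H_def .
    qed
    finally show ?thesis .
  qed
  \<comment> \<open>Where \<open>P\<close> does not vanish, \<open>1 - s y0\<close> divides a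
    nonzero scalar and is invertible, so \<open>A s\<close> is a central multiple of an element of
    \<open>N\<close>.\<close>
  let ?B = "{s \<in> center. P s = \<zero>}"
  have "P \<zero> = \<one>" using P_P1[of \<zero>] poly_fun_closed[OF pP1] by simp
  then have B: "finite ?B" by (intro finite_zeros[OF pP, of \<zero>]) auto
  have "eval_dev a (\<one> # q) ?y \<in> Span center (exp_base a r)"
  proof (rule deformation[OF inf C(1) yC pR A_eq q ind B])
    fix s assume "s \<in> center - ?B"
    then have s: "s \<in> center" "P s \<noteq> \<zero>" by auto
    define u where "u = \<one> \<ominus> s \<otimes> y0"
    have uC: "u \<in> carrier D" unfolding u_def using s C by simp
    have QC: "Q s \<in> carrier D" using poly_fun_closed[OF Q(1) s(1)] .
    have uQ: "u \<otimes> Q s = P s" unfolding u_def P_def using Q(2)[OF s(1)] .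
    have u0: "u \<noteq> \<zero>" using uQ s(2) QC by auto
    have PF: "P s \<in> center" unfolding P_def using p(1) s(1) by (intro eval_center) auto
    have "Q s = inv u \<otimes> P s" using inv_cancel(1)[OF uC u0 QC] uQ by simp
    then have "A s = u \<otimes> g \<otimes> (inv u \<otimes> P s) \<otimes> b" unfolding A_def u_def by simp
    also have "\<dots> = P s \<otimes> (u \<otimes> g \<otimes> inv u \<otimes> b)"
    proof -
      have "u \<otimes> g \<otimes> (inv u \<otimes> P s) \<otimes> b = u \<otimes> g \<otimes> inv u \<otimes> (P s \<otimes> b)"
        using uC u0 g C PF by (simp add: m_assoc)
      also have "\<dots> = P s \<otimes> (u \<otimes> g \<otimes> inv u \<otimes> b)"
        by (rule center_swap[OF PF]) (use uC u0 g C in auto)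
      finally show ?thesis .
    qed
    finally have AsN: "A s = P s \<otimes> (u \<otimes> g \<otimes> inv u \<otimes> b)" .
    have nN: "u \<otimes> g \<otimes> inv u \<otimes> b \<in> N" using N_mult[OF N_conj[OF g(1) uC u0] b] .
    show "dependent center (exp_base (A s) (Suc r))"
      using exp_base_scale(2)[OF PF s(2) N_carrier_nonzero(1)[OF nN]] dep[OF nN] unfolding AsN by blast
  qed
  then show ?thesis using k by blast
qed

lemma infinite_center_dimension:
  assumes inf: "infinite center" and alg: "\<And>n. n \<in> N \<Longrightarrow> dependent center (exp_base n (Suc d))"
  shows "\<exists>n \<le> d\<^sup>2. dimension n center (carrier D)"
proof -
  let ?P = "\<lambda>r. \<exists>a \<in> N. independent center (exp_base a r)"
  define r where "r = (GREATEST r. ?P r)"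
  have bound: "k \<le> d" if "?P k" for k
    using that alg independent_exp_base_mono[of _ k "Suc d"] by (meson not_less_eq_eq)
  have "?P 0" using N_one by (auto simp: exp_base_def)
  then have "?P r" unfolding r_def by (rule GreatestI_nat[where b = d]) (use bound in blast)
  then obtain a where a: "a \<in> N" and ind: "independent center (exp_base a r)" by blast
  have greatest: "k \<le> r" if "?P k" for k
    unfolding r_def by (rule Greatest_le_nat[where b = d]) (use bound that in blast)+
  have dep: "dependent center (exp_base n (Suc r))" if "n \<in> N" for n
    using greatest[of "Suc r"] that by auto
  have aC: "a \<in> carrier D" "a \<noteq> \<zero>" using N_carrier_nonzero a by auto
  define L where "L = Span center (exp_base a r)"
  note L = Span_exp_base[OF aC(1) ind dep[OF a], folded L_def]
  note Lr = subringE[OF subfieldE(1)[OF L(1)]]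
  obtain q where q: "set q \<subseteq> center" "length q = r" "eval (\<one> # q) a = \<zero>"
    using monic_relation[OF aC(1) ind dep[OF a]] by blast
  have q1: "set (\<one> # q) \<subseteq> center" using q(1) by simp
  define \<Delta> where "\<Delta> = eval_dev a (\<one> # q)"
  have \<Delta>C: "\<Delta> y \<in> carrier D" if "y \<in> carrier D" for y
    unfolding \<Delta>_def using eval_dev_closed[OF aC(1) that q1] .
  have \<Delta>_add: "\<Delta> (y \<oplus> z) = \<Delta> y \<oplus> \<Delta> z" if "y \<in> carrier D" "z \<in> carrier D" for y z
    unfolding \<Delta>_def using eval_dev_add[OF aC(1) that q1] .
  have \<Delta>_lmult: "\<Delta> (c \<otimes> y) = c \<otimes> \<Delta> y" if "y \<in> carrier D" "c \<in> carrier D" "c \<otimes> a = a \<otimes> c" for c y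
    unfolding \<Delta>_def using eval_dev_lmult[OF aC(1) that(1) q1 that(2,3)] .
  \<comment> \<open>Values of \<open>\<Delta>\<close> commute with \<open>a\<close>, so under
    \<open>\<Delta>\<close> a factor \<open>a\<close> may be moved from one side to the
    other.\<close>
  have \<Delta>_rmult: "\<Delta> (y \<otimes> a) = \<Delta> (a \<otimes> y)" if y: "y \<in> carrier D" for y
  proof -
    have "a \<otimes> \<Delta> y \<ominus> \<Delta> y \<otimes> a = \<zero>"
      unfolding \<Delta>_def eval_dev_commutator[OF aC(1) y q1] q(3) using y by (simp add: minus_eq)
    then have "a \<otimes> \<Delta> y = \<Delta> y \<otimes> a" using minus_eq_zero_iff \<Delta>C[OF y] aC by simp
    then show ?thesis
      using eval_dev_rmult[OF aC(1) y q1] \<Delta>_lmult[OF y aC(1) refl] by (simp add: \<Delta>_def)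
  qed
  have \<Delta>_L: "\<Delta> x \<in> L" if "x \<in> L" for x
    unfolding \<Delta>_def using eval_dev_mem[OF subfieldE(1)[OF L(1)] L(2,3) that q1] .
  have S_minus: "\<Delta> (y \<ominus> z) \<in> L" if "y \<in> carrier D" "z \<in> carrier D" "\<Delta> y \<in> L" "\<Delta> z \<in> L" for y z
  proof -
    have "\<ominus> z = \<ominus> \<one> \<otimes> z" using that by (simp add: l_minus)
    then have "\<Delta> (\<ominus> z) = \<ominus> \<Delta> z"
      using \<Delta>_lmult[OF that(2), of "\<ominus> \<one>"] aC \<Delta>C[OF that(2)] by (simp add: l_minus r_minus)
    then show ?thesis unfolding minus_eq using \<Delta>_add[OF that(1), of "\<ominus> z"] that Lr by simp
  qed
  have S_add: "\<Delta> (y \<oplus> z) \<in> L" if "y \<in> carrier D" "z \<in> carrier D" "\<Delta> y \<in> L" "\<Delta> z \<in> L" for y z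
    using \<Delta>_add[OF that(1,2)] that Lr by simp
  have S_smult: "\<Delta> (k \<otimes> y) \<in> L" if "y \<in> carrier D" "k \<in> center" "\<Delta> y \<in> L" for y k
    using \<Delta>_lmult[OF that(1), of k] centerD[OF that(2) aC(1)] that Lr(6) L(2) by auto
  \<comment> \<open>Taking \<open>y0 = b z\<close> in \<open>tangent\<close> cancels the inverse of
    \<open>b\<close>. The summand \<open>k a\<close> is harmless as \<open>\<Delta>\<close> maps
    \<open>L\<close> to itself, and under \<open>\<Delta>\<close> the term \<open>b z a\<close> may
    be replaced by \<open>a b z\<close>.\<close>
  have comm: "\<Delta> (a \<otimes> (z \<otimes> b \<ominus> b \<otimes> z)) \<in> L" if b: "b \<in> N" and z: "z \<in> N" for b z
  proof -
    have C: "b \<in> carrier D" "z \<in> carrier D" "b \<noteq> \<zero>" using b z N_carrier_nonzero by auto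
    obtain k where k: "k \<in> center"
      "\<Delta> (k \<otimes> a \<oplus> a \<otimes> inv b \<otimes> (b \<otimes> z) \<otimes> b \<ominus> b \<otimes> z \<otimes> a) \<in> L"
      using tangent[OF inf a ind dep q b N_mult[OF b z]] unfolding \<Delta>_def L_def by blast
    define x where "x = k \<otimes> a \<oplus> a \<otimes> inv b \<otimes> (b \<otimes> z) \<otimes> b \<ominus> b \<otimes> z \<otimes> a"
    have kC: "k \<in> carrier D" using k by simp
    have xC: "x \<in> carrier D" unfolding x_def using C aC kC by simp
    have ka: "k \<otimes> a \<in> L" using Lr(6) k(1) L(2,3) by blast
    define w where "w = x \<ominus> k \<otimes> a"
    have wC: "w \<in> carrier D" unfolding w_def using xC kC aC by simp
    have "\<Delta> w \<in> L" unfolding w_def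
      using S_minus[OF xC _ k(2)[folded x_def] \<Delta>_L[OF ka]] kC aC by simp
    moreover have "w = a \<otimes> (z \<otimes> b) \<ominus> b \<otimes> z \<otimes> a"
    proof -
      have "a \<otimes> inv b \<otimes> (b \<otimes> z) \<otimes> b = a \<otimes> (z \<otimes> b)" using C aC by (simp add: m_assoc)
      then show ?thesis unfolding w_def x_def using C aC kC by algebra
    qed
    ultimately have 1: "\<Delta> (a \<otimes> (z \<otimes> b) \<ominus> b \<otimes> z \<otimes> a) \<in> L" by simp
    have \<Delta>m: "\<Delta> (y \<ominus> z) = \<Delta> y \<ominus> \<Delta> z" if "y \<in> carrier D" "z \<in> carrier D" for y z
    proof -
      have "\<Delta> y = \<Delta> (y \<ominus> z) \<oplus> \<Delta> z"
      proof -
        have "y = (y \<ominus> z) \<oplus> z" using that by algebra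
        then show ?thesis using \<Delta>_add[of "y \<ominus> z" z] that by simp
      qed
      then show ?thesis using \<Delta>C[of "y \<ominus> z"] \<Delta>C[OF that(2)] that by (simp add: minus_eq a_assoc r_neg)
    qed
    have "\<Delta> (a \<otimes> (z \<otimes> b) \<ominus> b \<otimes> z \<otimes> a) = \<Delta> (a \<otimes> (z \<otimes> b)) \<ominus> \<Delta> (a \<otimes> (b \<otimes> z))"
      using \<Delta>m[of "a \<otimes> (z \<otimes> b)" "b \<otimes> z \<otimes> a"] \<Delta>_rmult[of "b \<otimes> z"] C aC by simp
    also have "\<dots> = \<Delta> (a \<otimes> (z \<otimes> b) \<ominus> a \<otimes> (b \<otimes> z))" using \<Delta>m C aC by simp
    also have "a \<otimes> (z \<otimes> b) \<ominus> a \<otimes> (b \<otimes> z) = a \<otimes> (z \<otimes> b \<ominus> b \<otimes> z)" using C aC by algebra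
    finally show ?thesis using 1 by simp
  qed
  \<comment> \<open>Subtracting \<open>a\<close> times the element for \<open>z\<close> from the
    element for \<open>a z\<close> isolates \<open>z\<close> as a right factor. The remaining factor
    does not involve \<open>z\<close>, so the statement extends by linearity to the span of
    \<open>N\<close>, which is all of \<open>D\<close>.\<close>
  have prod: "\<Delta> (a \<otimes> (a \<otimes> b \<ominus> b \<otimes> a) \<otimes> z) \<in> L" if b: "b \<in> N" and z: "z \<in> N" for b z
  proof -
    have C: "b \<in> carrier D" "z \<in> carrier D" using b z N_carrier_nonzero by auto
    let ?u = "a \<otimes> (a \<otimes> z \<otimes> b \<ominus> b \<otimes> (a \<otimes> z))" and ?v = "a \<otimes> (z \<otimes> b \<ominus> b \<otimes> z)"
    have "\<Delta> (a \<otimes> ?v) \<in> L"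
      using \<Delta>_lmult[of ?v a] comm[OF b z] C aC Lr(6) L(3) by simp
    then have "\<Delta> (?u \<ominus> a \<otimes> ?v) \<in> L"
      using comm[OF b N_mult[OF a z]] C aC by (intro S_minus) auto
    moreover have "?u \<ominus> a \<otimes> ?v = a \<otimes> (a \<otimes> b \<ominus> b \<otimes> a) \<otimes> z"
      using C aC by algebra
    ultimately show ?thesis by simp
  qed
  have lin: "lin = carrier D" using lin_eq_carrier[OF dep] .
  have "r \<noteq> 0"
    using one_not_zero greatest[of "Suc 0"] N_one by (force simp: exp_base_def intro: li_Cons)
  \<comment> \<open>If \<open>a\<close> commuted with \<open>N\<close>, it would commute with its
    span \<open>D\<close> and be central, so that \<open>r\<close> is less than 2. By maximality of
    \<open>r\<close> every element of \<open>N\<close> would then be a scalar.\<close>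
  obtain b where b: "b \<in> N" "a \<otimes> b \<noteq> b \<otimes> a"
  proof -
    have "\<exists>b \<in> N. a \<otimes> b \<noteq> b \<otimes> a"
    proof (rule ccontr)
      assume contra: "\<not> ?thesis"
      have "a \<otimes> v = v \<otimes> a" if "v \<in> lin" for v
        using that
      proof (induction rule: lin.induct)
        case (add k n v)
        have C: "n \<in> carrier D" "v \<in> carrier D" "a \<otimes> n = n \<otimes> a" using add N_carrier_nonzero lin_D contra by auto
        then show ?case using add aC center_swap[OF add(1) aC(1) C(1)]
          by (simp add: l_distr r_distr m_assoc)
      qed (use aC in simp)
      then have aF: "a \<in> center" unfolding ring_center_def using lin aC by auto
      have "N \<subseteq> center"
      proof
        fix n assume n: "n \<in> N"
        have nC: "n \<in> carrier D" using N_carrier_nonzero n by blast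
        have "\<not> r \<ge> 2"
        proof
          assume "r \<ge> 2"
          then have "independent center (exp_base a 2)" using independent_exp_base_mono ind by blast
          then have "a \<notin> Span center [\<one>]"
            using independent_backwards(1)[of center a "[\<one>]"] aC by (simp add: exp_base_def numeral_2_eq_2)
          moreover have "a = a \<otimes> \<one> \<oplus> \<zero>" using aC by simp
          ultimately show False using aF by (auto simp: line_extension_mem_iff)
        qed
        then have "dependent center (exp_base n 2)"
          using greatest[of 2] n by auto
        then have "n \<in> Span center [\<one>]"
          using li_Cons[of n center "[\<one>]"] li_Cons[of \<one> center "[]"] nC
          by (auto simp: exp_base_def numeral_2_eq_2)
        then show "n \<in> center" by (auto simp: line_extension_mem_iff)
      qed
      then show False using noncentral by simp
    qed
    then show ?thesis using that by blast
  qed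
  define g where "g = a \<otimes> (a \<otimes> b \<ominus> b \<otimes> a)"
  have bC: "b \<in> carrier D" using N_carrier_nonzero b by blast
  have g: "g \<in> carrier D" "g \<noteq> \<zero>"
    unfolding g_def using b aC bC minus_eq_zero_iff[of "a \<otimes> b" "b \<otimes> a"] by (auto simp: integral_iff)
  have "\<Delta> (g \<otimes> v) \<in> L" if "v \<in> lin" for v
    using that
  proof (induction rule: lin.induct)
    case zero
    have "\<Delta> \<zero> \<in> L" using \<Delta>_L Lr(2) by blast
    then show ?case using g by simp
  next
    case (add k n v)
    have C: "n \<in> carrier D" "v \<in> carrier D" "k \<in> carrier D" using add N_carrier_nonzero lin_D by auto
    have "g \<otimes> (k \<otimes> n \<oplus> v) = k \<otimes> (g \<otimes> n) \<oplus> g \<otimes> v"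
      using C g center_swap[OF add(1) g(1) C(1)] by (simp add: r_distr)
    moreover have "\<Delta> (k \<otimes> (g \<otimes> n)) \<in> L"
      using S_smult[OF _ add(1), of "g \<otimes> n"] prod[OF b(1) add(2)] C g by (simp add: g_def)
    ultimately show ?case using S_add[of "k \<otimes> (g \<otimes> n)" "g \<otimes> v"] C g add by simp
  qed
  then have all: "\<Delta> y \<in> L" if "y \<in> carrier D" for y
    using inv_cancel(2)[OF g that] lin that g by (metis inv_facts(1) m_closed)
  \<comment> \<open>Some value of \<open>\<Delta>\<close> is nonzero and lies in the field
    \<open>L\<close>, so it can be scaled to \<open>\<one>\<close>. Linearity over the centralizer
    then exhibits \<open>c\<close> itself as a value of \<open>\<Delta>\<close>.\<close>
  have central: "c \<in> L" if c: "c \<in> carrier D" "c \<otimes> a = a \<otimes> c" for c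
  proof -
    obtain y where y: "y \<in> carrier D" "\<Delta> y \<noteq> \<zero>"
      using eval_dev_nonzero[OF aC(1) q(1,2) _ ind] \<open>r \<noteq> 0\<close> unfolding \<Delta>_def by auto
    define l where "l = inv (\<Delta> y)"
    have l: "l \<in> L" "l \<in> carrier D" unfolding l_def
      using subfield_m_inv(1)[OF L(1)] all[OF y(1)] y \<Delta>C[OF y(1)] by auto
    have la: "l \<otimes> a = a \<otimes> l"
      using Span_exp_base_commute[OF aC(1) aC(1) refl] l(1) unfolding L_def by blast
    have "\<Delta> (l \<otimes> y) = \<one>"
      using \<Delta>_lmult[OF y(1) l(2) la] y \<Delta>C[OF y(1)] by (simp add: l_def)
    then have "\<Delta> (c \<otimes> (l \<otimes> y)) = c" using \<Delta>_lmult[OF _ c] l y c by simp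
    then show ?thesis using all[of "c \<otimes> (l \<otimes> y)"] c l y by simp
  qed
  obtain n where "n \<le> r\<^sup>2" "dimension n center (carrier D)"
    using dimension_of_center[OF aC(1) ind dep[OF a]] central unfolding L_def by blast
  moreover have "r\<^sup>2 \<le> d\<^sup>2" using bound[of r] a ind by (intro power_mono) auto
  ultimately show ?thesis using le_trans by blast
qed

end

section \<open>Finite subfields and torsion\<close>

context skew_field
begin

lemma pow_card_eq_one:
  assumes E: "subfield E D" "finite E" and e: "e \<in> E" "e \<noteq> \<zero>"
  shows "e [^] card (E - {\<zero>}) = \<one>"
proof -
  interpret E: field "D\<lparr>carrier := E\<rparr>" using subfield_iff(2)[OF E(1)] .
  have "e [^]\<^bsub>D\<lparr>carrier := E\<rparr>\<^esub> card (E - {\<zero>}) = \<one>"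
    using group.pow_order_eq_1[OF E.field_mult_group, of e] e
    by (simp add: Multiplicative_Group.nat_pow_mult_of order_def)
  then show ?thesis using nat_pow_consistent[of e _ E] by simp
qed

lemma pow_eq_one_if_finite:
  assumes a: "a \<in> carrier D" "a \<noteq> \<zero>" and S: "finite S" "\<And>i::nat. a [^] i \<in> S"
  shows "\<exists>k > (0::nat). a [^] k = \<one>"
proof -
  have "\<not> inj (\<lambda>i::nat. a [^] i)"
  proof
    assume "inj (\<lambda>i::nat. a [^] i)"
    then have "infinite (range (\<lambda>i::nat. a [^] i))" using finite_imageD infinite_UNIV_nat by blast
    then show False using S by (meson finite_subset image_subsetI)
  qed
  then obtain i j :: nat where ij: "a [^] i = a [^] j" "i < j"
    by (metis injI linorder_neqE_nat)
  have "a [^] i \<otimes> a [^] (j - i) = a [^] i \<otimes> \<one>"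
    using ij nat_pow_mult[OF a(1), of i "j - i"] a by simp
  then have "a [^] (j - i) = \<one>"
    by (rule left_cancel) (use a pow_zero_iff[of a i] in auto)
  then show ?thesis using ij(2) by (intro exI[of _ "j - i"]) simp
qed

lemma finite_Span_center:
  assumes "finite center" "set Us \<subseteq> carrier D"
  shows "finite (Span center Us)"
proof -
  have "Span center Us \<subseteq> (\<lambda>Ks. combine Ks Us) ` {Ks. set Ks \<subseteq> center \<and> length Ks = length Us}"
    using Span_mem_iff_length_version[OF ring_center_subfield assms(2)] by blast
  then show ?thesis using finite_lists_length_eq[OF assms(1)] by (meson finite_imageI finite_subset)
qed

text \<open>Division by X - b with one quotient serving two readings: as functions on the
  commutative \<open>E\<close>, and in the module action, where X - b sends \<open>w\<close> to
  \<open>w u - b w\<close>.\<close>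

lemma eval_factor_commuting:
  assumes E: "subfield E D" and u: "u \<in> carrier D" and p: "set p \<subseteq> E" "p \<noteq> []" and b: "b \<in> E"
  shows "\<exists>q. length q = length p - 1 \<and> set q \<subseteq> E \<and> (q \<noteq> [] \<longrightarrow> hd q = hd p) \<and>
    (\<forall>g \<in> E. eval p g = eval q g \<otimes> (g \<ominus> b) \<oplus> eval p b) \<and>
    (\<forall>w \<in> carrier D. twisted_eval u p w = twisted_eval u q (w \<otimes> u \<ominus> b \<otimes> w) \<oplus> eval p b \<otimes> w)"
proof -
  note Er = subringE[OF subfieldE(1)[OF E]]
  have EC: "e \<in> carrier D" if "e \<in> E" for e using that Er(1) by blast
  have twisted_append: "twisted_eval u (p @ [c]) w = twisted_eval u p (w \<otimes> u) \<oplus> c \<otimes> w"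
    if "set p \<subseteq> carrier D" "c \<in> carrier D" "w \<in> carrier D" for p c w
    using that
  proof (induction p)
    case (Cons k p)
    have "u [^] Suc (length p) = u \<otimes> u [^] length p" using nat_pow_Suc2[OF u] .
    then have "w \<otimes> u [^] Suc (length p) = w \<otimes> u \<otimes> u [^] length p" using Cons.prems u by (simp add: m_assoc del: nat_pow_Suc)
    then show ?case using Cons u by (simp add: twisted_eval_Cons a_assoc del: nat_pow_Suc)
  qed (use u in \<open>simp add: twisted_eval_Cons\<close>)
  show ?thesis
    using p
  proof (induction p rule: rev_induct)
    case (snoc c p)
    have c: "c \<in> E" "set p \<subseteq> E" "c \<in> carrier D" "set p \<subseteq> carrier D" using snoc.prems EC by auto
    have bC: "b \<in> carrier D" using EC b .
    show ?case
    proof (cases "p = []")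
      case True
      then show ?thesis using c EC u bC
        by (intro exI[of _ "[]"]) (auto simp: twisted_eval_Cons minus_eq)
    next
      case False
      then obtain q where q: "length q = length p - 1" "set q \<subseteq> E" "q \<noteq> [] \<longrightarrow> hd q = hd p"
        "\<And>g. g \<in> E \<Longrightarrow> eval p g = eval q g \<otimes> (g \<ominus> b) \<oplus> eval p b"
        "\<And>w. w \<in> carrier D \<Longrightarrow> twisted_eval u p w = twisted_eval u q (w \<otimes> u \<ominus> b \<otimes> w) \<oplus> eval p b \<otimes> w"
        using snoc.IH[OF c(2) False] by blast
      have qC: "set q \<subseteq> carrier D" using q(2) EC by auto
      define e where "e = eval p b"
      have eE: "e \<in> E"
        unfolding e_def using c(2)
      proof (induction p)
        case (Cons k p)
        have "b [^] n \<in> E" for n :: nat by (induction n) (use Er b in auto)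
        then show ?case using Cons Er by auto
      qed (use Er in simp)
      have eC: "e \<in> carrier D" using EC eE .
      have eb: "e \<otimes> b = b \<otimes> e" using subfieldE(4)[OF E eE b] .
      have 1: "eval (p @ [c]) g = eval (q @ [e]) g \<otimes> (g \<ominus> b) \<oplus> eval (p @ [c]) b" if g: "g \<in> E" for g
      proof -
        have gC: "g \<in> carrier D" using EC g .
        have comm: "g \<otimes> b = b \<otimes> g" using subfieldE(4)[OF E g b] .
        have qg: "eval q g \<in> carrier D" using eval_in_carrier[OF qC gC] .
        have "(eval q g \<otimes> (g \<ominus> b) \<oplus> e) \<otimes> g \<oplus> c = eval q g \<otimes> (g \<otimes> g \<ominus> b \<otimes> g) \<oplus> e \<otimes> g \<oplus> c"
          using gC qg bC eC c by algebra
        also have "\<dots> = (eval q g \<otimes> g \<oplus> e) \<otimes> (g \<ominus> b) \<oplus> (e \<otimes> b \<oplus> c)"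
          unfolding comm[symmetric] using gC qg bC eC c by algebra
        finally show ?thesis
          using eval_append_aux[OF c(4,3) gC] eval_append_aux[OF c(4,3) bC] eval_append_aux[OF qC eC gC]
            q(4)[OF g] by (simp add: e_def)
      qed
      have 2: "twisted_eval u (p @ [c]) w = twisted_eval u (q @ [e]) (w \<otimes> u \<ominus> b \<otimes> w) \<oplus> eval (p @ [c]) b \<otimes> w"
        if w: "w \<in> carrier D" for w
      proof -
        define w' where "w' = w \<otimes> u \<ominus> b \<otimes> w"
        have wC: "w' \<in> carrier D" "w \<otimes> u \<in> carrier D" unfolding w'_def using w u bC by auto
        have eq: "w \<otimes> u \<otimes> u \<ominus> b \<otimes> (w \<otimes> u) = w' \<otimes> u" unfolding w'_def using w u bC by algebra
        define t where "t = twisted_eval u q (w' \<otimes> u)"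
        have tC: "t \<in> carrier D" unfolding t_def using qC u wC by simp
        have "twisted_eval u (p @ [c]) w = t \<oplus> e \<otimes> (w \<otimes> u) \<oplus> c \<otimes> w"
          unfolding twisted_append[OF c(4,3) w] q(5)[OF wC(2)] eq t_def e_def ..
        also have "\<dots> = t \<oplus> e \<otimes> w' \<oplus> (e \<otimes> b \<oplus> c) \<otimes> w"
          unfolding w'_def using tC eC c w u bC by algebra
        finally show ?thesis
          unfolding eval_append_aux[OF c(4,3) bC] twisted_append[OF qC eC wC(1)[unfolded w'_def]]
          by (simp add: w'_def t_def e_def)
      qed
      have "hd (q @ [e]) = hd (p @ [c])"
      proof (cases q)
        case Nil
        then have "length p = 1" using q(1) False by (cases p) auto
        then obtain k where k: "p = [k]" by (cases p) auto
        then show ?thesis using Nil c bC by (simp add: e_def)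
      qed (use q(3) False in simp)
      then show ?thesis using 1 2 q(1,2) eE False
        by (intro exI[of _ "q @ [e]"]) (auto simp: Suc_le_eq)
    qed
  qed simp
qed

text \<open>With as many roots as its degree, \<open>p\<close> is a constant times the product of
  the X - b. A nonzero vector killed by the product leads to a nonzero vector killed by a single
  factor, that is, an eigenvector of right multiplication by \<open>u\<close>.\<close>

lemma eigenvector_exists:
  assumes E: "subfield E D" and u: "u \<in> carrier D"
    and "set p \<subseteq> E" "p \<noteq> []" "hd p \<noteq> \<zero>" and "w \<in> carrier D" "w \<noteq> \<zero>" and "twisted_eval u p w = \<zero>"
    and "finite B" "B \<subseteq> E" "card B = length p - 1" "\<And>b. b \<in> B \<Longrightarrow> eval p b = \<zero>"
  shows "\<exists>z \<in> carrier D. \<exists>b \<in> B. z \<noteq> \<zero> \<and> z \<otimes> u = b \<otimes> z"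
  using assms(3-)
proof (induction "length p" arbitrary: p w B rule: less_induct)
  case less
  note Er = subringE[OF subfieldE(1)[OF E]]
  show ?case
  proof (cases "length p = 1")
    case True
    then obtain c where c: "p = [c]" by (cases p) auto
    then have "c \<in> carrier D" "c \<noteq> \<zero>" using less.prems Er by auto
    then show ?thesis using less.prems(4-6) c by (simp add: twisted_eval_Cons integral_iff)
  next
    case False
    then have "card B > 0" using less.prems by (cases p) auto
    then obtain b where b: "b \<in> B" by (metis card.empty ex_in_conv less_irrefl)
    then have bE: "b \<in> E" "b \<in> carrier D" using less.prems Er by auto
    obtain q where q: "length q = length p - 1" "set q \<subseteq> E" "q \<noteq> [] \<longrightarrow> hd q = hd p"
        "\<And>g. g \<in> E \<Longrightarrow> eval p g = eval q g \<otimes> (g \<ominus> b) \<oplus> eval p b"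
        "\<And>w. w \<in> carrier D \<Longrightarrow> twisted_eval u p w = twisted_eval u q (w \<otimes> u \<ominus> b \<otimes> w) \<oplus> eval p b \<otimes> w"
      using eval_factor_commuting[OF E u less.prems(1,2) bE(1)] by blast
    have qC: "set q \<subseteq> carrier D" using q(2) Er by auto
    have qn: "q \<noteq> []" using q(1) False less.prems(2) by (cases p) auto
    define w' where "w' = w \<otimes> u \<ominus> b \<otimes> w"
    have w': "w' \<in> carrier D" unfolding w'_def using less.prems u bE by simp
    have kill: "twisted_eval u q w' = \<zero>"
      using q(5)[OF less.prems(4)] less.prems(4,6) less.prems(10)[OF b] qC u w' by (simp add: w'_def)
    show ?thesis
    proof (cases "w' = \<zero>")
      case True
      then have "w \<otimes> u = b \<otimes> w"
        using minus_eq_zero_iff[of "w \<otimes> u" "b \<otimes> w"] less.prems u bE by (simp add: w'_def)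
      then show ?thesis using less.prems b by blast
    next
      case False
      have roots: "eval q g = \<zero>" if g: "g \<in> B - {b}" for g
      proof -
        have gE: "g \<in> E" "g \<in> carrier D" "eval p g = \<zero>" "g \<noteq> b" using g less.prems Er by auto
        have "eval q g \<otimes> (g \<ominus> b) = \<zero>"
          using q(4)[OF gE(1)] gE less.prems(10)[OF b] eval_in_carrier[OF qC gE(2)] bE by simp
        then show ?thesis
          using integral_iff[of "eval q g" "g \<ominus> b"] minus_eq_zero_iff gE bE eval_in_carrier[OF qC gE(2)] by simp
      qed
      have "\<exists>z \<in> carrier D. \<exists>b \<in> B - {b}. z \<noteq> \<zero> \<and> z \<otimes> u = b \<otimes> z"
      proof (rule less.hyps[OF _ q(2) qn _ w' False kill])
        show "length q < length p" using q(1) less.prems(2) by (cases p) auto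
        show "hd q \<noteq> \<zero>" using q(3) qn less.prems(3) by simp
        show "finite (B - {b})" "B - {b} \<subseteq> E" using less.prems by auto
        show "card (B - {b}) = length q - 1" using less.prems b q(1) by simp
      qed (rule roots)
      then show ?thesis by blast
    qed
  qed
qed

text \<open>With \<open>k\<close> the number of nonzero elements of \<open>E\<close>, the polynomial
  X^k - 1 has all of them as roots and annihilates \<open>D\<close> because \<open>u^k = 1\<close>.
  Splitting off the root \<open>u\<close> and applying that factor to \<open>y\<close> gives the
  nonzero commutator \<open>w\<close>, which is killed by the quotient; so an eigenvalue other than
  \<open>u\<close> occurs.\<close>

lemma conjugating_element:
  assumes E: "subfield E D" "finite E" and u: "u \<in> E" and y: "y \<in> carrier D" "y \<otimes> u \<noteq> u \<otimes> y"
  shows "\<exists>x \<in> carrier D. \<exists>b \<in> E. x \<noteq> \<zero> \<and> b \<noteq> u \<and> x \<otimes> u = b \<otimes> x"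
proof -
  note Er = subringE[OF subfieldE(1)[OF E(1)]]
  have uC: "u \<in> carrier D" using u Er by auto
  have u0: "u \<noteq> \<zero>" using y by auto
  define k where "k = card (E - {\<zero>})"
  have "u \<in> E - {\<zero>}" using u u0 by simp
  then have k0: "k > 0" unfolding k_def using E(2) card_gt_0_iff by blast
  define p where "p = \<one> # replicate (k - 1) \<zero> @ [\<ominus> \<one>]"
  have p: "set p \<subseteq> E" "p \<noteq> []" "hd p = \<one>" "length p = Suc k" unfolding p_def using Er k0 by auto
  have roots: "eval p e = \<zero>" if e: "e \<in> E" "e \<noteq> \<zero>" for e
  proof -
    have eC: "e \<in> carrier D" using e Er by auto
    have "eval (replicate (k - 1) \<zero> @ [\<ominus> \<one>]) e = eval [\<ominus> \<one>] e"
      by (rule eval_replicate) (use eC in auto)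
    moreover have "e [^] k = \<one>" unfolding k_def using pow_card_eq_one[OF E e] .
    ultimately show ?thesis using eC k0 by (simp add: p_def r_neg)
  qed
  have "twisted_eval u (replicate n \<zero> @ [\<ominus> \<one>]) y = \<ominus> y" for n
    by (induction n) (use uC y in \<open>auto simp: twisted_eval_Cons l_minus\<close>)
  then have kill: "twisted_eval u p y = \<zero>"
    using pow_card_eq_one[OF E u u0] uC y k0 by (simp add: p_def twisted_eval_Cons k_def r_neg)
  obtain q where q: "length q = length p - 1" "set q \<subseteq> E" "q \<noteq> [] \<longrightarrow> hd q = hd p"
      "\<And>g. g \<in> E \<Longrightarrow> eval p g = eval q g \<otimes> (g \<ominus> u) \<oplus> eval p u"
      "\<And>w. w \<in> carrier D \<Longrightarrow> twisted_eval u p w = twisted_eval u q (w \<otimes> u \<ominus> u \<otimes> w) \<oplus> eval p u \<otimes> w"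
    using eval_factor_commuting[OF E(1) uC p(1,2) u] by blast
  have qC: "set q \<subseteq> carrier D" using q(2) Er by auto
  define w where "w = y \<otimes> u \<ominus> u \<otimes> y"
  have w: "w \<in> carrier D" "w \<noteq> \<zero>" unfolding w_def using y uC minus_eq_zero_iff[of "y \<otimes> u" "u \<otimes> y"] by auto
  have "twisted_eval u q w = \<zero>" using q(5)[OF y(1)] kill roots[OF u u0] y qC uC w by (simp add: w_def)
  moreover have "eval q g = \<zero>" if g: "g \<in> E - {\<zero>, u}" for g
  proof -
    have gE: "g \<in> E" "g \<in> carrier D" "eval p g = \<zero>" "g \<noteq> u" using g Er roots by auto
    have "eval q g \<otimes> (g \<ominus> u) = \<zero>"
      using q(4)[OF gE(1)] gE roots[OF u u0] eval_in_carrier[OF qC gE(2)] uC by simp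
    then show ?thesis
      using integral_iff[of "eval q g" "g \<ominus> u"] minus_eq_zero_iff gE uC eval_in_carrier[OF qC gE(2)] by simp
  qed
  moreover have "card (E - {\<zero>, u}) = length q - 1"
  proof -
    have "E - {\<zero>, u} = (E - {\<zero>}) - {u}" by auto
    then show ?thesis using q(1) p(4) \<open>u \<in> E - {\<zero>}\<close> E(2) by (simp add: k_def)
  qed
  moreover have "q \<noteq> []" using q(1) p(4) k0 by auto
  moreover from this have "hd q \<noteq> \<zero>" using q(3) p(3) by simp
  ultimately have "\<exists>z \<in> carrier D. \<exists>b \<in> E - {\<zero>, u}. z \<noteq> \<zero> \<and> z \<otimes> u = b \<otimes> z"
    using E(2) by (intro eigenvector_exists[OF E(1) uC q(2) _ _ w]) auto
  then show ?thesis by blast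
qed

section \<open>Left spans of powers of a normalizing element\<close>

primrec left_span :: "'a set \<Rightarrow> 'a \<Rightarrow> nat \<Rightarrow> 'a set" where
  "left_span E z 0 = {\<zero>}"
| "left_span E z (Suc j) = {v \<oplus> e \<otimes> z [^] j | v e. v \<in> left_span E z j \<and> e \<in> E}"

declare left_span.simps(2) [simp del]

lemma left_span_SucI: "v \<in> left_span E z j \<Longrightarrow> e \<in> E \<Longrightarrow> v \<oplus> e \<otimes> z [^] j \<in> left_span E z (Suc j)"
  by (auto simp: left_span.simps(2))

context
  fixes E z
  assumes E: "subring E D" and z: "z \<in> carrier D"
    and swap: "\<And>e. e \<in> E \<Longrightarrow> \<exists>e' \<in> E. z \<otimes> e = e' \<otimes> z"
begin

lemma left_span_carrier: "v \<in> left_span E z j \<Longrightarrow> v \<in> carrier D"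
  using subringE(1)[OF E] z by (induction j arbitrary: v) (auto simp: left_span.simps(2))

lemma left_span_finite: "finite E \<Longrightarrow> finite (left_span E z j)"
proof (induction j)
  case (Suc j)
  have "left_span E z (Suc j) = (\<lambda>(v, e). v \<oplus> e \<otimes> z [^] j) ` (left_span E z j \<times> E)"
    by (auto simp: left_span.simps(2))
  then show ?case using Suc by simp
qed simp

lemma left_span_mono: "i \<le> j \<Longrightarrow> left_span E z i \<subseteq> left_span E z j"
proof (induction j)
  case (Suc j)
  have "left_span E z j \<subseteq> left_span E z (Suc j)"
  proof
    fix v assume v: "v \<in> left_span E z j"
    then have "v = v \<oplus> \<zero> \<otimes> z [^] j" using left_span_carrier z by simp
    then show "v \<in> left_span E z (Suc j)" using left_span_SucI[OF v subringE(2)[OF E]] by metis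
  qed
  then show ?case using Suc by (cases "i = Suc j") auto
qed simp

lemma left_span_zero: "\<zero> \<in> left_span E z j"
  using left_span_mono[of 0 j] by simp

lemma left_span_pow: "e \<in> E \<Longrightarrow> e \<otimes> z [^] j \<in> left_span E z (Suc j)"
proof -
  assume e: "e \<in> E"
  have "e \<otimes> z [^] j = \<zero> \<oplus> e \<otimes> z [^] j" using e subringE(1)[OF E] z by auto
  then show ?thesis using left_span_SucI[OF left_span_zero e] by metis
qed

lemma left_span_add: "v \<in> left_span E z j \<Longrightarrow> w \<in> left_span E z j \<Longrightarrow> v \<oplus> w \<in> left_span E z j"
proof (induction j arbitrary: v w)
  case (Suc j)
  obtain v' e w' e' where *: "v = v' \<oplus> e \<otimes> z [^] j" "v' \<in> left_span E z j" "e \<in> E"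
    "w = w' \<oplus> e' \<otimes> z [^] j" "w' \<in> left_span E z j" "e' \<in> E" using Suc.prems by (auto simp: left_span.simps(2))
  have C: "v' \<in> carrier D" "w' \<in> carrier D" "e \<in> carrier D" "e' \<in> carrier D" "z [^] j \<in> carrier D"
    using * left_span_carrier subringE(1)[OF E] z by auto
  have eq: "v \<oplus> w = (v' \<oplus> w') \<oplus> (e \<oplus> e') \<otimes> z [^] j" unfolding *(1,4) using C by algebra
  show ?case unfolding eq using * by (intro left_span_SucI Suc.IH subringE(7)[OF E])
qed simp

lemma left_span_smult: "v \<in> left_span E z j \<Longrightarrow> e \<in> E \<Longrightarrow> e \<otimes> v \<in> left_span E z j"
proof (induction j arbitrary: v)
  case (Suc j)
  obtain v' e' where *: "v = v' \<oplus> e' \<otimes> z [^] j" "v' \<in> left_span E z j" "e' \<in> E" using Suc.prems by (auto simp: left_span.simps(2))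
  have C: "v' \<in> carrier D" "e \<in> carrier D" "e' \<in> carrier D" "z [^] j \<in> carrier D"
    using * Suc.prems left_span_carrier subringE(1)[OF E] z by auto
  have eq: "e \<otimes> v = e \<otimes> v' \<oplus> (e \<otimes> e') \<otimes> z [^] j" unfolding *(1) using C by algebra
  show ?case unfolding eq using * Suc.prems(2) by (intro left_span_SucI Suc.IH subringE(6)[OF E])
qed (use subringE(1)[OF E] in auto)

lemma left_span_shift: "v \<in> left_span E z j \<Longrightarrow> z \<otimes> v \<in> left_span E z (Suc j)"
proof (induction j arbitrary: v)
  case (Suc j)
  obtain v' e where *: "v = v' \<oplus> e \<otimes> z [^] j" "v' \<in> left_span E z j" "e \<in> E" using Suc.prems by (auto simp: left_span.simps(2))
  obtain e' where e': "e' \<in> E" "z \<otimes> e = e' \<otimes> z" using swap[OF *(3)] by blast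
  have C: "v' \<in> carrier D" "e \<in> carrier D" "e' \<in> carrier D" "z [^] j \<in> carrier D"
    using * e' left_span_carrier subringE(1)[OF E] z by auto
  have "z \<otimes> v = z \<otimes> v' \<oplus> z \<otimes> e \<otimes> z [^] j" unfolding *(1) using C z by algebra
  also have "\<dots> = z \<otimes> v' \<oplus> e' \<otimes> z [^] Suc j"
    unfolding e'(2) nat_pow_Suc2[OF z] using C z by (simp add: m_assoc)
  finally show ?case using left_span_SucI[OF Suc.IH[OF *(2)] e'(1)] by simp
next
  case 0
  then show ?case using z left_span_zero[of "Suc 0"] by simp
qed

text \<open>Multiplication by \<open>z\<close> raises exponents by one, so only a term with
  \<open>z^j\<close> could leave the span, and the assumption on \<open>z^j\<close> brings it
  back.\<close>

lemma left_span_closed: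
  assumes pow: "z [^] j \<in> left_span E z j" and v: "v \<in> left_span E z j"
  shows "z \<otimes> v \<in> left_span E z j"
proof -
  have "z \<otimes> v \<in> left_span E z j" if "v \<in> left_span E z i" "i \<le> j" for i v
    using that
  proof (induction i arbitrary: v)
    case 0
    then show ?case using z left_span_mono[of 0 j] by simp
  next
    case (Suc i)
    obtain v' e where *: "v = v' \<oplus> e \<otimes> z [^] i" "v' \<in> left_span E z i" "e \<in> E" using Suc.prems by (auto simp: left_span.simps(2))
    obtain e' where e': "e' \<in> E" "z \<otimes> e = e' \<otimes> z" using swap[OF *(3)] by blast
    have C: "v' \<in> carrier D" "e \<in> carrier D" "e' \<in> carrier D" "z [^] i \<in> carrier D"
      using * e' left_span_carrier subringE(1)[OF E] z by auto
    have "z \<otimes> v = z \<otimes> v' \<oplus> z \<otimes> e \<otimes> z [^] i" unfolding *(1) using C z by algebra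
    also have "\<dots> = z \<otimes> v' \<oplus> e' \<otimes> z [^] Suc i"
      unfolding e'(2) nat_pow_Suc2[OF z] using C z by (simp add: m_assoc)
    finally have eq: "z \<otimes> v = z \<otimes> v' \<oplus> e' \<otimes> z [^] Suc i" .
    have "e' \<otimes> z [^] Suc i \<in> left_span E z j"
    proof (cases "Suc i = j")
      case True
      then show ?thesis using left_span_smult[OF pow e'(1)] by simp
    next
      case False
      then show ?thesis using left_span_pow[OF e'(1), of "Suc i"] left_span_mono[of "Suc (Suc i)" j] Suc.prems by auto
    qed
    then show ?case unfolding eq using left_span_add Suc.IH[OF *(2)] Suc.prems by auto
  qed
  then show ?thesis using v by blast
qed

lemma left_span_pow_closed:
  assumes pow: "z [^] j \<in> left_span E z j" and "j > 0"
  shows "z [^] (i::nat) \<in> left_span E z j"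
proof (induction i)
  case 0
  have "\<one> \<otimes> z [^] (0::nat) \<in> left_span E z (Suc 0)" using left_span_pow subringE(3)[OF E] by blast
  then show ?case using left_span_mono[of "Suc 0" j] assms(2) by auto
next
  case (Suc i)
  then show ?case unfolding nat_pow_Suc2[OF z] using left_span_closed[OF pow] by blast
qed

end

text \<open>
  The powers of \<open>w\<close> have the form \<open>\<epsilon>\<^sub>j z^j + v\<^sub>j\<close> with \<open>v\<^sub>j\<close> of lower degree in \<open>z\<close>, so a
  coincidence between two of them bounds the powers of \<open>z\<close>.
\<close>
lemma torsion_of_linear_combination:
  assumes E: "subfield E D" "finite E" and z: "z \<in> carrier D" "z \<noteq> \<zero>"
    and swap: "\<And>e. e \<in> E \<Longrightarrow> \<exists>e' \<in> E. z \<otimes> e = e' \<otimes> z"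
    and e: "e1 \<in> E" "e1 \<noteq> \<zero>" "e0 \<in> E"
    and S: "finite S" "\<And>i::nat. (e1 \<otimes> z \<oplus> e0) [^] i \<in> S"
  shows "\<exists>k > (0::nat). z [^] k = \<one>"
proof -
  note Er = subringE[OF subfieldE(1)[OF E(1)]]
  note span = left_span_carrier[OF subfieldE(1)[OF E(1)] z(1) swap]
    left_span_finite[OF subfieldE(1)[OF E(1)] z(1) swap E(2)]
    left_span_mono[OF subfieldE(1)[OF E(1)] z(1) swap]
    left_span_pow[OF subfieldE(1)[OF E(1)] z(1) swap]
    left_span_add[OF subfieldE(1)[OF E(1)] z(1) swap]
    left_span_smult[OF subfieldE(1)[OF E(1)] z(1) swap]
    left_span_shift[OF subfieldE(1)[OF E(1)] z(1) swap]
    left_span_pow_closed[OF subfieldE(1)[OF E(1)] z(1) swap]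
  define w where "w = e1 \<otimes> z \<oplus> e0"
  have eC: "e1 \<in> carrier D" "e0 \<in> carrier D" using e Er by auto
  have wC: "w \<in> carrier D" unfolding w_def using eC z by simp
  have form: "\<exists>v \<in> left_span E z j. \<exists>f \<in> E. f \<noteq> \<zero> \<and> w [^] j = f \<otimes> z [^] j \<oplus> v" for j
  proof (induction j)
    case 0
    show ?case using Er by (intro bexI[of _ \<zero>] bexI[of _ \<one>]) auto
  next
    case (Suc j)
    then obtain v f where vf: "v \<in> left_span E z j" "f \<in> E" "f \<noteq> \<zero>" "w [^] j = f \<otimes> z [^] j \<oplus> v" by blast
    obtain f' where f': "f' \<in> E" "z \<otimes> f = f' \<otimes> z" using swap[OF vf(2)] by blast
    have C: "v \<in> carrier D" "f \<in> carrier D" "f' \<in> carrier D" "z [^] j \<in> carrier D"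
      using vf f' span(1) Er z by auto
    have f'0: "f' \<noteq> \<zero>"
    proof
      assume "f' = \<zero>"
      then have "z \<otimes> f = \<zero>" using f' z by simp
      then show False using integral_iff[OF z(1) C(2)] z vf by simp
    qed
    define v' where "v' = e1 \<otimes> (z \<otimes> v) \<oplus> (e0 \<otimes> f) \<otimes> z [^] j \<oplus> e0 \<otimes> v"
    have "e0 \<otimes> v \<in> left_span E z (Suc j)" using span(6)[OF _ vf(1) e(3)] span(3)[OF _ le_SucI[OF le_refl]] by blast
    then have v': "v' \<in> left_span E z (Suc j)"
      unfolding v'_def using e vf Er(6)
      by (intro span(5) span(6)[OF _ span(7)] span(4)) auto
    have "w [^] Suc j = (e1 \<otimes> z \<oplus> e0) \<otimes> (f \<otimes> z [^] j \<oplus> v)"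
      unfolding nat_pow_Suc2[OF wC] vf(4) by (simp add: w_def)
    also have "\<dots> = e1 \<otimes> (z \<otimes> f) \<otimes> z [^] j \<oplus> v'"
      unfolding v'_def using eC z C by algebra
    also have "\<dots> = (e1 \<otimes> f') \<otimes> z [^] Suc j \<oplus> v'"
      unfolding f'(2) nat_pow_Suc2[OF z(1)] using eC z C by (simp add: m_assoc)
    finally have "w [^] Suc j = (e1 \<otimes> f') \<otimes> z [^] Suc j \<oplus> v'" .
    moreover have "e1 \<otimes> f' \<in> E" "e1 \<otimes> f' \<noteq> \<zero>" using Er(6) e f' f'0 integral_iff eC C by auto
    ultimately show ?case using v' by blast
  qed
  have "\<not> inj (\<lambda>i::nat. w [^] i)"
  proof
    assume "inj (\<lambda>i::nat. w [^] i)"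
    then have "infinite (range (\<lambda>i::nat. w [^] i))" using finite_imageD infinite_UNIV_nat by blast
    then show False using S by (metis (no_types, lifting) finite_subset image_subsetI w_def)
  qed
  then obtain i j :: nat where ij: "w [^] i = w [^] j" "i < j"
    by (metis injI linorder_neqE_nat)
  obtain v f where vf: "v \<in> left_span E z j" "f \<in> E" "f \<noteq> \<zero>" "w [^] j = f \<otimes> z [^] j \<oplus> v" using form by blast
  obtain v2 f2 where vf2: "v2 \<in> left_span E z i" "f2 \<in> E" "w [^] i = f2 \<otimes> z [^] i \<oplus> v2" using form by blast
  have C: "v \<in> carrier D" "f \<in> carrier D" "z [^] j \<in> carrier D" using vf span(1) Er z by auto
  have "v2 \<in> left_span E z (Suc i)" using span(3)[OF _ le_SucI[OF le_refl]] vf2(1) by blast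
  then have "w [^] i \<in> left_span E z (Suc i)" unfolding vf2(3) using vf2(2) by (intro span(5) span(4))
  then have wj: "w [^] j \<in> left_span E z j" using span(3)[of "Suc i" j] ij by auto
  have "f \<otimes> z [^] j = w [^] j \<oplus> \<ominus> \<one> \<otimes> v" unfolding vf(4) using C by (simp add: l_minus a_assoc r_neg)
  then have "f \<otimes> z [^] j \<in> left_span E z j" using span(5)[OF _ wj span(6)[OF _ vf(1)]] Er by simp
  then have "inv f \<otimes> (f \<otimes> z [^] j) \<in> left_span E z j"
    using span(6) subfield_m_inv(1)[OF E(1), of f] vf by simp
  then have zj: "z [^] j \<in> left_span E z j" using C vf by simp
  show ?thesis
    by (rule pow_eq_one_if_finite[OF z span(2)[of j]]) (use span(8)[OF _ zj] ij in auto)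
qed

end

section \<open>Normalizers of finite subfields\<close>

context skew_field
begin

lemma inv_mult:
  assumes "x \<in> carrier D" "x \<noteq> \<zero>" "y \<in> carrier D" "y \<noteq> \<zero>"
  shows "inv (x \<otimes> y) = inv y \<otimes> inv x"
proof -
  have xy: "x \<otimes> y \<in> carrier D" "x \<otimes> y \<noteq> \<zero>" using assms integral_iff by auto
  have "(x \<otimes> y) \<otimes> (inv y \<otimes> inv x) = \<one>" using assms by (simp add: m_assoc)
  also have "\<one> = (x \<otimes> y) \<otimes> inv (x \<otimes> y)" using xy by simp
  finally show ?thesis
    by (rule left_cancel[symmetric]) (use assms xy in auto)
qed

text \<open>Every fibre of \<open>f\<close> over its image is a translate of the kernel.\<close>

lemma card_image_mult_card_kernel:
  assumes E: "subfield E D" "finite E" and f: "\<And>g. g \<in> E - {\<zero>} \<Longrightarrow> f g \<in> E - {\<zero>}"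
    and hom: "\<And>g h. g \<in> E - {\<zero>} \<Longrightarrow> h \<in> E - {\<zero>} \<Longrightarrow> f (g \<otimes> h) = f g \<otimes> f h"
  shows "card (E - {\<zero>}) = card (f ` (E - {\<zero>})) * card {g \<in> E - {\<zero>}. f g = \<one>}"
proof -
  let ?G = "E - {\<zero>}" and ?K = "{g \<in> E - {\<zero>}. f g = \<one>}"
  note Er = subringE[OF subfieldE(1)[OF E(1)]]
  have GC: "g \<in> carrier D" "g \<noteq> \<zero>" if "g \<in> ?G" for g using that Er by auto
  have mult: "g \<otimes> h \<in> ?G" if "g \<in> ?G" "h \<in> ?G" for g h
    using that Er(6) GC integral_iff by auto
  have invG: "inv g \<in> ?G" if "g \<in> ?G" for g
    using subfield_m_inv(1)[OF E(1) that] .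
  have "card {g \<in> ?G. f g = y} = card ?K" if y: "y \<in> f ` ?G" for y
  proof -
    obtain g where g: "g \<in> ?G" "y = f g" using y by blast
    have "(\<otimes>) g ` ?K = {h \<in> ?G. f h = y}"
    proof (intro equalityI subsetI)
      fix w assume "w \<in> (\<otimes>) g ` ?K"
      then obtain k where k: "k \<in> ?G" "f k = \<one>" "w = g \<otimes> k" by blast
      then show "w \<in> {h \<in> ?G. f h = y}" using hom[OF g(1) k(1)] mult[OF g(1) k(1)] g GC[OF f[OF g(1)]] by simp
    next
      fix h assume "h \<in> {h \<in> ?G. f h = y}"
      then have h: "h \<in> ?G" "f h = f g" using g by auto
      define k where "k = inv g \<otimes> h"
      have k: "k \<in> ?G" unfolding k_def using mult invG g h by blast
      have gk: "g \<otimes> k = h" unfolding k_def using GC g h by simp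
      have "f g \<otimes> f k = f g \<otimes> \<one>" using hom[OF g(1) k] gk h(2) GC[OF f[OF g(1)]] by simp
      then have "f k = \<one>" by (rule left_cancel) (use GC f g k in auto)
      then show "h \<in> (\<otimes>) g ` ?K" using k gk by blast
    qed
    moreover have inj: "inj_on ((\<otimes>) g) ?K"
      using left_cancel[of g] GC g by (intro inj_onI) blast
    ultimately show ?thesis using card_image[OF inj] by simp
  qed
  moreover have "card ?G = (\<Sum>y \<in> f ` ?G. card {g \<in> ?G. f g = y})"
    using sum.image_gen[of ?G "\<lambda>_. 1::nat" f] E(2) by simp
  ultimately show ?thesis by simp
qed

text \<open>Dedekind's independence of the automorphisms \<open>s \<mapsto> x^i s x^{-i}\<close> of
  \<open>E\<close>, with weights \<open>w i\<close> on the right. The inverse powers of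
  \<open>x\<close> as weights give the classical statement used for Hilbert's theorem 90; the
  weights \<open>\<one>\<close> give the independence of the powers of \<open>x\<close> over
  \<open>E\<close>.\<close>

lemma dedekind_independence:
  fixes m :: nat and "is" :: "nat list"
  assumes E: "subfield E D" and x: "x \<in> carrier D" "x \<noteq> \<zero>"
    and normalizes: "\<And>i s. s \<in> E \<Longrightarrow> x [^] i \<otimes> s \<otimes> inv (x [^] (i::nat)) \<in> E"
    and w: "\<And>i. w i \<in> carrier D" "\<And>i. w i \<noteq> \<zero>"
    and separated: "\<And>i j. \<lbrakk>i < m; j < m; i \<noteq> j\<rbrakk> \<Longrightarrow>
      \<exists>s \<in> E. x [^] i \<otimes> s \<otimes> inv (x [^] i) \<noteq> x [^] j \<otimes> s \<otimes> inv (x [^] j)"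
    and "distinct is" "set is \<subseteq> {..<m}" "length es = length is" "set es \<subseteq> E"
    and "\<And>t. t \<in> E \<Longrightarrow> combine es (map (\<lambda>i. x [^] i \<otimes> t \<otimes> w i) is) = \<zero>"
  shows "set es \<subseteq> {\<zero>}"
  using assms(8-)
proof (induction "is" arbitrary: es)
  case (Cons j "is")
  note Er = subringE[OF subfieldE(1)[OF E]]
  have EC: "e \<in> carrier D" if "e \<in> E" for e using that Er by auto
  obtain f es' where es: "es = f # es'" using Cons.prems(3) by (cases es) auto
  have es': "length es' = length is" "set es' \<subseteq> E" "f \<in> E" using Cons.prems es by auto
  have pw: "x [^] i \<in> carrier D" "x [^] i \<noteq> \<zero>" for i :: nat using x pow_zero_iff by auto
  define sg where "sg i s = x [^] i \<otimes> s \<otimes> inv (x [^] (i::nat))" for i s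
  have sgE: "sg i s \<in> E" if "s \<in> E" for i s unfolding sg_def using normalizes that .
  have sg_comm: "x [^] i \<otimes> s = sg i s \<otimes> x [^] i" if "s \<in> E" for i s
    unfolding sg_def using pw EC[OF that] by (simp add: m_assoc)
  define M where "M t = combine es' (map (\<lambda>i. x [^] i \<otimes> t \<otimes> w i) is)" for t
  have MC: "M t \<in> carrier D" if "t \<in> E" for t
    unfolding M_def using es'(2) EC that pw w by (intro combine_in_carrier) auto
  have rel: "f \<otimes> (x [^] j \<otimes> t \<otimes> w j) \<oplus> M t = \<zero>" if "t \<in> E" for t
    using Cons.prems(5)[OF that] by (simp add: es M_def)
  \<comment> \<open>Substituting \<open>s t\<close> for \<open>t\<close> and subtracting
    \<open>sg j s\<close> times the relation at \<open>t\<close> removes the index \<open>j\<close>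
    and multiplies the coefficient at \<open>i\<close> by \<open>sg i s - sg j s\<close>.\<close>
  have zero: "set (map2 (\<lambda>e i. e \<otimes> (sg i s \<ominus> sg j s)) es' is) \<subseteq> {\<zero>}" if s: "s \<in> E" for s
  proof (rule Cons.IH)
    show "distinct is" "set is \<subseteq> {..<m}" using Cons.prems by auto
    show "length (map2 (\<lambda>e i. e \<otimes> (sg i s \<ominus> sg j s)) es' is) = length is" using es' by simp
    show "set (map2 (\<lambda>e i. e \<otimes> (sg i s \<ominus> sg j s)) es' is) \<subseteq> E"
      using es'(2) sgE[OF s] Er(5,6,7) by (auto simp: minus_eq dest!: set_zip_leftD)
    fix t assume t: "t \<in> E"
    have "combine (map2 (\<lambda>e i. e \<otimes> (sg i s \<ominus> sg j s)) es' is) (map (\<lambda>i. x [^] i \<otimes> t \<otimes> w i) is)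
      = M (s \<otimes> t) \<ominus> sg j s \<otimes> M t"
      unfolding M_def using es'(1,2)
    proof (induction es' "is" rule: list_induct2)
      case Nil
      then show ?case using EC sgE[OF s] by (simp add: minus_eq)
    next
      case (Cons e es i "is")
      define A where "A = combine es (map (\<lambda>i. x [^] i \<otimes> (s \<otimes> t) \<otimes> w i) is)"
      define B where "B = combine es (map (\<lambda>i. x [^] i \<otimes> t \<otimes> w i) is)"
      have eE: "e \<in> E" "set es \<subseteq> E" using Cons.prems by auto
      have AB: "A \<in> carrier D" "B \<in> carrier D"
        unfolding A_def B_def using eE EC s t pw w by (auto intro!: combine_in_carrier)
      have C: "e \<in> carrier D" "s \<in> carrier D" "t \<in> carrier D" "sg i s \<in> carrier D" "sg j s \<in> carrier D"
        using eE s t EC sgE by auto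
      define y where "y = x [^] i \<otimes> t \<otimes> w i"
      have y: "y \<in> carrier D" unfolding y_def using pw C w by simp
      have 1: "x [^] i \<otimes> (s \<otimes> t) \<otimes> w i = sg i s \<otimes> y"
      proof -
        have "x [^] i \<otimes> (s \<otimes> t) \<otimes> w i = (x [^] i \<otimes> s) \<otimes> t \<otimes> w i" using pw C w by (simp add: m_assoc)
        then show ?thesis unfolding sg_comm[OF s] y_def using pw C w by (simp add: m_assoc)
      qed
      have 2: "e \<otimes> sg j s = sg j s \<otimes> e" using subfieldE(4)[OF E eE(1) sgE[OF s]] .
      have "e \<otimes> (sg i s \<ominus> sg j s) \<otimes> y \<oplus> (A \<ominus> sg j s \<otimes> B)
        = e \<otimes> (sg i s \<otimes> y) \<ominus> (e \<otimes> sg j s) \<otimes> y \<oplus> (A \<ominus> sg j s \<otimes> B)"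
        using C y AB by algebra
      also have "\<dots> = e \<otimes> (sg i s \<otimes> y) \<oplus> A \<ominus> sg j s \<otimes> (e \<otimes> y \<oplus> B)"
        unfolding 2 using C y AB by algebra
      finally show ?case using Cons.IH[OF eE(2)] 1 by (simp add: A_def B_def y_def)
    qed
    also have "\<dots> = \<zero>"
    proof -
      define y where "y = x [^] j \<otimes> t \<otimes> w j"
      have C: "f \<in> carrier D" "s \<in> carrier D" "t \<in> carrier D" "sg j s \<in> carrier D" "M t \<in> carrier D" "M (s \<otimes> t) \<in> carrier D"
        using es' s t EC sgE MC Er(6) by auto
      have y: "y \<in> carrier D" unfolding y_def using pw C w by simp
      have "x [^] j \<otimes> (s \<otimes> t) \<otimes> w j = (x [^] j \<otimes> s) \<otimes> t \<otimes> w j" using pw C w by (simp add: m_assoc)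
      then have 1: "x [^] j \<otimes> (s \<otimes> t) \<otimes> w j = sg j s \<otimes> y"
        unfolding sg_comm[OF s] y_def using pw C w by (simp add: m_assoc)
      have 2: "f \<otimes> sg j s = sg j s \<otimes> f" using subfieldE(4)[OF E es'(3) sgE[OF s]] .
      have r1: "f \<otimes> (sg j s \<otimes> y) \<oplus> M (s \<otimes> t) = \<zero>" using rel[OF Er(6)[OF s t]] unfolding 1 .
      have r2: "f \<otimes> y \<oplus> M t = \<zero>" using rel[OF t] by (simp add: y_def)
      have "M (s \<otimes> t) \<ominus> sg j s \<otimes> M t
        = (f \<otimes> (sg j s \<otimes> y) \<oplus> M (s \<otimes> t)) \<ominus> (f \<otimes> sg j s) \<otimes> y \<ominus> sg j s \<otimes> M t"
        using C y by algebra
      also have "\<dots> = (f \<otimes> (sg j s \<otimes> y) \<oplus> M (s \<otimes> t)) \<ominus> sg j s \<otimes> (f \<otimes> y \<oplus> M t)"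
        unfolding 2 using C y by algebra
      also have "\<dots> = \<zero>" unfolding r1 r2 using C by (simp add: minus_eq)
      finally show ?thesis .
    qed
    finally show "combine (map2 (\<lambda>e i. e \<otimes> (sg i s \<ominus> sg j s)) es' is) (map (\<lambda>i. x [^] i \<otimes> t \<otimes> w i) is) = \<zero>" .
  qed
  have "e = \<zero>" if e: "e \<in> set es'" for e
  proof -
    obtain n where n: "n < length es'" "e = es' ! n" using e by (metis in_set_conv_nth)
    define i where "i = is ! n"
    have i: "(e, i) \<in> set (zip es' is)" "i \<in> set is"
      using n es'(1) by (auto simp: i_def in_set_zip)
    then have "i < m" "j < m" "i \<noteq> j" using Cons.prems by auto
    then obtain s where s: "s \<in> E" "sg i s \<noteq> sg j s" using separated unfolding sg_def by blast
    have "e \<otimes> (sg i s \<ominus> sg j s) = \<zero>" using zero[OF s(1)] i(1) by force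
    then show ?thesis
      using integral_iff[of e "sg i s \<ominus> sg j s"] minus_eq_zero_iff[of "sg i s" "sg j s"] s sgE EC es'(2) e by auto
  qed
  then have es0: "set es' \<subseteq> {\<zero>}" by auto
  then have "es' = replicate (length es') \<zero>" by (intro replicate_eqI) auto
  then have "M \<one> = combine (replicate (length (map (\<lambda>i. x [^] i \<otimes> \<one> \<otimes> w i) is)) \<zero>) (map (\<lambda>i. x [^] i \<otimes> \<one> \<otimes> w i) is)"
    unfolding M_def using es'(1) by simp
  also have "\<dots> = \<zero>" by (rule combine_replicate) (use pw w in auto)
  finally have "f \<otimes> (x [^] j \<otimes> \<one> \<otimes> w j) = \<zero>" using rel[OF Er(3)] EC[OF es'(3)] pw w by simp
  then have "f = \<zero>" using integral_iff EC[OF es'(3)] pw w by simp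
  then show ?case using es es0 by simp
qed simp

text \<open>
  Counting with Hilbert's theorem 90, the norm \<open>e \<mapsto> (e x)^m x^{-m}\<close> of a finite field \<open>E\<close>
  normalised by \<open>x\<close> is onto the elements fixed by \<open>x\<close>; hence some \<open>y = e x\<close> has \<open>y^m = 1\<close>, and
  \<open>1 + y + \<dots> + y^{m-1} = 0\<close> contradicts the independence of the powers of \<open>x\<close> over \<open>E\<close>.
\<close>
lemma finite_field_norm_contradiction:
  fixes m :: nat
  assumes E: "subfield E D" "finite E" and x: "x \<in> carrier D" "x \<noteq> \<zero>"
    and normalizes: "\<And>e. e \<in> E \<Longrightarrow> x \<otimes> e \<otimes> inv x \<in> E"
    and m: "m > 0" "x [^] m \<in> E"
    and separated: "\<And>i. \<lbrakk>0 < i; i < m\<rbrakk> \<Longrightarrow> \<exists>s \<in> E. x [^] i \<otimes> s \<noteq> s \<otimes> x [^] i"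
    and u: "u \<in> E" "x \<otimes> u \<noteq> u \<otimes> x"
  shows False
proof -
  let ?G = "E - {\<zero>}"
  note Er = subringE[OF subfieldE(1)[OF E(1)]]
  have EC: "e \<in> carrier D" if "e \<in> E" for e using that Er by auto
  have comm: "e \<otimes> f = f \<otimes> e" if "e \<in> E" "f \<in> E" for e f using subfieldE(4)[OF E(1)] that .
  have mult: "g \<otimes> h \<in> ?G" if "g \<in> ?G" "h \<in> ?G" for g h
    using that Er(6) EC integral_iff by auto
  have invG: "inv g \<in> ?G" if "g \<in> ?G" for g
    using subfield_m_inv(1)[OF E(1) that] .
  have oneG: "\<one> \<in> ?G" using Er by simp
  have pw: "x [^] i \<in> carrier D" "x [^] i \<noteq> \<zero>" for i :: nat using x pow_zero_iff by auto
  define \<sigma> where "\<sigma> e = x \<otimes> e \<otimes> inv x" for e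
  have \<sigma>G: "\<sigma> e \<in> ?G" if "e \<in> ?G" for e
    using that normalizes x EC integral_iff unfolding \<sigma>_def by auto
  have \<sigma>x: "x \<otimes> e = \<sigma> e \<otimes> x" if "e \<in> E" for e
    unfolding \<sigma>_def using x EC that by (simp add: m_assoc)
  have \<sigma>_mult: "\<sigma> (e \<otimes> f) = \<sigma> e \<otimes> \<sigma> f" if "e \<in> E" "f \<in> E" for e f
    unfolding \<sigma>_def using x EC that by (simp add: m_assoc)
  define c where "c = x [^] m"
  have c: "c \<in> ?G" unfolding c_def using m pw by auto
  have xi_Suc: "x [^] Suc i \<otimes> s \<otimes> inv (x [^] Suc i) = \<sigma> (x [^] i \<otimes> s \<otimes> inv (x [^] i))"
    if "s \<in> carrier D" for i :: nat and s
    unfolding nat_pow_Suc2[OF x(1)] \<sigma>_def inv_mult[OF x pw] using x pw[of i] that by (simp add: m_assoc)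
  have pow_normalizes: "x [^] i \<otimes> s \<otimes> inv (x [^] (i::nat)) \<in> E" if "s \<in> E" for i s
  proof (induction i)
    case 0
    have "inv \<one> = \<one>" by (rule inv_unique'[symmetric]) auto
    then show ?case using EC that by simp
  next
    case (Suc i)
    show ?case unfolding xi_Suc[OF EC[OF that]] \<sigma>_def using normalizes[OF Suc] .
  qed
  have separated': "\<exists>s \<in> E. x [^] i \<otimes> s \<otimes> inv (x [^] i) \<noteq> x [^] j \<otimes> s \<otimes> inv (x [^] j)"
    if "i < m" "j < m" "i \<noteq> j" for i j
  proof -
    have "\<exists>s \<in> E. x [^] i \<otimes> s \<otimes> inv (x [^] i) \<noteq> x [^] j \<otimes> s \<otimes> inv (x [^] j)" if ij: "i < j" "j < m" for i j
    proof -
      have "0 < j - i" "j - i < m" using ij by auto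
      then obtain s where s: "s \<in> E" "x [^] (j - i) \<otimes> s \<noteq> s \<otimes> x [^] (j - i)" using separated by blast
      have sC: "s \<in> carrier D" using EC s by blast
      define p where "p = x [^] (j - i)"
      have p: "p \<in> carrier D" "p \<noteq> \<zero>" unfolding p_def using pw by auto
      have xj: "x [^] j = x [^] i \<otimes> p" unfolding p_def using nat_pow_mult[OF x(1), of i "j - i"] ij by simp
      have "x [^] i \<otimes> s \<otimes> inv (x [^] i) \<noteq> x [^] j \<otimes> s \<otimes> inv (x [^] j)"
      proof
        assume eq: "x [^] i \<otimes> s \<otimes> inv (x [^] i) = x [^] j \<otimes> s \<otimes> inv (x [^] j)"
        have "x [^] i \<otimes> (s \<otimes> inv (x [^] i)) = x [^] i \<otimes> (p \<otimes> s \<otimes> inv p \<otimes> inv (x [^] i))"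
          using eq unfolding xj inv_mult[OF pw p] using p pw sC by (simp add: m_assoc)
        then have "s \<otimes> inv (x [^] i) = p \<otimes> s \<otimes> inv p \<otimes> inv (x [^] i)"
          by (rule left_cancel) (use p pw sC in auto)
        then have "s = p \<otimes> s \<otimes> inv p"
          by (rule right_cancel) (use p pw sC in auto)
        then have "s \<otimes> p = p \<otimes> s \<otimes> inv p \<otimes> p" by simp
        then have "s \<otimes> p = p \<otimes> s" using p sC by (simp add: m_assoc)
        then show False using s(2) by (simp add: p_def)
      qed
      then show ?thesis using s by blast
    qed
    from this[of i j] this[of j i] that show ?thesis by (metis linorder_neqE_nat)
  qed
  \<comment> \<open>The partial norm, the product of \<open>e\<close>, \<open>\<sigma> e\<close>, up
    to the (i-1)-st iterate of \<open>\<sigma>\<close>; \<open>\<nu> m\<close> is the full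
    norm.\<close>
  define \<nu> where "\<nu> i e = (e \<otimes> x) [^] i \<otimes> inv (x [^] (i::nat))" for i e
  have \<nu>_0: "\<nu> 0 e = \<one>" if "e \<in> E" for e
  proof -
    have "inv \<one> = \<one>" by (rule inv_unique'[symmetric]) auto
    then show ?thesis by (simp add: \<nu>_def)
  qed
  have \<nu>_Suc: "\<nu> (Suc i) e = e \<otimes> \<sigma> (\<nu> i e)" if "e \<in> E" for i e
  proof -
    have exC: "e \<otimes> x \<in> carrier D" using EC that x by simp
    show ?thesis
      unfolding \<nu>_def \<sigma>_def nat_pow_Suc2[OF exC] nat_pow_Suc2[OF x(1)] inv_mult[OF x pw]
      using exC EC[OF that] x pw[of i] by (simp add: m_assoc)
  qed
  have \<nu>G: "\<nu> i e \<in> ?G" if e: "e \<in> ?G" for i e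
  proof (induction i)
    case 0
    then show ?case using \<nu>_0 e oneG by simp
  next
    case (Suc i)
    then show ?case using \<nu>_Suc e mult \<sigma>G by simp
  qed
  have \<nu>_pow: "(e \<otimes> x) [^] i = \<nu> i e \<otimes> x [^] i" if "e \<in> E" for i e
    unfolding \<nu>_def using EC that x pw[of i] by (simp add: m_assoc)
  have \<nu>_mult: "\<nu> i (e \<otimes> f) = \<nu> i e \<otimes> \<nu> i f" if e: "e \<in> ?G" "f \<in> ?G" for i e f
  proof (induction i)
    case 0
    then show ?case using \<nu>_0 that Er(6) by simp
  next
    case (Suc i)
    have G: "\<nu> i e \<in> ?G" "\<nu> i f \<in> ?G" "\<sigma> (\<nu> i e) \<in> ?G" "\<sigma> (\<nu> i f) \<in> ?G" using \<nu>G \<sigma>G e by auto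
    have "\<nu> (Suc i) (e \<otimes> f) = e \<otimes> f \<otimes> (\<sigma> (\<nu> i e) \<otimes> \<sigma> (\<nu> i f))"
      using \<nu>_Suc[of "e \<otimes> f"] Suc \<sigma>_mult G e Er(6) by simp
    also have "\<dots> = e \<otimes> (f \<otimes> \<sigma> (\<nu> i e)) \<otimes> \<sigma> (\<nu> i f)"
      using EC G e by (simp add: m_assoc)
    also have "f \<otimes> \<sigma> (\<nu> i e) = \<sigma> (\<nu> i e) \<otimes> f" using comm G e by auto
    finally show ?case using \<nu>_Suc e EC G by (simp add: m_assoc)
  qed
  define Z where "Z = {z \<in> ?G. z \<otimes> x = x \<otimes> z}"
  \<comment> \<open>The homomorphism of Hilbert's theorem 90: its kernel consists of the fixed
    elements, and \<open>hilbert\<close> shows that its image contains the kernel of the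
    norm.\<close>
  define \<psi> where "\<psi> h = h \<otimes> inv (\<sigma> h)" for h
  have \<psi>G: "\<psi> h \<in> ?G" if "h \<in> ?G" for h unfolding \<psi>_def using mult invG \<sigma>G that by blast
  have \<psi>_mult: "\<psi> (g \<otimes> h) = \<psi> g \<otimes> \<psi> h" if gh: "g \<in> ?G" "h \<in> ?G" for g h
  proof -
    have C: "g \<in> carrier D" "h \<in> carrier D" "\<sigma> g \<in> carrier D" "\<sigma> h \<in> carrier D"
      "inv (\<sigma> g) \<in> carrier D" "inv (\<sigma> h) \<in> carrier D" "\<sigma> g \<noteq> \<zero>" "\<sigma> h \<noteq> \<zero>"
      using gh \<sigma>G invG EC by auto
    have "\<psi> (g \<otimes> h) = g \<otimes> h \<otimes> (inv (\<sigma> h) \<otimes> inv (\<sigma> g))"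
      unfolding \<psi>_def using gh \<sigma>_mult inv_mult C by simp
    also have "inv (\<sigma> h) \<otimes> inv (\<sigma> g) = inv (\<sigma> g) \<otimes> inv (\<sigma> h)" using comm gh \<sigma>G invG by blast
    also have "g \<otimes> h \<otimes> (inv (\<sigma> g) \<otimes> inv (\<sigma> h)) = g \<otimes> (h \<otimes> inv (\<sigma> g)) \<otimes> inv (\<sigma> h)" using C by (simp add: m_assoc)
    also have "h \<otimes> inv (\<sigma> g) = inv (\<sigma> g) \<otimes> h" using comm gh \<sigma>G invG by blast
    finally show ?thesis unfolding \<psi>_def using C by (simp add: m_assoc)
  qed
  have ker_\<psi>: "{h \<in> ?G. \<psi> h = \<one>} = Z"
  proof -
    have "\<psi> h = \<one> \<longleftrightarrow> h \<otimes> x = x \<otimes> h" if h: "h \<in> ?G" for h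
    proof
      have C: "h \<in> carrier D" "\<sigma> h \<in> carrier D" "\<sigma> h \<noteq> \<zero>" using h \<sigma>G EC by auto
      show "h \<otimes> x = x \<otimes> h" if "\<psi> h = \<one>"
      proof -
        have "h \<otimes> inv (\<sigma> h) \<otimes> \<sigma> h = \<sigma> h" using that C by (simp add: \<psi>_def)
        then have "h = \<sigma> h" using C by (simp add: m_assoc)
        then show ?thesis using \<sigma>x h by auto
      qed
      show "\<psi> h = \<one>" if "h \<otimes> x = x \<otimes> h"
      proof -
        have "\<sigma> h = h" unfolding \<sigma>_def using that[symmetric] C x by (simp add: m_assoc)
        then show ?thesis unfolding \<psi>_def using C by simp
      qed
    qed
    then show ?thesis unfolding Z_def by blast
  qed
  \<comment> \<open>The power \<open>(e x)^m\<close> equals \<open>n c\<close> and commutes with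
    \<open>e x\<close>; as a member of \<open>E\<close> it also commutes with \<open>e\<close>,
    hence with \<open>x\<close>. Since \<open>c\<close> commutes with \<open>x\<close>, so does
    \<open>n\<close>.\<close>
  have \<nu>mZ: "\<nu> m e \<in> Z" if e: "e \<in> ?G" for e
  proof -
    define n where "n = \<nu> m e"
    have n: "n \<in> ?G" unfolding n_def using \<nu>G e by blast
    have C: "n \<in> carrier D" "c \<in> carrier D" "e \<in> carrier D" "c \<noteq> \<zero>" "e \<noteq> \<zero>" using n c e EC by auto
    have eq: "(e \<otimes> x) [^] m = n \<otimes> c" unfolding n_def c_def using \<nu>_pow e by blast
    have cx: "x \<otimes> c = c \<otimes> x" unfolding c_def using nat_pow_Suc2[OF x(1), of m] by simp
    have "e \<otimes> x \<otimes> (n \<otimes> c) = n \<otimes> c \<otimes> (e \<otimes> x)"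
      unfolding eq[symmetric] using nat_pow_Suc2[of "e \<otimes> x" m] C x by simp
    also have "\<dots> = (n \<otimes> c) \<otimes> e \<otimes> x" using C x by (simp add: m_assoc)
    also have "(n \<otimes> c) \<otimes> e = e \<otimes> (n \<otimes> c)" using comm n c e Er(6) by auto
    finally have "e \<otimes> (x \<otimes> (n \<otimes> c)) = e \<otimes> (n \<otimes> c \<otimes> x)" using C x by (simp add: m_assoc)
    then have "x \<otimes> (n \<otimes> c) = n \<otimes> c \<otimes> x" by (rule left_cancel) (use C x in auto)
    also have "\<dots> = n \<otimes> x \<otimes> c" using cx C x by (simp add: m_assoc)
    finally have "x \<otimes> n \<otimes> c = n \<otimes> x \<otimes> c" using C x by (simp add: m_assoc)
    then have "x \<otimes> n = n \<otimes> x" by (rule right_cancel) (use C x in auto)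
    then show ?thesis unfolding Z_def n_def[symmetric] using n by simp
  qed
  have sum_form: "combine (map (\<lambda>i. \<nu> i e) (rev [0..<Suc n])) (map f (rev [0..<Suc n]))
    = \<nu> n e \<otimes> f n \<oplus> combine (map (\<lambda>i. \<nu> i e) (rev [0..<n])) (map f (rev [0..<n]))" for e f n
    by simp
  have nonzero: "\<exists>t \<in> E. combine (map (\<lambda>i. \<nu> i e) (rev [0..<m])) (map (\<lambda>i. x [^] i \<otimes> t \<otimes> w i) (rev [0..<m])) \<noteq> \<zero>"
    if e: "e \<in> ?G" and w: "\<And>i. w i \<in> carrier D" "\<And>i. w i \<noteq> \<zero>" for e w
  proof (rule ccontr)
    assume contra: "\<not> ?thesis"
    have "set (map (\<lambda>i. \<nu> i e) (rev [0..<m])) \<subseteq> {\<zero>}"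
      by (rule dedekind_independence[OF E(1) x pow_normalizes w separated', of m "rev [0..<m]"])
        (use contra \<nu>G[OF e] in auto)
    moreover have "\<one> \<in> set (map (\<lambda>i. \<nu> i e) (rev [0..<m]))" using m(1) \<nu>_0[of e] e by force
    ultimately show False using one_not_zero by blast
  qed
  have hilbert: "e \<in> \<psi> ` ?G" if e: "e \<in> ?G" "\<nu> m e = \<one>" for e
  proof -
    \<comment> \<open>The resolvent with terms \<open>\<nu> i e\<close> times the i-th iterate of
      \<open>\<sigma>\<close> at \<open>t\<close>. Applying \<open>\<sigma>\<close> and multiplying
      by \<open>e\<close> shifts its terms by one; for \<open>n = m\<close> the ends agree, so
      \<open>e \<sigma>(h) = h\<close>. Dedekind independence supplies a \<open>t\<close> for which
      \<open>h\<close> is nonzero.\<close>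
    define H where "H n t = combine (map (\<lambda>i. \<nu> i e) (rev [0..<n])) (map (\<lambda>i. x [^] i \<otimes> t \<otimes> inv (x [^] i)) (rev [0..<n]))" for n t
    have eC: "e \<in> carrier D" using e EC by auto
    have HE: "H n t \<in> E" if "t \<in> E" for n t
    proof (induction n)
      case (Suc n)
      then show ?case unfolding H_def sum_form using \<nu>G[OF e(1)] pow_normalizes[OF that] Er(6,7) by auto
    qed (use Er in \<open>simp add: H_def\<close>)
    have tele: "e \<otimes> x \<otimes> H n t \<otimes> inv x \<oplus> t = H n t \<oplus> \<nu> n e \<otimes> (x [^] n \<otimes> t \<otimes> inv (x [^] n))" if t: "t \<in> E" for n t
    proof (induction n)
      case 0
      have "inv \<one> = \<one>" by (rule inv_unique'[symmetric]) auto
      then show ?case using EC t eC x \<nu>_0 e by (simp add: H_def)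
    next
      case (Suc n)
      define a where "a = \<nu> n e"
      define b where "b = x [^] n \<otimes> t \<otimes> inv (x [^] n)"
      have C: "a \<in> E" "b \<in> E" "a \<in> carrier D" "b \<in> carrier D" "H n t \<in> carrier D" "t \<in> carrier D" "\<sigma> a \<in> carrier D"
        unfolding a_def b_def using \<nu>G[OF e(1)] pow_normalizes[OF t] HE[OF t] t EC \<sigma>G[OF \<nu>G[OF e(1)]] by auto
      have H_Suc: "H (Suc n) t = a \<otimes> b \<oplus> H n t" unfolding H_def sum_form a_def b_def ..
      have "e \<otimes> x \<otimes> H (Suc n) t \<otimes> inv x \<oplus> t = e \<otimes> (x \<otimes> (a \<otimes> b) \<otimes> inv x) \<oplus> (e \<otimes> x \<otimes> H n t \<otimes> inv x \<oplus> t)"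
        unfolding H_Suc using C eC x inv_facts(1)[OF x] by algebra
      also have "x \<otimes> (a \<otimes> b) \<otimes> inv x = \<sigma> a \<otimes> \<sigma> b" using \<sigma>_mult[OF C(1,2)] by (simp add: \<sigma>_def)
      also have "e \<otimes> (\<sigma> a \<otimes> \<sigma> b) = \<nu> (Suc n) e \<otimes> (x [^] Suc n \<otimes> t \<otimes> inv (x [^] Suc n))"
        unfolding xi_Suc[OF C(6)] b_def[symmetric] using \<nu>_Suc[of e n] e eC C normalizes[OF C(2)] EC
        by (simp add: a_def[symmetric] m_assoc \<sigma>_def[of b])
      also have "e \<otimes> x \<otimes> H n t \<otimes> inv x \<oplus> t = H (Suc n) t"
        unfolding Suc H_Suc a_def[symmetric] b_def[symmetric] using C by (simp add: a_comm)
      finally show ?case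
        using C \<nu>G[OF e(1), of "Suc n"] pow_normalizes[OF t, of "Suc n"] EC HE[OF t, of "Suc n"]
        by (simp add: a_comm del: nat_pow_Suc)
    qed
    obtain t where t: "t \<in> E" "H m t \<noteq> \<zero>"
      using nonzero[OF e(1), of "\<lambda>i. inv (x [^] i)"] pw unfolding H_def by auto
    define h where "h = H m t"
    have h: "h \<in> ?G" unfolding h_def using HE t by simp
    have hC: "h \<in> carrier D" "t \<in> carrier D" using h t EC by auto
    have "x [^] m \<otimes> t \<otimes> inv (x [^] m) = t"
    proof -
      have "c \<otimes> t = t \<otimes> c" using comm c t by auto
      then show ?thesis using c hC EC unfolding c_def[symmetric] by (simp add: m_assoc)
    qed
    then have "e \<otimes> x \<otimes> h \<otimes> inv x \<oplus> t = h \<oplus> t" using tele[OF t(1), of m] e(2) hC by (simp add: h_def)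
    then have "e \<otimes> \<sigma> h = h" unfolding \<sigma>_def using eC x hC by (simp add: m_assoc)
    then have "\<psi> h = e \<otimes> \<sigma> h \<otimes> inv (\<sigma> h)" unfolding \<psi>_def by simp
    also have "\<dots> = e" using \<sigma>G[OF h] EC eC by (simp add: m_assoc)
    finally show ?thesis using h by blast
  qed
  have finG: "finite ?G" using E(2) by simp
  \<comment> \<open>Both products equal the number of nonzero elements of \<open>E\<close>. As the
    kernel of the norm is no larger than the image of \<open>\<psi>\<close>, the image of the norm
    is at least as large as \<open>Z\<close>, and it is contained in \<open>Z\<close>.\<close>
  have 1: "card ?G = card (\<nu> m ` ?G) * card {g \<in> ?G. \<nu> m g = \<one>}"
    by (rule card_image_mult_card_kernel[OF E \<nu>G \<nu>_mult])
  have 2: "card ?G = card (\<psi> ` ?G) * card Z"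
    using card_image_mult_card_kernel[OF E \<psi>G \<psi>_mult] unfolding ker_\<psi> .
  have 3: "card {g \<in> ?G. \<nu> m g = \<one>} \<le> card (\<psi> ` ?G)"
    using finG hilbert by (intro card_mono) auto
  have "card (\<psi> ` ?G) > 0" using finG oneG card_gt_0_iff by blast
  moreover have "card (\<psi> ` ?G) * card Z \<le> card (\<psi> ` ?G) * card (\<nu> m ` ?G)"
  proof -
    have "card (\<psi> ` ?G) * card Z = card (\<nu> m ` ?G) * card {g \<in> ?G. \<nu> m g = \<one>}"
      by (rule trans[OF 2[symmetric] 1])
    also have "\<dots> \<le> card (\<nu> m ` ?G) * card (\<psi> ` ?G)" by (rule mult_le_mono2[OF 3])
    finally show ?thesis by (simp only: mult.commute)
  qed
  ultimately have "card Z \<le> card (\<nu> m ` ?G)" by (metis mult_le_cancel1)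
  moreover have "\<nu> m ` ?G \<subseteq> Z" "finite Z" using \<nu>mZ finG unfolding Z_def by auto
  ultimately have surj: "\<nu> m ` ?G = Z" using card_seteq by blast
  \<comment> \<open>Being fixed, the inverse of \<open>c\<close> is a norm, say of \<open>e\<close>,
    and then \<open>(e x)^m\<close> is this inverse times \<open>c\<close>, which is
    \<open>\<one>\<close>.\<close>
  have "inv c \<in> Z"
  proof -
    have C: "c \<in> carrier D" "c \<noteq> \<zero>" using c EC by auto
    have cx: "x \<otimes> c = c \<otimes> x" unfolding c_def using nat_pow_Suc2[OF x(1), of m] by simp
    have "inv c \<otimes> (x \<otimes> c) \<otimes> inv c = inv c \<otimes> (c \<otimes> x) \<otimes> inv c" using cx by simp
    then have "inv c \<otimes> x = x \<otimes> inv c" using C x by (simp add: m_assoc)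
    then show ?thesis unfolding Z_def using invG[OF c] by simp
  qed
  then have "inv c \<in> \<nu> m ` ?G" using surj by simp
  then obtain e where e: "e \<in> ?G" "\<nu> m e = inv c" by (elim imageE) simp
  define y where "y = e \<otimes> x"
  have eC: "e \<in> carrier D" "e \<noteq> \<zero>" using e EC by auto
  have yC: "y \<in> carrier D" unfolding y_def using eC x by simp
  have ym: "y [^] m = \<one>" unfolding y_def using \<nu>_pow[of e m] e c EC by (simp add: c_def)
  \<comment> \<open>The sum of the powers of \<open>y\<close> below \<open>n\<close>, written
    through the powers of \<open>x\<close> with coefficients in \<open>E\<close> so that
    \<open>nonzero\<close> with weights \<open>\<one>\<close> refutes
    \<open>R m = \<zero>\<close>.\<close>
  define R where "R n = combine (map (\<lambda>i. \<nu> i e) (rev [0..<n])) (map (\<lambda>i. x [^] i) (rev [0..<n]))" for n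
  have RC: "R n \<in> carrier D" for n
    unfolding R_def using \<nu>G[OF e(1)] EC pw by (intro combine_in_carrier) auto
  have R_Suc: "R (Suc n) = y [^] n \<oplus> R n" for n
    unfolding R_def sum_form y_def using \<nu>_pow[of e n] e by simp
  have tele: "y \<otimes> R n \<oplus> \<one> = R n \<oplus> y [^] n" for n
  proof (induction n)
    case 0
    show ?case using yC by (simp add: R_def)
  next
    case (Suc n)
    have "y \<otimes> R (Suc n) \<oplus> \<one> = y \<otimes> y [^] n \<oplus> (y \<otimes> R n \<oplus> \<one>)"
      unfolding R_Suc using yC RC by (simp add: r_distr a_assoc)
    also have "\<dots> = R (Suc n) \<oplus> y [^] Suc n"
      unfolding Suc R_Suc nat_pow_Suc2[OF yC] using yC RC by (simp add: a_ac)
    finally show ?case .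
  qed
  have "y \<otimes> R m = R m" using tele[of m] yC RC ym by simp
  moreover have "y \<noteq> \<one>"
  proof
    assume "y = \<one>"
    then have "inv e \<otimes> (e \<otimes> x) = inv e" using eC by (simp add: y_def)
    then have "x = inv e" using eC x by simp
    then have "x \<in> E" using invG e by auto
    then show False using comm u by blast
  qed
  ultimately have "R m = \<zero>"
  proof -
    have "(y \<ominus> \<one>) \<otimes> R m = y \<otimes> R m \<ominus> \<one> \<otimes> R m" using yC RC[of m] one_closed by algebra
    then have "(y \<ominus> \<one>) \<otimes> R m = \<zero>" using \<open>y \<otimes> R m = R m\<close> RC by (simp add: minus_eq r_neg)
    then show ?thesis using integral_iff[of "y \<ominus> \<one>" "R m"] minus_eq_zero_iff[of y \<one>] \<open>y \<noteq> \<one>\<close> yC RC by simp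
  qed
  obtain t where t: "t \<in> E"
    "combine (map (\<lambda>i. \<nu> i e) (rev [0..<m])) (map (\<lambda>i. x [^] i \<otimes> t \<otimes> \<one>) (rev [0..<m])) \<noteq> \<zero>"
    using nonzero[OF e(1), of "\<lambda>i. \<one>"] by auto
  have "map (\<lambda>i. x [^] i \<otimes> t \<otimes> \<one>) (rev [0..<m]) = map (\<lambda>v. v \<otimes> t) (map (\<lambda>i. x [^] i) (rev [0..<m]))"
    using EC t pw by simp
  then have "combine (map (\<lambda>i. \<nu> i e) (rev [0..<m])) (map (\<lambda>i. x [^] i \<otimes> t \<otimes> \<one>) (rev [0..<m])) = R m \<otimes> t"
    unfolding R_def using \<nu>G[OF e(1)] EC pw t by (subst combine_l_distr) (auto simp: o_def)
  then show False using t \<open>R m = \<zero>\<close> EC by simp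
qed

text \<open>Adjoining a commuting element of finite order to a finite field gives a finite
  commutative ring, as \<open>z^l = 1\<close> reduces exponents below \<open>l\<close>. A nonzero
  element of it has finite order, so its inverse is one of its powers.\<close>

lemma left_span_subfield:
  assumes E: "subfield E D" "finite E" and z: "z \<in> carrier D" "z \<noteq> \<zero>"
    and comm: "\<And>e. e \<in> E \<Longrightarrow> z \<otimes> e = e \<otimes> z" and l: "l > 0" "z [^] l = \<one>"
  shows "subfield (left_span E z l) D" and "E \<subseteq> left_span E z l" and "z \<in> left_span E z l"
proof -
  note ring_E = subfieldE(1)[OF E(1)]
  note Er = subringE[OF ring_E]
  have swap: "\<exists>e' \<in> E. z \<otimes> e = e' \<otimes> z" if "e \<in> E" for e using comm that by blast
  let ?S = "left_span E z"
  have carr: "v \<in> carrier D" if "v \<in> ?S j" for v j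
    by (rule left_span_carrier[OF ring_E z(1) swap that])
  have add: "v \<oplus> w \<in> ?S j" if "v \<in> ?S j" "w \<in> ?S j" for v w j
    by (rule left_span_add[OF ring_E z(1) swap that])
  have smult: "e \<otimes> v \<in> ?S j" if "v \<in> ?S j" "e \<in> E" for e v j
    by (rule left_span_smult[OF ring_E z(1) swap that])
  have mono: "?S i \<subseteq> ?S j" if "i \<le> j" for i j
    by (rule left_span_mono[OF ring_E z(1) swap that])
  have E1: "E \<subseteq> ?S l"
  proof
    fix e assume e: "e \<in> E"
    then have "e \<otimes> z [^] (0::nat) \<in> ?S (Suc 0)" using left_span_pow[OF ring_E z(1) swap] by blast
    then have "e \<in> ?S (Suc 0)" using e Er by auto
    then show "e \<in> ?S l" using mono[of "Suc 0" l] l(1) by auto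
  qed
  have zl: "z [^] l \<in> ?S l" unfolding l(2) using E1 Er(3) by blast
  have shift: "z \<otimes> v \<in> ?S l" if "v \<in> ?S l" for v
    by (rule left_span_closed[OF ring_E z(1) swap zl that])
  have pow: "z [^] (i::nat) \<in> ?S l" for i
    by (rule left_span_pow_closed[OF ring_E z(1) swap zl l(1)])
  have pow_mult: "z [^] (i::nat) \<otimes> v \<in> ?S l" if "v \<in> ?S l" for i v
  proof (induction i)
    case 0
    then show ?case using that carr by simp
  next
    case (Suc i)
    have "z [^] Suc i \<otimes> v = z \<otimes> (z [^] i \<otimes> v)"
      unfolding nat_pow_Suc2[OF z(1)] by (rule m_assoc) (use z carr that in auto)
    then show ?case using shift[OF Suc] by simp
  qed
  have mult: "v \<otimes> w \<in> ?S l" if "v \<in> ?S j" "w \<in> ?S l" for v w j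
    using that(1)
  proof (induction j arbitrary: v)
    case 0
    then show ?case using mono[of 0 l] carr[OF that(2)] by simp
  next
    case (Suc j)
    then obtain v' e where *: "v = v' \<oplus> e \<otimes> z [^] j" "v' \<in> ?S j" "e \<in> E" by (auto simp: left_span.simps(2))
    have C: "v' \<in> carrier D" "e \<in> carrier D" "w \<in> carrier D" "z [^] j \<in> carrier D"
      using * carr that(2) Er z by auto
    have eq: "v \<otimes> w = v' \<otimes> w \<oplus> e \<otimes> (z [^] j \<otimes> w)" unfolding *(1) using C by algebra
    show ?case unfolding eq by (rule add[OF Suc.IH[OF *(2)] smult[OF pow_mult[OF that(2)] *(3)]])
  qed
  have commute: "v \<otimes> y = y \<otimes> v"
    if "v \<in> ?S j" and y: "y \<in> carrier D" "z \<otimes> y = y \<otimes> z" "\<And>e. e \<in> E \<Longrightarrow> e \<otimes> y = y \<otimes> e" for v y j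
    using that(1)
  proof (induction j arbitrary: v)
    case (Suc j)
    then obtain v' e where *: "v = v' \<oplus> e \<otimes> z [^] j" "v' \<in> ?S j" "e \<in> E" by (auto simp: left_span.simps(2))
    have C: "v' \<in> carrier D" "e \<in> carrier D" "z [^] j \<in> carrier D" using * carr Er z by auto
    have "e \<otimes> z [^] j \<otimes> y = e \<otimes> (y \<otimes> z [^] j)"
      using C y group_commutes_pow[OF y(2) z(1) y(1), of j] by (simp add: m_assoc)
    also have "\<dots> = y \<otimes> (e \<otimes> z [^] j)" using C y(1) y(3)[OF *(3)] by (simp add: m_assoc[symmetric])
    finally show ?case unfolding *(1) using Suc.IH[OF *(2)] C y(1) by (simp add: l_distr r_distr)
  qed (use y in simp)
  have commutative: "v \<otimes> w = w \<otimes> v" if v: "v \<in> ?S l" and w: "w \<in> ?S l" for v w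
  proof (rule commute[OF v])
    show "w \<in> carrier D" using carr w .
    show "z \<otimes> w = w \<otimes> z" using commute[OF w z(1) refl] comm by simp
    show "e \<otimes> w = w \<otimes> e" if e: "e \<in> E" for e
      using commute[OF w, of e] comm[OF e] subfieldE(4)[OF E(1)] e Er by (metis subsetD)
  qed
  have sub: "subring (?S l) D"
  proof (rule subringI)
    show "?S l \<subseteq> carrier D" using carr by blast
    show "\<one> \<in> ?S l" using E1 Er by blast
    show "\<ominus> v \<in> ?S l" if "v \<in> ?S l" for v
      using smult[OF that, of "\<ominus> \<one>"] Er carr[OF that] by (simp add: l_minus)
  qed (use add mult in blast)+
  show "subfield (?S l) D"
  proof (rule subfield_if_inv_closed[OF sub commutative])
    fix v assume v: "v \<in> ?S l" "v \<noteq> \<zero>"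
    have vC: "v \<in> carrier D" using carr v by blast
    have pow_v: "v [^] (i::nat) \<in> ?S l" for i
      by (induction i) (use E1 Er mult v in auto)
    obtain k :: nat where k: "k > 0" "v [^] k = \<one>"
      using pow_eq_one_if_finite[OF vC v(2) left_span_finite[OF ring_E z(1) swap E(2)] pow_v] by blast
    have "v \<otimes> v [^] (k - 1) = v \<otimes> inv v"
      using k vC v nat_pow_Suc2[OF vC, of "k - 1"] by simp
    then have "v [^] (k - 1) = inv v" by (rule left_cancel) (use v vC in auto)
    then show "inv v \<in> ?S l" using pow_v by metis
  qed
  show "E \<subseteq> ?S l" by (rule E1)
  show "z \<in> ?S l" using pow[of 1] z by simp
qed

text \<open>Let \<open>m\<close> be the order of the automorphism of \<open>E\<close> induced by
  \<open>x\<close>. The norm argument wants \<open>x^m\<close> in the field, so \<open>E\<close> is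
  enlarged by this power, which commutes with \<open>E\<close> and with \<open>x\<close>; torsion of
  \<open>x\<close> keeps the larger field finite, and \<open>x\<close> still normalizes it.\<close>

lemma torsion_normalizer_commutes:
  assumes E: "subfield E D" "finite E" and x: "x \<in> carrier D" "x \<noteq> \<zero>"
    and normalizes: "\<And>e. e \<in> E \<Longrightarrow> x \<otimes> e \<otimes> inv x \<in> E"
    and l: "(l::nat) > 0" "x [^] l = \<one>" and u: "u \<in> E"
  shows "x \<otimes> u = u \<otimes> x"
proof (rule ccontr)
  assume noncomm: "x \<otimes> u \<noteq> u \<otimes> x"
  note ring_E = subfieldE(1)[OF E(1)]
  note Er = subringE[OF ring_E]
  let ?P = "\<lambda>m::nat. m > 0 \<and> (\<forall>e \<in> E. x [^] m \<otimes> e = e \<otimes> x [^] m)"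
  define m where "m = (LEAST m. ?P m)"
  have "?P l" using l Er by auto
  then have m: "m > 0" "\<And>e. e \<in> E \<Longrightarrow> x [^] m \<otimes> e = e \<otimes> x [^] m"
    using LeastI[of ?P l] unfolding m_def by blast+
  have least: "\<exists>e \<in> E. x [^] i \<otimes> e \<noteq> e \<otimes> x [^] i" if "0 < i" "i < m" for i
    using not_less_Least[of i ?P] that unfolding m_def by blast
  define c where "c = x [^] m"
  have c: "c \<in> carrier D" "c \<noteq> \<zero>" unfolding c_def using x pow_zero_iff[of x m] by auto
  have cl: "c [^] l = \<one>"
    unfolding c_def nat_pow_pow[OF x(1)] using l(2) nat_pow_pow[OF x(1), of l m] by (simp add: mult.commute)
  define E' where "E' = left_span E c l"
  note E' = left_span_subfield[OF E c m(2)[folded c_def] l(1) cl, folded E'_def]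
  have swap: "\<exists>e' \<in> E. c \<otimes> e = e' \<otimes> c" if "e \<in> E" for e using m(2)[OF that] that unfolding c_def by blast
  have cx: "x \<otimes> c = c \<otimes> x" unfolding c_def using nat_pow_Suc2[OF x(1), of m] by simp
  have "x \<otimes> v \<otimes> inv x \<in> left_span E c j" if "v \<in> left_span E c j" for v j
    using that
  proof (induction j arbitrary: v)
    case (Suc j)
    then obtain v' e where *: "v = v' \<oplus> e \<otimes> c [^] j" "v' \<in> left_span E c j" "e \<in> E" by (auto simp: left_span.simps(2))
    have C: "v' \<in> carrier D" "e \<in> carrier D" "c [^] j \<in> carrier D" "inv x \<in> carrier D"
      using * left_span_carrier[OF ring_E c(1) swap] Er c x by auto
    have "c [^] j \<otimes> inv x = inv x \<otimes> c [^] j"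
    proof (rule group_commutes_pow[OF _ c(1) C(4)])
      have "inv x \<otimes> (x \<otimes> c) \<otimes> inv x = inv x \<otimes> (c \<otimes> x) \<otimes> inv x" using cx by simp
      then show "c \<otimes> inv x = inv x \<otimes> c" using c x by (simp add: m_assoc)
    qed
    then have "x \<otimes> (e \<otimes> c [^] j) \<otimes> inv x = (x \<otimes> e \<otimes> inv x) \<otimes> c [^] j" using C x by (simp add: m_assoc)
    moreover have "x \<otimes> v \<otimes> inv x = x \<otimes> v' \<otimes> inv x \<oplus> x \<otimes> (e \<otimes> c [^] j) \<otimes> inv x"
      unfolding *(1) using C x by algebra
    ultimately show ?case using left_span_SucI[OF Suc.IH[OF *(2)] normalizes[OF *(3)]] by simp
  qed (use x in simp)
  then have "x \<otimes> v \<otimes> inv x \<in> E'" if "v \<in> E'" for v using that unfolding E'_def by blast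
  moreover have "finite E'" unfolding E'_def by (rule left_span_finite[OF ring_E c(1) swap E(2)])
  ultimately show False
    using finite_field_norm_contradiction[OF E'(1) _ x _ m(1) E'(3)[unfolded c_def]] least u E'(2) noncomm
    by blast
qed

end

context noncentral_normal_subgroup
begin

lemma infinite_center:
  assumes alg: "\<And>n. n \<in> N \<Longrightarrow> dependent center (exp_base n (Suc d))"
  shows "infinite center"
proof
  assume fin: "finite center"
  \<comment> \<open>The field generated by \<open>n\<close> is finite along with the center. A
    single relation \<open>x n = b x\<close> with \<open>b\<close> in that field already makes
    \<open>x\<close> normalize all of it, since powers of \<open>n\<close> span it over the
    center.\<close>
  have field_ex: "\<exists>E. subfield E D \<and> finite E \<and> n \<in> E \<and>
      (\<forall>x \<in> carrier D. \<forall>b \<in> E. x \<otimes> n = b \<otimes> x \<longrightarrow> (\<forall>e \<in> E. \<exists>e' \<in> E. x \<otimes> e = e' \<otimes> x))" if n: "n \<in> N" for n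
  proof -
    have nC: "n \<in> carrier D" using N_carrier_nonzero n by blast
    obtain r where r: "independent center (exp_base n r)" "dependent center (exp_base n (Suc r))"
      using minimal_dependence[OF alg[OF n]] by blast
    define E where "E = Span center (exp_base n r)"
    note E = Span_exp_base[OF nC r, folded E_def]
    note Er = subringE[OF subfieldE(1)[OF E(1)]]
    have U: "set (exp_base n r) \<subseteq> carrier D" using nC by (auto simp: exp_base_set)
    have "\<exists>e' \<in> E. x \<otimes> e = e' \<otimes> x" if x: "x \<in> carrier D" and b: "b \<in> E" "x \<otimes> n = b \<otimes> x" and e: "e \<in> E" for x b e
      using e[unfolded E_def] U
    proof (induction e rule: Span_induct)
      case zero
      then show ?case using x Er by (intro bexI[of _ \<zero>]) auto
    next
      case (add k u v)
      then obtain v' where v': "v' \<in> E" "x \<otimes> v = v' \<otimes> x" by blast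
      obtain i :: nat where i: "u = n [^] i" using add by (auto simp: exp_base_set)
      have bC: "b \<in> carrier D" "v' \<in> carrier D" using b v' Er by auto
      have "x \<otimes> n [^] i = b [^] i \<otimes> x"
      proof (induction i)
        case (Suc i)
        have "x \<otimes> n [^] Suc i = x \<otimes> n [^] i \<otimes> n" using x nC by (simp add: m_assoc)
        also have "\<dots> = b [^] i \<otimes> (x \<otimes> n)" using Suc x nC bC by (simp add: m_assoc)
        finally show ?case unfolding b(2) using x bC by (simp add: m_assoc)
      qed (use x in simp)
      then have "x \<otimes> (k \<otimes> u \<oplus> v) = (k \<otimes> b [^] i \<oplus> v') \<otimes> x"
        using add v' i bC x nC center_swap[OF add(1) x, of u] by (simp add: r_distr l_distr m_assoc)
      moreover have "b [^] j \<in> E" for j :: nat by (induction j) (use Er b in auto)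
      then have "k \<otimes> b [^] i \<oplus> v' \<in> E" using Er(6,7) E(2) add(1) v' by blast
      ultimately show ?case by blast
    qed
    moreover have "finite E" unfolding E_def using finite_Span_center[OF fin U] .
    ultimately show ?thesis using E by blast
  qed
  obtain u y where u: "u \<in> N" and y: "y \<in> carrier D" "y \<otimes> u \<noteq> u \<otimes> y"
    using noncentral N_carrier_nonzero unfolding ring_center_def by force
  have uC: "u \<in> carrier D" "u \<noteq> \<zero>" using N_carrier_nonzero u by auto
  obtain E where E: "subfield E D" "finite E" "u \<in> E" and
    normal: "\<And>x b e. \<lbrakk>x \<in> carrier D; b \<in> E; x \<otimes> u = b \<otimes> x; e \<in> E\<rbrakk> \<Longrightarrow> \<exists>e' \<in> E. x \<otimes> e = e' \<otimes> x"
    using field_ex[OF u] by blast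
  note Er = subringE[OF subfieldE(1)[OF E(1)]]
  have EC: "e \<in> carrier D" if "e \<in> E" for e using that Er by auto
  obtain x b where x: "x \<in> carrier D" "x \<noteq> \<zero>" and b: "b \<in> E" "b \<noteq> u" "x \<otimes> u = b \<otimes> x"
    using conjugating_element[OF E y] by blast
  have bC: "b \<in> carrier D" using EC b by blast
  define z where "z = inv x"
  have z: "z \<in> carrier D" "z \<noteq> \<zero>" unfolding z_def using x by auto
  define \<sigma> where "\<sigma> e = x \<otimes> e \<otimes> inv x" for e
  have \<sigma>E: "\<sigma> e \<in> E" if e: "e \<in> E" for e
  proof -
    obtain e' where "e' \<in> E" "x \<otimes> e = e' \<otimes> x" using normal[OF x(1) b(1,3) e] by blast
    then show ?thesis unfolding \<sigma>_def using x EC by (simp add: m_assoc)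
  qed
  have "inj_on \<sigma> E"
  proof (rule inj_onI)
    fix e f assume ef: "e \<in> E" "f \<in> E" "\<sigma> e = \<sigma> f"
    have "x \<otimes> e = x \<otimes> f" using ef(3) unfolding \<sigma>_def
      by (rule right_cancel) (use x EC ef in auto)
    then show "e = f" by (rule left_cancel) (use x EC ef in auto)
  qed
  \<comment> \<open>Finiteness makes the injective \<open>\<sigma>\<close> onto, which passes the
    normalizing property from \<open>x\<close> to its inverse \<open>z\<close>.\<close>
  then have surj: "\<sigma> ` E = E" using endo_inj_surj[OF E(2)] \<sigma>E by blast
  have swap: "\<exists>e' \<in> E. z \<otimes> e = e' \<otimes> z" if e: "e \<in> E" for e
  proof -
    obtain e' where e': "e' \<in> E" "e = \<sigma> e'" using surj e by blast
    have "z \<otimes> e = e' \<otimes> z" unfolding e'(2) \<sigma>_def z_def using x EC[OF e'(1)] by (simp add: m_assoc)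
    then show ?thesis using e' by blast
  qed
  define x1 where "x1 = \<one> \<oplus> x"
  have x1: "x1 \<in> carrier D" "x1 \<noteq> \<zero>"
  proof -
    show "x1 \<in> carrier D" unfolding x1_def using x by simp
    show "x1 \<noteq> \<zero>"
    proof
      assume "x1 = \<zero>"
      then have "x = \<ominus> \<one>" unfolding x1_def using x by (metis minus_equality one_closed a_comm)
      then have "\<ominus> u = \<ominus> b" using b(3) uC bC by (simp add: l_minus r_minus)
      then have "u = b" using uC bC minus_minus by metis
      then show False using b by blast
    qed
  qed
  define n where "n = x1 \<otimes> u \<otimes> inv x1 \<otimes> inv u"
  have n: "n \<in> N" "n \<in> carrier D" unfolding n_def using N_mult N_conj N_inv N_carrier_nonzero u x1 by auto
  define g where "g = inv (b \<ominus> u)"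
  have bu: "b \<ominus> u \<in> E - {\<zero>}" "b \<ominus> u \<in> carrier D"
    using Er(5,7) b E(3) minus_eq_zero_iff[OF bC uC(1)] bC uC by (auto simp: minus_eq)
  have g: "g \<in> E" "g \<noteq> \<zero>" "g \<in> carrier D"
    unfolding g_def using subfield_m_inv(1)[OF E(1) bu(1)] EC by auto
  \<comment> \<open>\<open>n - 1\<close> equals \<open>(b - u) x x1^{-1} u^{-1}\<close>, so its
    inverse is \<open>u x1 z g\<close> with \<open>x1 z = z + 1\<close>. Inverting removes the
    inverse of \<open>x1\<close> and leaves an expression of degree one in \<open>z\<close> over
    \<open>E\<close>, whose powers stay in the finite field of \<open>n\<close>.\<close>
  define w where "w = u \<otimes> (z \<oplus> \<one>) \<otimes> g"
  have wC: "w \<in> carrier D" unfolding w_def using uC z g by simp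
  have nw: "(n \<ominus> \<one>) \<otimes> w = \<one>"
  proof -
    have "n \<ominus> \<one> = (b \<ominus> u) \<otimes> x \<otimes> inv x1 \<otimes> inv u"
    proof -
      have "x1 \<otimes> u = u \<otimes> x1 \<oplus> (b \<ominus> u) \<otimes> x"
      proof -
        have "x1 \<otimes> u = \<one> \<otimes> u \<oplus> b \<otimes> x" unfolding x1_def b(3)[symmetric] using x uC by (simp add: l_distr)
        also have "\<dots> = u \<otimes> \<one> \<oplus> b \<otimes> x" using uC by simp
        also have "\<dots> = u \<otimes> (\<one> \<oplus> x) \<oplus> (b \<ominus> u) \<otimes> x" using x uC bC one_closed by algebra
        finally show ?thesis by (simp add: x1_def)
      qed
      then have "n = (u \<otimes> x1 \<oplus> (b \<ominus> u) \<otimes> x) \<otimes> (inv x1 \<otimes> inv u)"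
        unfolding n_def using x1 uC bu(2) x by (simp add: m_assoc)
      also have "\<dots> = u \<otimes> x1 \<otimes> (inv x1 \<otimes> inv u) \<oplus> (b \<ominus> u) \<otimes> x \<otimes> (inv x1 \<otimes> inv u)"
        using x1 uC bu(2) x by (intro l_distr) auto
      also have "u \<otimes> x1 \<otimes> (inv x1 \<otimes> inv u) = \<one>" using x1 uC by (simp add: m_assoc)
      finally have eq: "n = \<one> \<oplus> (b \<ominus> u) \<otimes> x \<otimes> (inv x1 \<otimes> inv u)" .
      define h where "h = (b \<ominus> u) \<otimes> x \<otimes> (inv x1 \<otimes> inv u)"
      have hC: "h \<in> carrier D" unfolding h_def using bu(2) x x1 uC by simp
      have "n \<ominus> \<one> = h" unfolding eq h_def[symmetric] using hC one_closed by algebra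
      then show ?thesis unfolding h_def using bu(2) x x1 uC by (simp add: m_assoc)
    qed
    moreover have "x \<otimes> inv x1 \<otimes> (z \<oplus> \<one>) = \<one>"
    proof -
      have "x1 \<otimes> z = z \<oplus> \<one>" unfolding x1_def z_def using x by (simp add: l_distr)
      then have "x \<otimes> inv x1 \<otimes> (z \<oplus> \<one>) = x \<otimes> inv x1 \<otimes> (x1 \<otimes> z)" by simp
      also have "\<dots> = \<one>" unfolding z_def using x x1 by (simp add: m_assoc)
      finally show ?thesis .
    qed
    moreover have "(b \<ominus> u) \<otimes> x \<otimes> inv x1 \<otimes> inv u \<otimes> w = (b \<ominus> u) \<otimes> (x \<otimes> inv x1 \<otimes> (z \<oplus> \<one>)) \<otimes> g"
      unfolding w_def using bu(2) x x1 uC z g by (simp add: m_assoc)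
    ultimately show ?thesis using bu g(3) by (simp add: g_def)
  qed
  obtain L where L: "subfield L D" "finite L" "n \<in> L" using field_ex[OF n(1)] by blast
  note Lr = subringE[OF subfieldE(1)[OF L(1)]]
  have n1: "n \<ominus> \<one> \<in> L" using Lr(3,5,7) L(3) by (simp add: minus_eq)
  have n1': "n \<ominus> \<one> \<noteq> \<zero>" "n \<ominus> \<one> \<in> carrier D"
  proof
    assume "n \<ominus> \<one> = \<zero>"
    from nw[unfolded this] show False using wC by simp
  qed (use n(2) in simp)
  have "inv (n \<ominus> \<one>) = w"
  proof -
    have "(n \<ominus> \<one>) \<otimes> inv (n \<ominus> \<one>) = (n \<ominus> \<one>) \<otimes> w" using nw n1' by simp
    then show ?thesis by (rule left_cancel) (use n1' wC in auto)
  qed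
  then have "w \<in> L" using subfield_m_inv(1)[OF L(1)] n1 n1' by auto
  then have pow_w: "w [^] (i::nat) \<in> L" for i by (induction i) (use Lr in auto)
  obtain g' where g': "g' \<in> E" "z \<otimes> g = g' \<otimes> z" using swap[OF g(1)] by blast
  have g'C: "g' \<in> carrier D" using EC g' by blast
  have "g' \<noteq> \<zero>"
  proof
    assume "g' = \<zero>"
    then have "z \<otimes> g = \<zero>" using g' z by simp
    then show False using integral_iff z g by simp
  qed
  then have e1: "u \<otimes> g' \<in> E" "u \<otimes> g' \<noteq> \<zero>" using Er(6) E(3) g' integral_iff uC g'C by auto
  have "w = u \<otimes> g' \<otimes> z \<oplus> u \<otimes> g"
    unfolding w_def using uC z g g'C g'(2) by (simp add: l_distr r_distr m_assoc)
  then obtain k :: nat where k: "k > 0" "z [^] k = \<one>"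
    using torsion_of_linear_combination[OF E(1,2) z swap e1 _ L(2)] pow_w Er(6)[OF E(3) g(1)] by metis
  have "x [^] k = \<one>"
  proof -
    have "x [^] k \<otimes> z [^] k = (x \<otimes> z) [^] k"
      using x z by (intro pow_mult_distrib[symmetric]) (auto simp: z_def)
    moreover have "x \<otimes> z = \<one>" unfolding z_def using x by simp
    ultimately show ?thesis using k x by simp
  qed
  then have "x \<otimes> u = u \<otimes> x"
    using torsion_normalizer_commutes[OF E(1,2) x \<sigma>E[unfolded \<sigma>_def] k(1) _ E(3)] by blast
  then have "b \<otimes> x = u \<otimes> x" using b(3) by simp
  then have "b = u" by (rule right_cancel) (use x bC uC in auto)
  then show False using b by blast
qed

end

theorem theorem5p5:
  fixes D :: "('a, 'b) ring_scheme" and K N :: "'a set" and d :: nat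
  assumes "skew_field D"
    and "subfield K D"
    and "d > 0"
    and "N \<lhd> units_of D"
    and "\<not> N \<subseteq> ring_center D"
    and "ring.left_algebraic_of_bounded_degree D d K N"
  shows "ring.finite_dimension D (ring_center D) (carrier D) \<and>
         ring.dim D (ring_center D) (carrier D) \<le> d\<^sup>2"
proof -
  interpret noncentral_normal_subgroup D N
    using assms(1,4,5)
    by (simp add: noncentral_normal_subgroup_def noncentral_normal_subgroup_axioms_def
        skew_field_normal_subgroup_def skew_field_normal_subgroup_axioms_def)
  have alg: "dependent (ring_center D) (exp_base n (Suc d))" if "n \<in> N" for n
    using N_dependent[OF assms(2,6) that] .
  obtain n where n: "n \<le> d\<^sup>2" "dimension n (ring_center D) (carrier D)"
    using infinite_center_dimension[OF infinite_center[OF alg] alg] by blast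
  then have "dim (ring_center D) (carrier D) = n"
    using dimI[OF ring_center_subfield n(2)] by (simp add: over_def)
  then show ?thesis using n finite_dimensionI by blast
qed

end
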